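(* 1) Let $L$ be a collection of subspaces of a linear space which is obtained from a brick collection of one-dimensional subspaces by finitely many operations, each of which is either adding a copy of one of the subspaces, i.e. replacing $(V;V_1,\ldots,V_n)$ by $(V;V_1,\ldots,V_n,V_k)$ for some $1\le k\le n$, or applying one of the Coxeter functors $\Phi^+$, $\Phi^-$. Then $L$ can be unitarized with some character. 2) In particular, every brick quadruple of subspaces $(V;V_1,V_2,V_3,V_4)$ can be unitarized with some character.
   Context: All linear spaces are finite dimensional over $\mathbb{C}$. A collection (system) of subspaces $L=(V;V_1,\ldots,V_n)$ consists of a linear space $V$ and subspaces $V_1,\ldots,V_n\subset V$ (a quadruple if $n=4$). It is called brick if every linear operator $X:V\to V$ with $X(V_i)\subset V_i$ for all $i$ is a scalar multiple of the identity. A brick collection of one-dimensional subspaces is a brick collection with $\dim V_i=1$ for all $i$. A character is a tuple $\chi=(a_0;a_1,\ldots,a_n)$ of real numbers with $a_0\ge 0$ and $a_k>0$ for $1\le k\le n$. The collection $L$ can be unitarized with the character $\chi$ if $V$ can be endowed with a Hermitian scalar product such that $\sum_{k=1}^n a_kP_k=a_0I$, where $P_k$ is the orthogonal projection of $V$ onto $V_k$ with respect to this scalar product. Coxeter functors (Gelfand–Ponomarev). For $L=(V;V_1,\ldots,V_n)$, $\Phi^+L=(V^+;V_1^+,\ldots,V_n^+)$ where $V^+=\{(\xi_1,\ldots,\xi_n)\in V_1\oplus\cdots\oplus V_n:\ \xi_1+\cdots+\xi_n=0\}$ and $V_i^+=\{(\xi_1,\ldots,\xi_n)\in V^+:\ \xi_i=0\}$.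 Dually, $\Phi^-L=(V^-;V_1^-,\ldots,V_n^-)$ where $V^-$ is the quotient of $V/V_1\oplus\cdots\oplus V/V_n$ by the image of the map $v\mapsto (v+V_1,\ldots,v+V_n)$, $v\in V$, and $V_i^-$ is the image in $V^-$ of the summand $V/V_i$. *)

theory Defs
  imports Complex_Main "HOL-Algebra.AbelCoset" "Jordan_Normal_Form.VS_Connect"
begin

text \<open>A collection \<open>(V; V\<^sub>1, \<dots>, V\<^sub>n)\<close> is a pair of a complex vector space with explicit carrier
  and a list of subsets of that carrier; \<open>V\<^sub>i\<close> is the list entry with index \<open>i - 1\<close>.
  The ring operations \<open>mult\<close> and \<open>one\<close> of the module record carry no information.\<close>

type_synonym 'a collection = "(complex, 'a) module \<times> 'a set list"

abbreviation complex_field :: "complex ring" where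
  "complex_field \<equiv> class_ring"

fun collection :: "'a collection \<Rightarrow> bool" where
  "collection (V, Us) \<longleftrightarrow>
     vectorspace complex_field V \<and> vectorspace.fin_dim complex_field V \<and>
     (\<forall>U \<in> set Us. VectorSpace.subspace complex_field U V)"

fun brick :: "'a collection \<Rightarrow> bool" where
  "brick (V, Us) \<longleftrightarrow>
     collection (V, Us) \<and>
     (\<forall>X. linear_map complex_field V V X \<and> (\<forall>U \<in> set Us. X ` U \<subseteq> U) \<longrightarrow>
        (\<exists>c. \<forall>v \<in> carrier V. X v = c \<odot>\<^bsub>V\<^esub> v))"

fun one_dimensional :: "'a collection \<Rightarrow> bool" where
  "one_dimensional (V, Us) \<longleftrightarrow>
     (\<forall>U \<in> set Us. vectorspace.dim complex_field (V\<lparr>carrier := U\<rparr>) = 1)"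


subsection \<open>Unitarization\<close>

definition hermitian_product :: "(complex, 'a) module \<Rightarrow> ('a \<Rightarrow> 'a \<Rightarrow> complex) \<Rightarrow> bool" where
  "hermitian_product V ip \<longleftrightarrow>
     (\<forall>u \<in> carrier V. \<forall>v \<in> carrier V. \<forall>w \<in> carrier V.
        ip (u \<oplus>\<^bsub>V\<^esub> v) w = ip u w + ip v w) \<and>
     (\<forall>c. \<forall>u \<in> carrier V. \<forall>w \<in> carrier V. ip (c \<odot>\<^bsub>V\<^esub> u) w = c * ip u w) \<and>
     (\<forall>u \<in> carrier V. \<forall>w \<in> carrier V. ip w u = cnj (ip u w)) \<and>
     (\<forall>v \<in> carrier V. v \<noteq> \<zero>\<^bsub>V\<^esub> \<longrightarrow> 0 < Re (ip v v))"

text \<open>For a Hermitian product on a finite-dimensional space and a subspace \<open>U\<close> there is exactly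
  one such \<open>u\<close> for every vector \<open>v\<close>.\<close>

definition orthogonal_projection ::
    "(complex, 'a) module \<Rightarrow> ('a \<Rightarrow> 'a \<Rightarrow> complex) \<Rightarrow> 'a set \<Rightarrow> 'a \<Rightarrow> 'a" where
  "orthogonal_projection V ip U v =
     (THE u. u \<in> U \<and> (\<forall>w \<in> U. ip (v \<ominus>\<^bsub>V\<^esub> u) w = 0))"

text \<open>A character \<open>(a\<^sub>0; a\<^sub>1, \<dots>, a\<^sub>n)\<close> is the pair of \<open>a\<^sub>0\<close> and the list \<open>[a\<^sub>1, \<dots>, a\<^sub>n]\<close>.\<close>

fun character :: "nat \<Rightarrow> real \<times> real list \<Rightarrow> bool" where
  "character n (a0, as) \<longleftrightarrow> length as = n \<and> 0 \<le> a0 \<and> (\<forall>a \<in> set as. 0 < a)"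

fun unitarized_with :: "'a collection \<Rightarrow> real \<times> real list \<Rightarrow> bool" where
  "unitarized_with (V, Us) (a0, as) \<longleftrightarrow>
     character (length Us) (a0, as) \<and>
     (\<exists>ip. hermitian_product V ip \<and>
        (\<forall>v \<in> carrier V.
           (\<Oplus>\<^bsub>V\<^esub>k \<in> {..<length Us}.
              complex_of_real (as ! k) \<odot>\<^bsub>V\<^esub> orthogonal_projection V ip (Us ! k) v)
           = complex_of_real a0 \<odot>\<^bsub>V\<^esub> v))"


subsection \<open>Direct sums and quotients\<close>

definition direct_sum_space ::
    "nat \<Rightarrow> (nat \<Rightarrow> (complex, 'a) module) \<Rightarrow> (complex, nat \<Rightarrow> 'a) module" where
  "direct_sum_space n M =
     \<lparr>carrier = (\<Pi>\<^sub>E i \<in> {..<n}. carrier (M i)),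
      mult = undefined, one = undefined,
      zero = (\<lambda>i \<in> {..<n}. \<zero>\<^bsub>M i\<^esub>),
      add = (\<lambda>x y. \<lambda>i \<in> {..<n}. x i \<oplus>\<^bsub>M i\<^esub> y i),
      smult = (\<lambda>c x. \<lambda>i \<in> {..<n}. c \<odot>\<^bsub>M i\<^esub> x i)\<rparr>"

text \<open>The elements of \<open>V/U\<close> are the cosets of \<open>U\<close>; adding \<open>U\<close> in the scalar multiplication
  makes \<open>0\<close> times a coset the coset \<open>U\<close>.\<close>

definition quotient_space ::
    "(complex, 'a) module \<Rightarrow> 'a set \<Rightarrow> (complex, 'a set) module" where
  "quotient_space V U =
     \<lparr>carrier = a_rcosets\<^bsub>V\<^esub> U,
      mult = undefined, one = undefined,
      zero = U,
      add = (\<lambda>A B. A <+>\<^bsub>V\<^esub> B),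
      smult = (\<lambda>c A. \<Union>x \<in> A. U +>\<^bsub>V\<^esub> (c \<odot>\<^bsub>V\<^esub> x))\<rparr>"


subsection \<open>Coxeter functors\<close>

fun Phi_plus_space :: "'a collection \<Rightarrow> (complex, nat \<Rightarrow> 'a) module" where
  "Phi_plus_space (V, Us) =
     (let S = direct_sum_space (length Us) (\<lambda>i. V\<lparr>carrier := Us ! i\<rparr>)
      in S\<lparr>carrier := {\<xi> \<in> carrier S. (\<Oplus>\<^bsub>V\<^esub>i \<in> {..<length Us}. \<xi> i) = \<zero>\<^bsub>V\<^esub>}\<rparr>)"

fun Phi_plus :: "'a collection \<Rightarrow> (nat \<Rightarrow> 'a) collection" where
  "Phi_plus (V, Us) =
     (Phi_plus_space (V, Us),
      map (\<lambda>i. {\<xi> \<in> carrier (Phi_plus_space (V, Us)). \<xi> i = \<zero>\<^bsub>V\<^esub>}) [0..<length Us])"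

fun Phi_minus :: "'a collection \<Rightarrow> (nat \<Rightarrow> 'a set) set collection" where
  "Phi_minus (V, Us) =
     (let n = length Us;
          S = direct_sum_space n (\<lambda>i. quotient_space V (Us ! i));
          D = (\<lambda>v. \<lambda>i \<in> {..<n}. Us ! i +>\<^bsub>V\<^esub> v) ` carrier V
      in (quotient_space S D,
          map (\<lambda>i. (\<lambda>\<xi>. D +>\<^bsub>S\<^esub> \<xi>) `
                 {\<xi> \<in> carrier S. \<forall>j < n. j \<noteq> i \<longrightarrow> \<xi> j = \<zero>\<^bsub>quotient_space V (Us ! j)\<^esub>})
            [0..<n]))"


subsection \<open>Collections generated by Coxeter functors and by copying\<close>

definition isomorphic :: "'a collection \<Rightarrow> 'b collection \<Rightarrow> bool" where
  "isomorphic L L' \<longleftrightarrow>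
     (\<exists>h. linear_map complex_field (fst L) (fst L') h \<and>
          bij_betw h (carrier (fst L)) (carrier (fst L')) \<and>
          snd L' = map ((`) h) (snd L))"

text \<open>The functors change the type of vectors, so their values are transported back to type \<open>'a\<close>
  along an arbitrary isomorphism. This excludes nothing: a type carrying a nonzero complex vector
  space has at least continuum many elements, and so carries a copy of every finite-dimensional
  complex vector space.\<close>

inductive generated :: "'a collection \<Rightarrow> bool" where
  lines: "brick L \<Longrightarrow> one_dimensional L \<Longrightarrow> generated L"
| copy: "generated (V, Us) \<Longrightarrow> k < length Us \<Longrightarrow> generated (V, Us @ [Us ! k])"
| plus: "generated L \<Longrightarrow> isomorphic (Phi_plus L) L' \<Longrightarrow> generated L'"
| minus: "generated L \<Longrightarrow> isomorphic (Phi_minus L) L' \<Longrightarrow> generated L'"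

end

theory Submission
  imports Defs "HOL-Library.Nat_Bijection"
begin

text \<open>
  A collection of lines that spans its space can always be unitarized: choosing positive weights
  determines the inverse of the scalar product (\<open>unitarizable_lines\<close>). A brick collection of lines
  spans, up to the case of no lines at all. Adding a copy of a subspace splits its coefficient. For
  the Coxeter functors, write the identity \<open>\<Sum> a\<^sub>k P\<^sub>k = a\<^sub>0\<close> as \<open>\<sigma>\<sigma>\<^sup>* = a\<^sub>0\<close>, where \<open>\<sigma>\<close> is the
  summation map of the weighted direct sum of the subspaces. Then \<open>1 - \<sigma>\<^sup>*\<sigma> / a\<^sub>0\<close> is the projection
  onto the kernel of \<open>\<sigma>\<close>, which is the space of \<open>\<Phi>\<^sup>+\<close>, and the projections onto the summands,
  compressed to this kernel, are multiples of projections that add up to the identity. This unitarizes \<open>\<Phi>\<^sup>+\<close>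
  (\<open>unitarizable_kernel\<close>); the same argument with the complementary projections unitarizes \<open>\<Phi>\<^sup>-\<close>
  (\<open>unitarizable_cokernel\<close>).

  For a brick quadruple on a space of dimension \<open>d \<ge> 2\<close> the proof goes by induction on \<open>d\<close>. An operator
  of rank one cannot preserve all four subspaces; hence each subspace lies in the sum of the others
  and contains the intersection of the others, and so the quadruple is \<open>\<Phi>\<^sup>-\<Phi>\<^sup>+\<close> and \<open>\<Phi>\<^sup>+\<Phi>\<^sup>-\<close> of itself, with bricks
  in between. If the dimensions of the four subspaces do not add up to \<open>2 d\<close>, one of the two functors
  lowers the dimension and the other one leads back. If they do add up to \<open>2 d\<close>, the absence of
  endomorphisms of rank one forces all four dimensions to be \<open>d / 2\<close>, and explicit endomorphisms of rank at most two force
  \<open>d = 2\<close> (\<open>mixed_dim\<close>, \<open>generic_dim\<close>). The four subspaces are then lines.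

  Records of vector spaces are awkward to compute with, and an induction cannot change the type of
  vectors. All linear algebra is therefore done with subspaces of one space of complex sequences,
  which contains its own countable powers. A presentation transports a collection there, and
  subspaces, direct sums and quotients of presented spaces are presented again.
\<close>

section \<open>The ambient space of complex sequences\<close>

datatype cseq = Cseq (coord: "nat \<Rightarrow> complex")

lemma cseq_eqI: "(\<And>i. coord x i = coord y i) \<Longrightarrow> x = y"
  by (rule cseq.expand) auto

instantiation cseq :: ab_group_add
begin

definition "0 = Cseq (\<lambda>i. 0)"
definition "x + y = Cseq (\<lambda>i. coord x i + coord y i)"
definition "- x = Cseq (\<lambda>i. - coord x i)"
definition "x - y = Cseq (\<lambda>i. coord x i - coord y i)"

instance
  by standard (auto simp: zero_cseq_def plus_cseq_def uminus_cseq_def minus_cseq_def algebra_simps)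

end

definition scl :: "complex \<Rightarrow> cseq \<Rightarrow> cseq" where
  "scl c x = Cseq (\<lambda>i. c * coord x i)"

lemma coord_simps [simp]:
  "coord 0 i = 0" "coord (x + y) i = coord x i + coord y i" "coord (- x) i = - coord x i"
  "coord (x - y) i = coord x i - coord y i" "coord (scl c x) i = c * coord x i"
  by (simp_all add: zero_cseq_def plus_cseq_def uminus_cseq_def minus_cseq_def scl_def)

lemma scl_vector_space: "vector_space scl"
  by unfold_locales (auto intro!: cseq_eqI simp: algebra_simps)

lemma times_vector_space: "vector_space ((*) :: complex \<Rightarrow> complex \<Rightarrow> complex)"
  by unfold_locales (auto simp: algebra_simps)

interpretation cs: vector_space scl
  by (rule scl_vector_space)

interpretation cp: vector_space_pair scl scl
  by (intro vector_space_pair.intro scl_vector_space)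

interpretation cf: vector_space_pair scl "(*) :: complex \<Rightarrow> complex \<Rightarrow> complex"
  by (intro vector_space_pair.intro scl_vector_space times_vector_space)

abbreviation lin :: "(cseq \<Rightarrow> cseq) \<Rightarrow> bool" where
  "lin \<equiv> Vector_Spaces.linear scl scl"

abbreviation functional :: "(cseq \<Rightarrow> complex) \<Rightarrow> bool" where
  "functional \<equiv> Vector_Spaces.linear scl (*)"

lemma linI: "(\<And>x y. f (x + y) = f x + f y) \<Longrightarrow> (\<And>c x. f (scl c x) = scl c (f x)) \<Longrightarrow> lin f"
  by (simp add: Vector_Spaces.linear_iff scl_vector_space times_vector_space)

lemma functionalI:
  "(\<And>x y. f (x + y) = f x + f y) \<Longrightarrow> (\<And>c x. f (scl c x) = c * f x) \<Longrightarrow> functional f"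
  by (simp add: Vector_Spaces.linear_iff scl_vector_space times_vector_space)

lemmas lin_simps = cp.linear_add cp.linear_diff cp.linear_scale cp.linear_0 cp.linear_neg cp.linear_sum
lemmas functional_simps = cf.linear_add cf.linear_diff cf.linear_scale cf.linear_0 cf.linear_neg cf.linear_sum

named_theorems lin_intros

lemma lin_id [lin_intros]: "lin (\<lambda>x. x)"
  by (rule linI) auto

lemma lin_zero [lin_intros]: "lin (\<lambda>x. 0)"
  by (rule linI) auto

lemma lin_add [lin_intros]: "lin f \<Longrightarrow> lin g \<Longrightarrow> lin (\<lambda>x. f x + g x)"
  by (rule linI) (auto simp: lin_simps cs.scale_right_distrib)

lemma lin_diff [lin_intros]: "lin f \<Longrightarrow> lin g \<Longrightarrow> lin (\<lambda>x. f x - g x)"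
  by (rule linI) (auto simp: lin_simps cs.scale_right_diff_distrib)

lemma lin_scale [lin_intros]: "lin f \<Longrightarrow> lin (\<lambda>x. scl c (f x))"
  by (rule linI) (auto simp: lin_simps cs.scale_right_distrib cs.scale_left_commute)

lemma lin_sum [lin_intros]: "(\<And>k. k \<in> K \<Longrightarrow> lin (f k)) \<Longrightarrow> lin (\<lambda>x. \<Sum>k\<in>K. f k x)"
  by (rule linI) (auto simp: lin_simps sum.distrib cs.scale_sum_right)

lemma lin_if [lin_intros]: "lin f \<Longrightarrow> lin g \<Longrightarrow> lin (\<lambda>x. if b then f x else g x)"
  by (cases b) auto

lemma lin_comp: "lin f \<Longrightarrow> lin g \<Longrightarrow> lin (\<lambda>x. f (g x))"
  by (rule linI) (auto simp: lin_simps)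

lemma lin_functional [lin_intros]: "functional f \<Longrightarrow> lin (\<lambda>x. scl (f x) u)"
  by (rule linI) (auto simp: functional_simps cs.scale_left_distrib)

lemma functional_comp: "functional f \<Longrightarrow> lin g \<Longrightarrow> functional (\<lambda>x. f (g x))"
  by (rule functionalI) (auto simp: functional_simps lin_simps)

text \<open>Interleaving along a bijection between pairs of numbers and numbers makes one sequence out of a
  sequence of sequences. So the ambient space contains a copy of every power of itself, and direct
  sums can be formed without leaving the type \<open>cseq\<close>.\<close>

definition prj :: "nat \<Rightarrow> cseq \<Rightarrow> cseq" where
  "prj k f = Cseq (\<lambda>i. coord f (prod_encode (k, i)))"

definition join :: "(nat \<Rightarrow> cseq) \<Rightarrow> cseq" where
  "join w = Cseq (\<lambda>m. coord (w (fst (prod_decode m))) (snd (prod_decode m)))"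

lemma prj_join [simp]: "prj k (join w) = w k"
  by (simp add: prj_def join_def)

lemma prj_eqI:
  assumes eq: "\<And>k. prj k f = prj k g"
  shows "f = g"
proof (rule cseq_eqI)
  fix m
  have "coord (prj (fst (prod_decode m)) f) (snd (prod_decode m)) =
      coord (prj (fst (prod_decode m)) g) (snd (prod_decode m))"
    by (simp add: eq)
  then show "coord f m = coord g m" by (simp add: prj_def)
qed

lemma lin_prj [lin_intros]: "lin (prj k)"
  by (rule linI) (auto intro!: cseq_eqI simp: prj_def)

lemma prj_simps [simp]:
  "prj k (f + g) = prj k f + prj k g" "prj k (f - g) = prj k f - prj k g"
  "prj k (scl c f) = scl c (prj k f)" "prj k 0 = 0"
  using lin_prj[of k] by (auto simp: lin_simps)

lemma lin_join [lin_intros]: "(\<And>k. lin (F k)) \<Longrightarrow> lin (\<lambda>x. join (\<lambda>k. F k x))"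
  by (rule linI; rule prj_eqI) (auto simp: lin_simps)

definition single :: "nat \<Rightarrow> cseq \<Rightarrow> cseq" where
  "single k v = join (\<lambda>j. if j = k then v else 0)"

lemma prj_single [simp]: "prj j (single k v) = (if j = k then v else 0)"
  by (simp add: single_def)

lemma lin_single [lin_intros]: "lin (single k)"
  unfolding single_def by (intro lin_intros)

lemma prj_sum_single: "prj j (\<Sum>k<n. single k (w k)) = (if j < n then w j else 0)"
  by (simp add: cp.linear_sum[OF lin_prj])

text \<open>All maps below are linear on the whole ambient space. When only the values on a subspace are
  prescribed, a linear section of a suitable map supplies the extension.\<close>

lemma lin_section:
  assumes "lin A" "cs.subspace T"
  obtains g where "lin g" "\<And>y. g y \<in> T" "\<And>x. x \<in> T \<Longrightarrow> A (g (A x)) = A x"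
  using cp.linear_exists_right_inverse_on[OF assms] by (metis image_eqI rangeI subsetD)

lemma lin_left_inverse:
  assumes "lin A" "cs.subspace T" "\<And>x. x \<in> T \<Longrightarrow> A x = 0 \<Longrightarrow> x = 0"
  obtains g where "lin g" "\<And>y. g y \<in> T" "\<And>x. x \<in> T \<Longrightarrow> g (A x) = x"
proof -
  obtain g where g: "lin g" "\<And>y. g y \<in> T" "\<And>x. x \<in> T \<Longrightarrow> A (g (A x)) = A x"
    using lin_section[OF assms(1,2)] by blast
  have "g (A x) = x" if "x \<in> T" for x
  proof -
    have "A (g (A x) - x) = 0"
      using g(3)[OF that] assms(1) by (simp add: lin_simps)
    then show ?thesis
      using assms(3)[of "g (A x) - x"] g(2) that assms(2) by (simp add: cs.subspace_diff)
  qed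
  with g that show ?thesis by blast
qed

text \<open>The map \<open>(a, b) \<mapsto> a + b\<close> is injective on the outer direct sum of \<open>A\<close> and \<open>B\<close>; the first
  component of a left inverse is the projection wanted.\<close>

lemma lin_extension_on_sum:
  assumes A: "cs.subspace A" and B: "cs.subspace B" and AB: "A \<inter> B \<subseteq> {0}"
  obtains \<pi> where "lin \<pi>" "\<And>x. x \<in> A \<Longrightarrow> \<pi> x = x" "\<And>x. x \<in> B \<Longrightarrow> \<pi> x = 0"
proof -
  define T where "T = {f. prj 0 f \<in> A \<and> prj 1 f \<in> B \<and> (\<forall>k>1. prj k f = 0)}"
  have T: "cs.subspace T"
    using A B by (auto simp: T_def cs.subspace_def)
  have lin: "lin (\<lambda>f. prj 0 f + prj 1 f)" by (intro lin_intros)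
  have inj: "f = 0" if "f \<in> T" "prj 0 f + prj 1 f = 0" for f
  proof -
    have "prj 0 f = - prj 1 f" using that(2) by (simp add: eq_neg_iff_add_eq_0)
    then have "prj 0 f \<in> A \<inter> B" using that(1) B by (auto simp: T_def cs.subspace_neg)
    then have 0: "prj 0 f = 0" using AB by blast
    with that(2) have 1: "prj 1 f = 0" by simp
    show ?thesis
    proof (rule prj_eqI)
      fix k :: nat consider "k = 0" | "k = 1" | "k > 1" by linarith
      then show "prj k f = prj k 0" using 0 1 that(1) by cases (auto simp: T_def)
    qed
  qed
  obtain g where g: "lin g" "\<And>y. g y \<in> T" "\<And>x. x \<in> T \<Longrightarrow> g (prj 0 x + prj 1 x) = x"
    using lin_left_inverse[OF lin T inj] by blast
  show ?thesis
  proof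
    show "lin (\<lambda>x. prj 0 (g x))" by (rule lin_comp[OF lin_prj g(1)])
    show "prj 0 (g x) = x" if "x \<in> A" for x
      using g(3)[of "single 0 x"] that cs.subspace_0[OF B] by (simp add: T_def)
    show "prj 0 (g x) = 0" if "x \<in> B" for x
      using g(3)[of "single 1 x"] that cs.subspace_0[OF A] by (simp add: T_def)
  qed
qed

lemma lin_projection:
  assumes "cs.subspace S"
  obtains \<pi> where "lin \<pi>" "\<And>x. \<pi> x \<in> S" "\<And>x. x \<in> S \<Longrightarrow> \<pi> x = x"
  by (rule lin_left_inverse[OF lin_id assms]) auto

text \<open>A quotient by \<open>K\<close> inside the ambient space: the complement of a projection onto \<open>K\<close>.\<close>

lemma lin_with_kernel:
  assumes "cs.subspace K"
  obtains q where "lin q" "\<And>x. q x = 0 \<longleftrightarrow> x \<in> K"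
proof -
  obtain \<pi> where \<pi>: "lin \<pi>" "\<And>x. \<pi> x \<in> K" "\<And>x. x \<in> K \<Longrightarrow> \<pi> x = x"
    using lin_projection[OF assms] by blast
  show ?thesis
  proof
    show "lin (\<lambda>x. x - \<pi> x)" by (intro lin_intros \<pi>(1))
    show "x - \<pi> x = 0 \<longleftrightarrow> x \<in> K" for x using \<pi>(2)[of x] \<pi>(3)[of x] by auto
  qed
qed

lemma functional_separating:
  assumes "cs.subspace T" "x \<notin> T"
  obtains f where "functional f" "f x = 1" "\<And>y. y \<in> T \<Longrightarrow> f y = 0"
proof -
  obtain B where B: "B \<subseteq> T" "cs.independent B" "T \<subseteq> cs.span B"
    using cs.maximal_independent_subset[of T] by blast
  have "x \<notin> cs.span B"
    using assms B(1) cs.span_minimal by blast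
  then have ind: "cs.independent (insert x B)"
    using B(2) by (rule cs.independent_insertI)
  obtain f where f: "functional f" "\<forall>b\<in>insert x B. f b = (if b = x then 1 else 0)"
    using cf.linear_independent_extend[OF ind, of "\<lambda>b. if b = x then 1 else 0"] by blast
  have "f b = 0" if "b \<in> B" for b
    using f(2) that \<open>x \<notin> cs.span B\<close> cs.span_base by auto
  then have "f y = 0" if "y \<in> T" for y
    using cf.linear_eq_0_on_span[OF f(1)] B(3) that by blast
  with f that show ?thesis by auto
qed

section \<open>Unitarizable collections of subspaces\<close>

text \<open>Scalar products are sesquilinear on the whole ambient space; only positivity is asked on the
  subspace under consideration.\<close>

definition sesquilinear :: "(cseq \<Rightarrow> cseq \<Rightarrow> complex) \<Rightarrow> bool" where
  "sesquilinear ip \<longleftrightarrow>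
     (\<forall>x y z. ip (x + y) z = ip x z + ip y z) \<and>
     (\<forall>c x z. ip (scl c x) z = c * ip x z) \<and>
     (\<forall>x y. ip y x = cnj (ip x y))"

lemma functional_ip:
  assumes "sesquilinear ip"
  shows "functional (\<lambda>x. ip x z)"
  using assms unfolding sesquilinear_def by (intro functionalI) blast+

lemma ip_left:
  assumes "sesquilinear ip"
  shows "ip (x + y) z = ip x z + ip y z" "ip (x - y) z = ip x z - ip y z"
    "ip (scl c x) z = c * ip x z" "ip 0 z = 0" "ip (sum f K) z = (\<Sum>k\<in>K. ip (f k) z)"
  using functional_simps[OF functional_ip[OF assms, of z]] by auto

lemma ip_cnj: "sesquilinear ip \<Longrightarrow> ip y x = cnj (ip x y)"
  unfolding sesquilinear_def by blast

lemma ip_right: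
  assumes "sesquilinear ip"
  shows "ip z (x + y) = ip z x + ip z y" "ip z (x - y) = ip z x - ip z y"
    "ip z (scl c x) = cnj c * ip z x" "ip z 0 = 0" "ip z (sum f K) = (\<Sum>k\<in>K. ip z (f k))"
  unfolding ip_cnj[OF assms, of z] ip_left[OF assms] by simp_all

text \<open>Unitarization with the projections \<open>P k\<close> as part of the data. The coefficient \<open>a0\<close> may have
  any sign here, because its sign is a consequence of the identity as soon as \<open>S\<close> is nonzero.\<close>

locale unitary_data =
  fixes S :: "cseq set" and n :: nat and Vs :: "nat \<Rightarrow> cseq set"
    and ip :: "cseq \<Rightarrow> cseq \<Rightarrow> complex" and a0 :: real and a :: "nat \<Rightarrow> real"
    and P :: "nat \<Rightarrow> cseq \<Rightarrow> cseq"
  assumes subspace_S: "cs.subspace S"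
    and subspace_Vs: "\<And>k. k < n \<Longrightarrow> cs.subspace (Vs k)"
    and Vs_subset: "\<And>k. k < n \<Longrightarrow> Vs k \<subseteq> S"
    and sesq: "sesquilinear ip"
    and pos: "\<And>x. x \<in> S \<Longrightarrow> x \<noteq> 0 \<Longrightarrow> 0 < Re (ip x x)"
    and a_pos: "\<And>k. k < n \<Longrightarrow> 0 < a k"
    and lin_P: "\<And>k. k < n \<Longrightarrow> lin (P k)"
    and P_in: "\<And>k v. k < n \<Longrightarrow> v \<in> S \<Longrightarrow> P k v \<in> Vs k"
    and P_orth: "\<And>k v w. k < n \<Longrightarrow> v \<in> S \<Longrightarrow> w \<in> Vs k \<Longrightarrow> ip (v - P k v) w = 0"
    and sum_P: "\<And>v. v \<in> S \<Longrightarrow> (\<Sum>k<n. scl (a k) (P k v)) = scl a0 v"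
begin

lemmas ipl = ip_left[OF sesq]
lemmas ipr = ip_right[OF sesq]

lemma P_in_S: "k < n \<Longrightarrow> v \<in> S \<Longrightarrow> P k v \<in> S"
  using P_in Vs_subset by blast

lemma ip_eq_0D: "x \<in> S \<Longrightarrow> ip x x = 0 \<Longrightarrow> x = 0"
  using pos[of x] by force

lemma Re_ip_nonneg: "x \<in> S \<Longrightarrow> 0 \<le> Re (ip x x)"
  using pos[of x] by (cases "x = 0") (auto simp: ipl)

lemma weighted_norms_zero:
  assumes sum: "(\<Sum>j<n. a j * Re (ip (T j) (T j))) = 0"
    and T: "\<And>j. j < n \<Longrightarrow> T j \<in> S" and k: "k < n"
  shows "T k = 0"
proof -
  have "0 \<le> a j * Re (ip (T j) (T j))" if "j < n" for j
    using a_pos[OF that] Re_ip_nonneg[OF T[OF that]] by simp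
  then have "a k * Re (ip (T k) (T k)) = 0"
    using sum k sum_nonneg_eq_0_iff[of "{..<n}" "\<lambda>j. a j * Re (ip (T j) (T j))"] by simp
  then show ?thesis using a_pos[OF k] pos[OF T[OF k]] by force
qed

lemma P_adj: "k < n \<Longrightarrow> v \<in> S \<Longrightarrow> w \<in> Vs k \<Longrightarrow> ip (P k v) w = ip v w"
  using P_orth[of k v w] by (simp add: ipl)

lemma P_self: assumes "k < n" "v \<in> Vs k" shows "P k v = v"
proof -
  have v: "v \<in> S" using assms Vs_subset by blast
  have d: "v - P k v \<in> Vs k" using P_in[OF assms(1) v] assms subspace_Vs by (auto intro: cs.subspace_diff)
  have "v - P k v = 0"
    by (rule ip_eq_0D) (use d assms Vs_subset P_orth[OF assms(1) v d] in auto)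
  then show ?thesis by simp
qed

lemma P_norm: assumes "k < n" "v \<in> S" shows "ip (P k v) v = ip (P k v) (P k v)"
proof -
  have "ip (P k v) (P k v) = ip v (P k v)" by (rule P_adj[OF assms P_in[OF assms]])
  then show ?thesis using ip_cnj[OF sesq, of "P k v" v] ip_cnj[OF sesq, of "P k v" "P k v"] by simp
qed

text \<open>Pairing the identity \<open>\<Sum> a k P k = a0\<close> with \<open>v\<close>.\<close>

lemma sum_norm_P:
  assumes v: "v \<in> S"
  shows "(\<Sum>k<n. a k * Re (ip (P k v) (P k v))) = a0 * Re (ip v v)"
proof -
  have "ip (P k v) v = ip (P k v) (P k v)" if "k < n" for k
    by (rule P_norm[OF that v])
  then have "(\<Sum>k<n. a k * Re (ip (P k v) (P k v))) = Re (ip (\<Sum>k<n. scl (a k) (P k v)) v)"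
    by (simp add: ipl)
  also have "\<dots> = a0 * Re (ip v v)" by (simp add: sum_P[OF v] ipl)
  finally show ?thesis .
qed

text \<open>The complementary projections satisfy the same kind of identity, with the coefficient
  \<open>\<Sum> a k - a0\<close>.\<close>

lemma sum_norm_Q:
  assumes v: "v \<in> S"
  shows "(\<Sum>k<n. a k * Re (ip (v - P k v) (v - P k v))) = ((\<Sum>k<n. a k) - a0) * Re (ip v v)"
proof -
  have "Re (ip (v - P k v) (v - P k v)) = Re (ip v v) - Re (ip (P k v) (P k v))" if "k < n" for k
  proof -
    have "ip (v - P k v) (P k v) = 0" by (rule P_orth[OF that v P_in[OF that v]])
    then have "ip (v - P k v) (v - P k v) = ip (v - P k v) v"
      by (simp add: ipr(2))
    also have "\<dots> = ip v v - ip (P k v) v" by (simp add: ipl)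
    also have "ip (P k v) v = ip (P k v) (P k v)"
      by (rule P_norm[OF that v])
    finally show ?thesis by simp
  qed
  then have "(\<Sum>k<n. a k * Re (ip (v - P k v) (v - P k v))) =
      (\<Sum>k<n. a k * Re (ip v v) - a k * Re (ip (P k v) (P k v)))"
    by (intro sum.cong refl) (simp add: right_diff_distrib)
  then show ?thesis
    using sum_norm_P[OF v] by (simp add: sum_subtractf sum_distrib_right[symmetric] left_diff_distrib)
qed

lemma P_zero:
  assumes "k < n" "v \<in> S" "\<And>w. w \<in> Vs k \<Longrightarrow> ip v w = 0"
  shows "P k v = 0"
proof (rule ip_eq_0D)
  show "P k v \<in> S" by (rule P_in_S[OF assms(1,2)])
  show "ip (P k v) (P k v) = 0"
    using P_adj[OF assms(1,2) P_in[OF assms(1,2)]] assms(3)[OF P_in[OF assms(1,2)]] by simp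
qed

lemma sum_Q:
  assumes "v \<in> S"
  shows "(\<Sum>k<n. scl (a k) (v - P k v)) = scl ((\<Sum>k<n. a k) - a0) v"
  by (simp add: cs.scale_right_diff_distrib sum_subtractf sum_P[OF assms] cs.scale_sum_left
      cs.scale_left_diff_distrib)

lemma a0_nonneg:
  assumes "x \<in> S" "x \<noteq> 0"
  shows "0 \<le> a0"
proof -
  have "0 \<le> (\<Sum>k<n. a k * Re (ip (P k x) (P k x)))"
    using a_pos Re_ip_nonneg P_in_S assms(1) by (intro sum_nonneg mult_nonneg_nonneg) (auto simp: less_imp_le)
  then have "0 \<le> a0 * Re (ip x x)" using sum_norm_P[OF assms(1)] by simp
  then show ?thesis using pos[OF assms] by (simp add: zero_le_mult_iff)
qed

end

definition unitarizable :: "cseq set \<Rightarrow> nat \<Rightarrow> (nat \<Rightarrow> cseq set) \<Rightarrow> bool" where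
  "unitarizable S n Vs \<longleftrightarrow> (\<exists>ip a0 a P. 0 \<le> a0 \<and> unitary_data S n Vs ip a0 a P)"

text \<open>In the space \<open>{0}\<close> the coefficient \<open>a0\<close> is arbitrary and can be replaced by \<open>0\<close>.\<close>

lemma unitarizableI:
  assumes "unitary_data S n Vs ip a0 a P"
  shows "unitarizable S n Vs"
proof (cases "\<exists>x\<in>S. x \<noteq> 0")
  case True
  then show ?thesis using assms unitary_data.a0_nonneg[OF assms] unfolding unitarizable_def by blast
next
  case False
  then have 0: "v = 0" if "v \<in> S" for v using that by blast
  have "unitary_data S n Vs ip 0 a P"
    using assms unfolding unitary_data_def by (auto dest!: 0 simp: lin_simps)
  then show ?thesis unfolding unitarizable_def by (intro exI[of _ 0] exI conjI) auto
qed

lemma unitarizable_zero: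
  assumes "\<And>k. k < n \<Longrightarrow> cs.subspace (Vs k)" "\<And>k. k < n \<Longrightarrow> Vs k \<subseteq> {0}"
  shows "unitarizable {0} n Vs"
proof (rule unitarizableI)
  show "unitary_data {0} n Vs (\<lambda>x y. 0) 0 (\<lambda>k. 1) (\<lambda>k x. 0)"
    using assms by unfold_locales (auto simp: sesquilinear_def intro: lin_zero cs.subspace_0)
qed

section \<open>Coxeter functors and unitarization\<close>

text \<open>The functor \<open>\<Phi>\<^sup>+\<close> preserves unitarizability. The family \<open>t\<close> identifies \<open>W\<close> with the kernel of
  the summation map \<open>\<sigma>\<close> from the direct sum of the \<open>Vs k\<close> to \<open>V\<close>, so that the subspaces of
  \<open>\<Phi>\<^sup>+\<close> are the kernels of the \<open>t k\<close>. If \<open>a0 = 0\<close>, then \<open>W\<close> is zero. Otherwise give the direct sum the product in which the \<open>k\<close>-th summand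
  has weight \<open>1 / a k\<close>. Then the adjoint of \<open>\<sigma>\<close> is \<open>v \<mapsto> (a k P k v)\<^sub>k\<close>, and the hypothesis says
  \<open>\<sigma>\<sigma>\<^sup>* = a0\<close>. Hence \<open>1 - \<sigma>\<^sup>*\<sigma> / a0\<close> is the orthogonal projection onto the kernel. It maps the
  \<open>i\<close>-th summand conformally onto the complement of the \<open>i\<close>-th subspace, with factor
  \<open>c i = 1 - a i / a0\<close>, and the resulting operators \<open>r i\<close> on \<open>W\<close> add up to the identity.\<close>

theorem unitarizable_kernel:
  assumes unit: "unitarizable V n Vs"
    and W: "cs.subspace W"
    and t: "\<And>k. k < n \<Longrightarrow> lin (t k)"
    and t_in: "\<And>k w. k < n \<Longrightarrow> w \<in> W \<Longrightarrow> t k w \<in> Vs k"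
    and sum_t: "\<And>w. w \<in> W \<Longrightarrow> (\<Sum>k<n. t k w) = 0"
    and ex: "\<And>v. (\<And>k. k < n \<Longrightarrow> v k \<in> Vs k) \<Longrightarrow> (\<Sum>k<n. v k) = 0 \<Longrightarrow> \<exists>w\<in>W. \<forall>k<n. t k w = v k"
    and inj: "\<And>w. w \<in> W \<Longrightarrow> (\<And>k. k < n \<Longrightarrow> t k w = 0) \<Longrightarrow> w = 0"
  shows "unitarizable W n (\<lambda>k. {w \<in> W. t k w = 0})"
proof -
  obtain ip a0 a P where a0: "0 \<le> a0" and ud: "unitary_data V n Vs ip a0 a P"
    using unit unfolding unitarizable_def by blast
  interpret unitary_data V n Vs ip a0 a P by (rule ud)
  have sub: "cs.subspace {w \<in> W. t k w = 0}" if "k < n" for k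
    using W t[OF that] by (auto simp: cs.subspace_def lin_simps)
  have tV: "t k w \<in> V" if "k < n" "w \<in> W" for k w using t_in[OF that] Vs_subset[OF that(1)] by blast
  show ?thesis
  proof (cases "a0 = 0")
    case True
    have "t k w = 0" if k: "k < n" and w: "w \<in> W" for k w
    proof -
      define v where "v = t k w"
      have v: "v \<in> Vs k" "v \<in> V" using t_in[OF k w] tV[OF k w] by (auto simp: v_def)
      have "P k v = 0"
        by (rule weighted_norms_zero[OF _ P_in_S[OF _ v(2)] k]) (use sum_norm_P[OF v(2)] True in simp)
      then show ?thesis using P_self[OF k v(1)] by (simp add: v_def)
    qed
    then have "W = {0}" using inj W cs.subspace_0 by blast
    with sub show ?thesis by (simp only:) (rule unitarizable_zero, auto)
  next
    case False
    then have a0: "0 < a0" using a0 by simp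
    have a0': "complex_of_real a0 \<noteq> 0" using a0 by simp
    define \<tau> where "\<tau> w = join (\<lambda>k. if k < n then t k w else 0)" for w
    have "lin \<tau>" unfolding \<tau>_def
    proof (rule lin_join)
      show "lin (\<lambda>x. if k < n then t k x else 0)" for k
        by (cases "k < n") (simp_all add: t lin_zero)
    qed
    moreover have "w = 0" if "w \<in> W" "\<tau> w = 0" for w
    proof (rule inj[OF that(1)])
      fix k assume "k < n"
      then show "t k w = 0" using arg_cong[OF that(2), of "prj k"] by (simp add: \<tau>_def)
    qed
    ultimately obtain g where g: "lin g" "\<And>y. g y \<in> W" "\<And>w. w \<in> W \<Longrightarrow> g (\<tau> w) = w"
      using lin_left_inverse[OF _ W] by blast
    \<comment> \<open>\<open>r i w\<close> projects the vector with \<open>i\<close>-th entry \<open>t i w\<close> and zeros elsewhere to the kernel;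
      \<open>q i k w\<close> are its entries.\<close>
    define q where "q i k w = (if k = i then t i w else 0) - scl (a k / a0) (P k (t i w))" for i k w
    define r where "r i w = g (join (\<lambda>k. if k < n then q i k w else 0))" for i w
    define c where "c i = 1 - a i / a0" for i
    define ip' where "ip' w w' = (\<Sum>k<n. (1 / a k) * ip (t k w) (t k w'))" for w w'
    \<comment> \<open>If \<open>t i\<close> vanishes on \<open>W\<close>, then \<open>c i\<close> may be zero; the \<open>i\<close>-th subspace is then all of \<open>W\<close>,
      and any positive coefficient will do.\<close>
    define triv where "triv i \<longleftrightarrow> (\<forall>w\<in>W. t i w = 0)" for i
    define \<alpha> where "\<alpha> i = (if triv i then 1 else c i)" for i
    define P' where "P' i w = (if triv i then w else w - scl (1 / c i) (r i w))" for i w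
    have lin_q: "lin (q i k)" if "i < n" "k < n" for i k
    proof (cases "k = i")
      case True
      then show ?thesis unfolding q_def
        by (simp, intro lin_diff lin_scale lin_comp[OF lin_P t] t that)
    next
      case False
      then show ?thesis unfolding q_def
        by (simp only: if_False, intro lin_diff lin_zero lin_scale lin_comp[OF lin_P t] that)
    qed
    have lin_r: "lin (r i)" if "i < n" for i
      unfolding r_def
    proof (intro lin_comp[OF g(1)] lin_join)
      show "lin (\<lambda>x. if k < n then q i k x else 0)" for k
        by (cases "k < n") (simp_all add: lin_q that lin_zero)
    qed
    have r: "r i w \<in> W" "\<And>k. k < n \<Longrightarrow> t k (r i w) = q i k w" if i: "i < n" and w: "w \<in> W" for i w
    proof -
      have "(\<Sum>k<n. q i k w) = (\<Sum>k<n. if k = i then t i w else 0) -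
          scl (1 / a0) (\<Sum>k<n. scl (a k) (P k (t i w)))"
        unfolding q_def by (simp add: sum_subtractf cs.scale_sum_right)
      also have "\<dots> = 0" using i tV[OF i w] a0' by (simp add: sum_P)
      finally have sum: "(\<Sum>k<n. q i k w) = 0" .
      have "q i k w \<in> Vs k" if "k < n" for k
        unfolding q_def using t_in[OF i w] P_in[OF that tV[OF i w]] subspace_Vs[OF that]
        by (auto intro!: cs.subspace_diff cs.subspace_scale cs.subspace_0 cs.subspace_neg)
      then obtain w' where w': "w' \<in> W" "\<And>k. k < n \<Longrightarrow> t k w' = q i k w"
        using ex[OF _ sum] by blast
      have "\<tau> w' = join (\<lambda>k. if k < n then q i k w else 0)"
        unfolding \<tau>_def by (rule prj_eqI) (simp add: w'(2))
      then have "r i w = w'" using g(3)[OF w'(1)] by (simp add: r_def)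
      with w' show "r i w \<in> W" "\<And>k. k < n \<Longrightarrow> t k (r i w) = q i k w" by auto
    qed
    have ip'_r: "ip' (r i w) w' = (1 / a i) * ip (t i w) (t i w')"
      if i: "i < n" and w: "w \<in> W" "w' \<in> W" for i w w'
    proof -
      have "ip' (r i w) w' = (\<Sum>k<n. (1 / a k) * ip (q i k w) (t k w'))"
        unfolding ip'_def by (simp add: r[OF i w(1)])
      also have "\<dots> = (\<Sum>k<n. (if k = i then (1 / a i) * ip (t i w) (t i w') else 0) -
          (1 / a0) * ip (t i w) (t k w'))"
      proof (rule sum.cong)
        fix k assume "k \<in> {..<n}"
        then have k: "k < n" by simp
        have "ip (P k (t i w)) (t k w') = ip (t i w) (t k w')"
          by (rule P_adj[OF k tV[OF i w(1)] t_in[OF k w(2)]])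
        then show "(1 / a k) * ip (q i k w) (t k w') =
            (if k = i then (1 / a i) * ip (t i w) (t i w') else 0) - (1 / a0) * ip (t i w) (t k w')"
          using a_pos[OF k] a_pos[OF i] by (simp add: q_def ipl field_simps)
      qed simp
      also have "\<dots> = (1 / a i) * ip (t i w) (t i w') - (1 / a0) * ip (t i w) (\<Sum>k<n. t k w')"
        using i by (simp add: sum_subtractf ipr sum_distrib_left sum_divide_distrib)
      finally show ?thesis using sum_t[OF w(2)] by (simp add: ipr)
    qed
    have sesq': "sesquilinear ip'"
      unfolding sesquilinear_def
    proof (intro conjI allI)
      show "ip' (x + y) z = ip' x z + ip' y z" for x y z
        unfolding ip'_def by (simp add: lin_simps t ipl sum.distrib add_divide_distrib)
      show "ip' (scl c x) z = c * ip' x z" for c x z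
        unfolding ip'_def by (simp add: lin_simps t ipl sum_distrib_left)
      show "ip' y x = cnj (ip' x y)" for x y
        unfolding ip'_def by (simp add: ip_cnj[OF sesq, of "t _ y" "t _ x"])
    qed
    have Re_ip': "Re (ip' w w) = (\<Sum>k<n. (1 / a k) * Re (ip (t k w) (t k w)))" for w
      unfolding ip'_def by simp
    have pos': "0 < Re (ip' w w)" if w: "w \<in> W" "w \<noteq> 0" for w
    proof -
      obtain k where k: "k < n" "t k w \<noteq> 0" using inj w by blast
      show ?thesis unfolding Re_ip'
        by (rule sum_pos2[of _ k]) (use k w pos tV a_pos Re_ip_nonneg in \<open>auto simp: less_imp_le\<close>)
    qed
    have tr: "t i (r i w) = scl (c i) (t i w)" if "i < n" "w \<in> W" for i w
      using r(2)[OF that that(1)] P_self[OF that(1) t_in[OF that]]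
      by (simp add: q_def c_def cs.scale_left_diff_distrib)
    have c_pos: "0 < c i" if i: "i < n" "\<not> triv i" for i
    proof -
      obtain w where w: "w \<in> W" "t i w \<noteq> 0" using i(2) by (auto simp: triv_def)
      have p: "0 < Re (ip (t i w) (t i w))" using pos[OF tV[OF i(1) w(1)] w(2)] .
      have "ip' (r i w) w \<noteq> 0" using ip'_r[OF i(1) w(1) w(1)] p a_pos[OF i(1)] by force
      then have "r i w \<noteq> 0" using ip_left(4)[OF sesq'] by metis
      then have "0 < Re (ip' (r i w) (r i w))" by (rule pos'[OF r(1)[OF i(1) w(1)]])
      moreover have "ip' (r i w) (r i w) = (1 / a i) * (c i * ip (t i w) (t i w))"
        using ip'_r[OF i(1) w(1) r(1)[OF i(1) w(1)]] by (simp add: tr[OF i(1) w(1)] ipr)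
      ultimately have "0 < (1 / a i) * (c i * Re (ip (t i w) (t i w)))" by simp
      then show ?thesis using p a_pos[OF i(1)] by (simp add: zero_less_divide_iff zero_less_mult_iff)
    qed
    have sum_r: "(\<Sum>i<n. r i w) = w" if w: "w \<in> W" for w
    proof -
      have "(\<Sum>i<n. r i w) - w = 0"
      proof (rule inj)
        show "(\<Sum>i<n. r i w) - w \<in> W"
          using W r(1) w by (auto intro!: cs.subspace_diff cs.subspace_sum)
        fix k assume k: "k < n"
        have "(\<Sum>i<n. q i k w) =
            (\<Sum>i<n. if k = i then t i w else 0) - (\<Sum>i<n. scl (a k / a0) (P k (t i w)))"
          unfolding q_def by (rule sum_subtractf)
        also have "(\<Sum>i<n. scl (a k / a0) (P k (t i w))) = scl (a k / a0) (P k (\<Sum>i<n. t i w))"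
          by (simp add: lin_simps lin_P[OF k] cs.scale_sum_right)
        finally have "(\<Sum>i<n. q i k w) = t k w"
          using k by (simp add: sum_t[OF w] lin_simps lin_P[OF k])
        then show "t k ((\<Sum>i<n. r i w) - w) = 0"
          using r(2)[OF _ w k] by (simp add: lin_simps t[OF k])
      qed
      then show ?thesis by simp
    qed
    have "unitary_data W n (\<lambda>k. {w \<in> W. t k w = 0}) ip' ((\<Sum>i<n. \<alpha> i) - 1) \<alpha> P'"
    proof (rule unitary_data.intro)
      show "cs.subspace W" by (rule W)
      show "cs.subspace {w \<in> W. t k w = 0}" if "k < n" for k by (rule sub[OF that])
      show "{w \<in> W. t k w = 0} \<subseteq> W" for k by blast
      show "sesquilinear ip'" by (rule sesq')
      show "0 < Re (ip' x x)" if "x \<in> W" "x \<noteq> 0" for x by (rule pos'[OF that])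
      show "0 < \<alpha> k" if "k < n" for k using c_pos[OF that] by (auto simp: \<alpha>_def)
      show "lin (P' k)" if "k < n" for k
        unfolding P'_def by (cases "triv k") (auto intro!: lin_id lin_diff lin_scale lin_r[OF that])
      show "P' k v \<in> {w \<in> W. t k w = 0}" if k: "k < n" and v: "v \<in> W" for k v
      proof (cases "triv k")
        case True
        then show ?thesis using v by (auto simp: P'_def triv_def)
      next
        case False
        then show ?thesis
          using c_pos[OF k] v r(1)[OF k v] W tr[OF k v]
          by (auto simp: P'_def lin_simps t[OF k] intro!: cs.subspace_diff cs.subspace_scale)
      qed
      show "ip' (v - P' k v) w = 0" if k: "k < n" and v: "v \<in> W" and w: "w \<in> {w \<in> W. t k w = 0}" for k v w
      proof (cases "triv k")
        case True
        then show ?thesis by (simp add: P'_def ip_left[OF sesq'])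
      next
        case False
        then show ?thesis
          using ip'_r[OF k v, of w] w by (simp add: P'_def ip_left[OF sesq'] ipr)
      qed
      show "(\<Sum>k<n. scl (\<alpha> k) (P' k v)) = scl ((\<Sum>i<n. \<alpha> i) - 1) v" if v: "v \<in> W" for v
      proof -
        have "scl (\<alpha> k) (P' k v) = scl (\<alpha> k) v - r k v" if k: "k < n" for k
        proof (cases "triv k")
          case True
          have "q k j v = 0" if "j < n" for j
            using True v lin_P[OF that] by (auto simp: q_def triv_def lin_simps)
          then have "r k v = 0"
            using inj[OF r(1)[OF k v]] r(2)[OF k v] by simp
          with True show ?thesis by (simp add: \<alpha>_def P'_def)
        next
          case False
          then show ?thesis using c_pos[OF k] by (simp add: \<alpha>_def P'_def cs.scale_right_diff_distrib)
        qed
        then have "(\<Sum>k<n. scl (\<alpha> k) (P' k v)) = (\<Sum>k<n. scl (\<alpha> k) v) - v"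
          by (simp add: sum_subtractf sum_r[OF v])
        then show ?thesis by (simp add: cs.scale_left_diff_distrib cs.scale_sum_left)
      qed
    qed
    then show ?thesis by (rule unitarizableI)
  qed
qed

text \<open>The functor \<open>\<Phi>\<^sup>-\<close> preserves unitarizability. Here \<open>V\<close> is presented as the quotient of the direct
  sum of the \<open>W / Ws k\<close> by the diagonal image of \<open>W\<close>, the map \<open>s k\<close> being induced by the \<open>k\<close>-th
  summand. Put \<open>b0 = \<Sum> a k - a0\<close>. If \<open>b0 = 0\<close>, then \<open>V\<close> is zero. Otherwise a class has exactly one representative \<open>(g k x)\<^sub>k\<close> with
  \<open>g k x\<close> orthogonal to \<open>Ws k\<close> and \<open>\<Sum> a k g k x = 0\<close>; the product of \<open>V\<close> is that of these
  representatives, the \<open>k\<close>-th component having weight \<open>a k\<close>. With respect to it the operators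
  \<open>x \<mapsto> s i (g i x)\<close> are multiples of the orthogonal projections onto the subspaces, with factor
  \<open>c i = 1 - a i / b0\<close>, and they add up to the identity by the choice of the representatives.\<close>

theorem unitarizable_cokernel:
  assumes unit: "unitarizable W n Ws"
    and V: "cs.subspace V"
    and s: "\<And>k. k < n \<Longrightarrow> lin (s k)"
    and s_in: "\<And>k w. k < n \<Longrightarrow> w \<in> W \<Longrightarrow> s k w \<in> V"
    and gen: "\<And>x. x \<in> V \<Longrightarrow> \<exists>w. (\<forall>k<n. w k \<in> W) \<and> x = (\<Sum>k<n. s k (w k))"
    and exact: "\<And>w. (\<And>k. k < n \<Longrightarrow> w k \<in> W) \<Longrightarrow>
      (\<Sum>k<n. s k (w k)) = 0 \<longleftrightarrow> (\<exists>u\<in>W. \<forall>k<n. w k - u \<in> Ws k)"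
  shows "unitarizable V n (\<lambda>k. s k ` W)"
proof -
  obtain ip a0 a P where ud: "unitary_data W n Ws ip a0 a P"
    using unit unfolding unitarizable_def by blast
  interpret unitary_data W n Ws ip a0 a P by (rule ud)
  define b0 where "b0 = (\<Sum>k<n. a k) - a0"
  define Q where "Q k v = v - P k v" for k v
  have lin_Q: "lin (Q k)" if "k < n" for k
    unfolding Q_def by (intro lin_diff lin_id lin_P[OF that])
  have Q_in: "Q k v \<in> W" if "k < n" "v \<in> W" for k v
    unfolding Q_def by (rule cs.subspace_diff[OF subspace_S that(2) P_in_S[OF that]])
  have Q_orth: "ip (Q k v) w = 0" if "k < n" "v \<in> W" "w \<in> Ws k" for k v w
    unfolding Q_def by (rule P_orth[OF that])
  have Q_self: "Q k v = v" if "k < n" "v \<in> W" "\<And>w. w \<in> Ws k \<Longrightarrow> ip v w = 0" for k v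
    unfolding Q_def using P_zero[OF that] by simp
  have Q_zero: "Q k v = 0" if "k < n" "v \<in> Ws k" for k v
    unfolding Q_def using P_self[OF that] by simp
  have sub: "cs.subspace (s k ` W)" if "k < n" for k
    by (rule cp.linear_subspace_image[OF s[OF that] subspace_S])
  show ?thesis
  proof (cases "b0 = 0")
    case True
    have all: "v \<in> Ws k" if k: "k < n" and v: "v \<in> W" for k v
    proof -
      have "Q k v = 0"
        by (rule weighted_norms_zero[OF _ Q_in[OF _ v] k])
          (use sum_norm_Q[OF v] True in \<open>simp add: Q_def b0_def\<close>)
      then show ?thesis using P_in[OF k v] by (simp add: Q_def)
    qed
    have "x = 0" if x: "x \<in> V" for x
    proof -
      obtain w where w: "\<And>k. k < n \<Longrightarrow> w k \<in> W" "x = (\<Sum>k<n. s k (w k))" using gen[OF x] by blast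
      have "\<exists>u\<in>W. \<forall>k<n. w k - u \<in> Ws k"
        using all w(1) cs.subspace_0[OF subspace_S] by (intro bexI[of _ 0]) auto
      then show ?thesis using exact w by blast
    qed
    then have "V = {0}" using V cs.subspace_0 by blast
    moreover have "unitarizable {0} n (\<lambda>k. s k ` W)"
      by (rule unitarizable_zero) (use sub s_in calculation in auto)
    ultimately show ?thesis by simp
  next
    case b0: False
    define T where "T = {f. \<forall>k<n. prj k f \<in> W}"
    have T: "cs.subspace T"
      using subspace_S by (auto simp: T_def cs.subspace_def)
    define A where "A f = (\<Sum>k<n. s k (prj k f))" for f
    have A: "lin A"
      unfolding A_def by (intro lin_sum lin_comp[OF s lin_prj]) auto
    obtain g0 where g0: "lin g0" "\<And>y. g0 y \<in> T" "\<And>x. x \<in> T \<Longrightarrow> A (g0 (A x)) = A x"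
      using lin_section[OF A T] by blast
    have A_g0: "A (g0 x) = x" if x: "x \<in> V" for x
    proof -
      obtain w where w: "\<And>k. k < n \<Longrightarrow> w k \<in> W" "x = (\<Sum>k<n. s k (w k))" using gen[OF x] by blast
      then have "x = A (join w)" "join w \<in> T" by (auto simp: A_def T_def)
      then show ?thesis using g0(3) by metis
    qed
    define y where "y k x = prj k (g0 x)" for k x
    \<comment> \<open>Subtracting \<open>u x\<close> from every component does not change the class and makes the weighted sum
      of the projected components vanish.\<close>
    define u where "u x = scl (1 / b0) (\<Sum>k<n. scl (a k) (Q k (y k x)))" for x
    define g where "g k x = Q k (y k x - u x)" for k x
    define c where "c i = 1 - a i / b0" for i
    define ip' where "ip' x z = (\<Sum>k<n. a k * ip (g k x) (g k z))" for x z
    \<comment> \<open>If \<open>g i\<close> vanishes on \<open>V\<close>, then the \<open>i\<close>-th subspace is zero and its coefficient is arbitrary.\<close>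
    define triv where "triv i \<longleftrightarrow> (\<forall>x\<in>V. g i x = 0)" for i
    define \<alpha> where "\<alpha> i = (if triv i then 1 else c i)" for i
    define P' where "P' i x = (if triv i then 0 else scl (1 / c i) (s i (g i x)))" for i x
    have lin_y: "lin (y k)" for k unfolding y_def by (rule lin_comp[OF lin_prj g0(1)])
    have lin_u: "lin u" unfolding u_def
      by (intro lin_scale lin_sum lin_comp[OF lin_Q lin_y]) auto
    have lin_g: "lin (g k)" if "k < n" for k unfolding g_def
      by (intro lin_comp[OF lin_Q[OF that]] lin_diff lin_y lin_u)
    have y_in: "y k x \<in> W" if "k < n" for k x using g0(2)[of x] that by (simp add: y_def T_def)
    have u_in: "u x \<in> W" for x
      unfolding u_def using subspace_S y_in Q_in
      by (auto intro!: cs.subspace_scale cs.subspace_sum)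
    have yu_in: "y k x - u x \<in> W" if "k < n" for k x
      by (rule cs.subspace_diff[OF subspace_S y_in[OF that] u_in])
    have g_in: "g k x \<in> W" if "k < n" for k x
      unfolding g_def by (rule Q_in[OF that yu_in[OF that]])
    have g_orth: "ip (g k x) w = 0" if "k < n" "w \<in> Ws k" for k x w
      unfolding g_def by (rule Q_orth[OF that(1) yu_in[OF that(1)] that(2)])
    have Q_g: "Q k (g k x) = g k x" if "k < n" for k x
      by (rule Q_self[OF that g_in[OF that] g_orth[OF that]])
    have sum_g: "(\<Sum>k<n. scl (a k) (g k x)) = 0" for x
    proof -
      have "(\<Sum>k<n. scl (a k) (g k x)) = (\<Sum>k<n. scl (a k) (Q k (y k x))) - (\<Sum>k<n. scl (a k) (Q k (u x)))"
        by (simp add: g_def lin_simps lin_Q cs.scale_right_diff_distrib sum_subtractf)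
      also have "(\<Sum>k<n. scl (a k) (Q k (u x))) = scl b0 (u x)"
        unfolding Q_def b0_def by (rule sum_Q[OF u_in])
      also have "\<dots> = (\<Sum>k<n. scl (a k) (Q k (y k x)))"
        unfolding u_def using b0 by simp
      finally show ?thesis by simp
    qed
    have sum_sg: "(\<Sum>k<n. s k (g k x)) = x" if x: "x \<in> V" for x
    proof -
      have "\<exists>v\<in>W. \<forall>k<n. (y k x - g k x) - v \<in> Ws k"
      proof (intro bexI allI impI)
        fix k assume k: "k < n"
        have "(y k x - g k x) - u x = P k (y k x - u x)" by (simp add: g_def Q_def)
        then show "(y k x - g k x) - u x \<in> Ws k" using P_in[OF k yu_in[OF k]] by simp
      qed (rule u_in)
      then have "(\<Sum>k<n. s k (y k x - g k x)) = 0"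
        using exact[of "\<lambda>k. y k x - g k x"] cs.subspace_diff[OF subspace_S y_in g_in] by blast
      then have "(\<Sum>k<n. s k (g k x)) = (\<Sum>k<n. s k (y k x))"
        by (simp add: lin_simps s sum_subtractf)
      then show ?thesis using A_g0[OF x] by (simp add: A_def y_def)
    qed
    have key: "\<exists>w\<in>W. \<forall>k<n. g k (s i v) - (if k = i then v else 0) - w \<in> Ws k"
      if i: "i < n" and v: "v \<in> W" for i v
    proof -
      have "(\<Sum>k<n. s k (g k (s i v) - (if k = i then v else 0))) =
          (\<Sum>k<n. s k (g k (s i v)) - (if k = i then s i v else 0))"
        by (intro sum.cong) (auto simp: lin_simps s)
      also have "\<dots> = 0"
        using i by (simp add: sum_subtractf sum_sg[OF s_in[OF i v]])
      finally show ?thesis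
        using exact[of "\<lambda>k. g k (s i v) - (if k = i then v else 0)"] g_in v
          cs.subspace_diff[OF subspace_S] cs.subspace_0[OF subspace_S] by force
    qed
    have ip'_s: "ip' x (s i v) = a i * ip (g i x) v" if i: "i < n" and v: "v \<in> W" for i x v
    proof -
      obtain w where w: "w \<in> W" "\<And>k. k < n \<Longrightarrow> g k (s i v) - (if k = i then v else 0) - w \<in> Ws k"
        using key[OF i v] by blast
      have "ip (g k x) (g k (s i v)) = (if k = i then ip (g k x) v else 0) + ip (g k x) w" if k: "k < n" for k
        using g_orth[OF k w(2)[OF k], of x] by (cases "k = i") (auto simp: ipr diff_eq_eq add.commute)
      then have "ip' x (s i v) =
          (\<Sum>k<n. (if k = i then a i * ip (g i x) v else 0) + a k * ip (g k x) w)"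
        unfolding ip'_def by (intro sum.cong) (auto simp: algebra_simps)
      also have "\<dots> = a i * ip (g i x) v + ip (\<Sum>k<n. scl (a k) (g k x)) w"
        using i by (simp add: sum.distrib ipl)
      finally show ?thesis by (simp add: sum_g ipl)
    qed
    have gs: "g i (s i (g i x)) = scl (c i) (g i x)" if i: "i < n" for i x
    proof -
      define z where "z = s i (g i x)"
      obtain w where w: "w \<in> W" "\<And>k. k < n \<Longrightarrow> g k z - (if k = i then g i x else 0) - w \<in> Ws k"
        using key[OF i g_in[OF i]] unfolding z_def by blast
      have gz: "g k z = (if k = i then g i x else 0) + Q k w" if k: "k < n" for k
      proof -
        have "Q k (g k z - (if k = i then g i x else 0) - w) = 0" by (rule Q_zero[OF k w(2)[OF k]])
        then have "g k z = Q k (if k = i then g i x else 0) + Q k w"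
          by (simp add: lin_simps lin_Q[OF k] Q_g[OF k] algebra_simps)
        then show ?thesis using Q_g[OF k] by (auto simp: lin_simps lin_Q[OF k])
      qed
      have "0 = (\<Sum>k<n. scl (a k) (g k z))" by (simp add: sum_g)
      also have "\<dots> = (\<Sum>k<n. (if k = i then scl (a i) (g i x) else 0) + scl (a k) (Q k w))"
        by (intro sum.cong) (auto simp: gz cs.scale_right_distrib)
      also have "\<dots> = scl (a i) (g i x) + scl b0 w"
        using i sum_Q[OF w(1)] by (simp add: sum.distrib Q_def b0_def)
      finally have "scl b0 w = - scl (a i) (g i x)" by (simp add: eq_neg_iff_add_eq_0 add.commute)
      then have "scl (1 / b0) (scl b0 w) = scl (1 / b0) (- scl (a i) (g i x))" by simp
      then have "w = - scl (a i / b0) (g i x)" using b0 by simp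
      then have "Q i w = - scl (a i / b0) (g i x)" by (simp add: lin_simps lin_Q[OF i] Q_g[OF i])
      then show ?thesis
        using gz[OF i] by (simp add: z_def c_def cs.scale_left_diff_distrib)
    qed
    have sesq': "sesquilinear ip'"
      unfolding sesquilinear_def
    proof (intro conjI allI)
      show "ip' (x + y) z = ip' x z + ip' y z" for x y z
        unfolding ip'_def by (simp add: lin_simps lin_g ipl sum.distrib distrib_left)
      show "ip' (scl c x) z = c * ip' x z" for c x z
        unfolding ip'_def sum_distrib_left
        by (intro sum.cong refl) (simp add: lin_simps lin_g ipl)
      show "ip' y x = cnj (ip' x y)" for x y
        unfolding ip'_def by (simp add: ip_cnj[OF sesq, of "g _ y" "g _ x"])
    qed
    have Re_ip': "Re (ip' x x) = (\<Sum>k<n. a k * Re (ip (g k x) (g k x)))" for x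
      unfolding ip'_def by simp
    have pos': "0 < Re (ip' x x)" if x: "x \<in> V" "x \<noteq> 0" for x
    proof -
      have "\<exists>k<n. g k x \<noteq> 0"
      proof (rule ccontr)
        assume "\<not> ?thesis"
        then have "(\<Sum>k<n. s k (g k x)) = 0" by (simp add: lin_simps s)
        then show False using x sum_sg by simp
      qed
      then obtain k where k: "k < n" "g k x \<noteq> 0" by blast
      show ?thesis unfolding Re_ip'
        by (rule sum_pos2[of _ k]) (use k pos g_in a_pos Re_ip_nonneg in \<open>auto simp: less_imp_le\<close>)
    qed
    have c_pos: "0 < c i" if i: "i < n" "\<not> triv i" for i
    proof -
      obtain x where x: "x \<in> V" "g i x \<noteq> 0" using i(2) by (auto simp: triv_def)
      have p: "0 < Re (ip (g i x) (g i x))" using pos[OF g_in[OF i(1)] x(2)] .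
      define z where "z = s i (g i x)"
      have z: "z \<in> V" unfolding z_def by (rule s_in[OF i(1) g_in[OF i(1)]])
      have "ip' x z \<noteq> 0" using ip'_s[OF i(1) g_in[OF i(1)], of x x] p a_pos[OF i(1)] by (force simp: z_def)
      then have "z \<noteq> 0" using ip_right(4)[OF sesq'] by metis
      then have "0 < Re (ip' z z)" by (rule pos'[OF z])
      moreover have "ip' z z = a i * (c i * ip (g i x) (g i x))"
        using ip'_s[OF i(1) g_in[OF i(1)], of z x] gs[OF i(1)] by (simp add: z_def ipl)
      ultimately have "0 < a i * (c i * Re (ip (g i x) (g i x)))" by simp
      then show ?thesis using p a_pos[OF i(1)] by (simp add: zero_less_mult_iff)
    qed
    have triv_zero: "v = 0" if i: "i < n" and tr: "triv i" and v: "v \<in> s i ` W" for i v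
    proof -
      obtain w where w: "w \<in> W" "v = s i w" using v by blast
      have vV: "v \<in> V" using s_in[OF i w(1)] w(2) by simp
      have "ip' v v = a i * ip (g i v) w" using ip'_s[OF i w(1)] w(2) by simp
      then have "ip' v v = 0" using tr vV by (simp add: triv_def ipl)
      then show ?thesis using pos'[OF vV] by force
    qed
    have "unitary_data V n (\<lambda>k. s k ` W) ip' 1 \<alpha> P'"
    proof (rule unitary_data.intro)
      show "cs.subspace V" by (rule V)
      show "cs.subspace (s k ` W)" if "k < n" for k by (rule sub[OF that])
      show "s k ` W \<subseteq> V" if "k < n" for k using s_in[OF that] by blast
      show "sesquilinear ip'" by (rule sesq')
      show "0 < Re (ip' x x)" if "x \<in> V" "x \<noteq> 0" for x by (rule pos'[OF that])
      show "0 < \<alpha> k" if "k < n" for k using c_pos[OF that] by (auto simp: \<alpha>_def)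
      show "lin (P' k)" if "k < n" for k
        unfolding P'_def
        by (cases "triv k") (auto intro!: lin_zero lin_scale lin_comp[OF s[OF that] lin_g[OF that]])
      show "P' k v \<in> s k ` W" if k: "k < n" and v: "v \<in> V" for k v
        unfolding P'_def using sub[OF k] g_in[OF k]
        by (auto intro!: cs.subspace_0 cs.subspace_scale)
      show "ip' (v - P' k v) w = 0" if k: "k < n" and v: "v \<in> V" and w: "w \<in> s k ` W" for k v w
      proof (cases "triv k")
        case True
        then show ?thesis using triv_zero[OF k True w] by (simp add: ip_right[OF sesq'])
      next
        case False
        obtain w' where w': "w' \<in> W" "w = s k w'" using w by blast
        show ?thesis
          using False c_pos[OF k] gs[OF k, of v]
          by (simp add: P'_def w' ip'_s[OF k w'(1)] lin_simps lin_g[OF k] ipl)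
      qed
      show "(\<Sum>k<n. scl (\<alpha> k) (P' k v)) = scl (complex_of_real 1) v" if v: "v \<in> V" for v
      proof -
        have "scl (\<alpha> k) (P' k v) = s k (g k v)" if k: "k < n" for k
        proof (cases "triv k")
          case True
          then show ?thesis using v by (simp add: P'_def triv_def lin_simps s[OF k])
        next
          case False
          then show ?thesis using c_pos[OF k] by (simp add: \<alpha>_def P'_def)
        qed
        then show ?thesis by (simp add: sum_sg[OF v])
      qed
    qed
    then show ?thesis by (rule unitarizableI)
  qed
qed

section \<open>Presentations of vector spaces\<close>

text \<open>The link between vector spaces given by a record and subspaces of the ambient space: a linear map
  of \<open>T\<close> onto \<open>M\<close> with kernel \<open>N\<close>. Allowing a kernel makes quotients as simple as subspaces.\<close>

definition presentation :: "(complex, 'a) module \<Rightarrow> (cseq \<Rightarrow> 'a) \<Rightarrow> cseq set \<Rightarrow> cseq set \<Rightarrow> bool" where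
  "presentation M \<mu> T N \<longleftrightarrow>
     cs.subspace T \<and> cs.subspace N \<and> N \<subseteq> T \<and> carrier M = \<mu> ` T \<and> \<zero>\<^bsub>M\<^esub> = \<mu> 0 \<and>
     (\<forall>x\<in>T. \<forall>y\<in>T. \<mu> (x + y) = \<mu> x \<oplus>\<^bsub>M\<^esub> \<mu> y) \<and>
     (\<forall>c. \<forall>x\<in>T. \<mu> (scl c x) = c \<odot>\<^bsub>M\<^esub> \<mu> x) \<and>
     (\<forall>x\<in>T. \<forall>y\<in>T. \<mu> x = \<mu> y \<longleftrightarrow> x - y \<in> N)"

lemma presentationD:
  assumes "presentation M \<mu> T N"
  shows "cs.subspace T" "cs.subspace N" "N \<subseteq> T" "carrier M = \<mu> ` T" "\<zero>\<^bsub>M\<^esub> = \<mu> 0"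
    "\<And>x y. x \<in> T \<Longrightarrow> y \<in> T \<Longrightarrow> \<mu> (x + y) = \<mu> x \<oplus>\<^bsub>M\<^esub> \<mu> y"
    "\<And>c x. x \<in> T \<Longrightarrow> \<mu> (scl c x) = c \<odot>\<^bsub>M\<^esub> \<mu> x"
    "\<And>x y. x \<in> T \<Longrightarrow> y \<in> T \<Longrightarrow> \<mu> x = \<mu> y \<longleftrightarrow> x - y \<in> N"
  using assms unfolding presentation_def by blast+

lemma presentation_zero_iff:
  assumes "presentation M \<mu> T N" "x \<in> T"
  shows "\<mu> x = \<zero>\<^bsub>M\<^esub> \<longleftrightarrow> x \<in> N"
  using presentationD(8)[OF assms(1,2), of 0] presentationD(1,5)[OF assms(1)]
  by (simp add: cs.subspace_0)

lemma presentation_finsum: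
  assumes p: "presentation M \<mu> T N" and M: "abelian_monoid M"
    and K: "finite K" and f: "\<And>k. k \<in> K \<Longrightarrow> f k \<in> T"
  shows "(\<Oplus>\<^bsub>M\<^esub>k\<in>K. \<mu> (f k)) = \<mu> (\<Sum>k\<in>K. f k)"
  using K f
proof (induction K rule: finite_induct)
  case empty
  then show ?case using presentationD(5)[OF p] by (simp add: abelian_monoid.finsum_empty[OF M])
next
  case (insert k K)
  have "\<mu> (f j) \<in> carrier M" if "j \<in> insert k K" for j
    using insert.prems[OF that] presentationD(4)[OF p] by blast
  then have "(\<Oplus>\<^bsub>M\<^esub>j\<in>insert k K. \<mu> (f j)) = \<mu> (f k) \<oplus>\<^bsub>M\<^esub> (\<Oplus>\<^bsub>M\<^esub>j\<in>K. \<mu> (f j))"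
    using insert.hyps by (intro abelian_monoid.finsum_insert[OF M]) auto
  also have "\<dots> = \<mu> (f k + (\<Sum>j\<in>K. f j))"
    using insert presentationD(1)[OF p] by (simp add: presentationD(6)[OF p] cs.subspace_sum)
  finally show ?case using insert.hyps by simp
qed

lemma presentation_restrict:
  assumes p: "presentation M \<mu> T N" and T': "cs.subspace T'" "N \<subseteq> T'" "T' \<subseteq> T"
  shows "presentation (M\<lparr>carrier := \<mu> ` T'\<rparr>) \<mu> T' N"
  using presentationD[OF p] T' unfolding presentation_def by (auto simp: subset_iff)

text \<open>The coset of \<open>\<mu> x\<close> is the image of \<open>K + x\<close>, so the operations on cosets can be computed with
  representatives in \<open>T\<close>.\<close>

lemma presentation_quotient:
  assumes p: "presentation M \<mu> T N" and K: "cs.subspace K" "N \<subseteq> K" "K \<subseteq> T"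
  shows "presentation (quotient_space M (\<mu> ` K)) (\<lambda>x. \<mu> ` K +>\<^bsub>M\<^esub> \<mu> x) T K"
proof -
  define coset where "coset x = \<mu> ` K +>\<^bsub>M\<^esub> \<mu> x" for x
  note T = presentationD(1)[OF p]
  have coset: "coset x = {\<mu> (k + x) |k. k \<in> K}" if "x \<in> T" for x
    using that K(3) presentationD(6)[OF p] unfolding coset_def a_r_coset_def'[of M]
    by (auto simp: subset_iff) metis
  have coset_eq: "coset x = coset y \<longleftrightarrow> x - y \<in> K" if x: "x \<in> T" and y: "y \<in> T" for x y
  proof
    assume eq: "coset x = coset y"
    have "\<mu> (0 + x) \<in> coset x" using cs.subspace_0[OF K(1)] unfolding coset[OF x] by blast
    then obtain k where k: "k \<in> K" "\<mu> x = \<mu> (k + y)" using eq unfolding coset[OF y] by auto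
    then have "x - (k + y) \<in> N"
      using presentationD(8)[OF p x, of "k + y"] K(3) y cs.subspace_add[OF T] by blast
    then have "(x - (k + y)) + k \<in> K" using K k by (intro cs.subspace_add) auto
    then show "x - y \<in> K" by (simp add: algebra_simps)
  next
    assume d: "x - y \<in> K"
    have 1: "coset x \<subseteq> coset y" if x: "x \<in> T" and y: "y \<in> T" and d: "x - y \<in> K" for x y
    proof
      fix z assume "z \<in> coset x"
      then obtain k where k: "k \<in> K" "z = \<mu> (k + x)" unfolding coset[OF x] by blast
      have "k + (x - y) \<in> K" using K k d by (intro cs.subspace_add) auto
      moreover have "z = \<mu> ((k + (x - y)) + y)" using k by (simp add: algebra_simps)
      ultimately show "z \<in> coset y" unfolding coset[OF y] by blast
    qed
    have "y - x \<in> K" using cs.subspace_neg[OF K(1) d] by simp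
    then show "coset x = coset y" using 1[OF x y d] 1[OF y x] by blast
  qed
  have add: "coset x <+>\<^bsub>M\<^esub> coset y = coset (x + y)" if x: "x \<in> T" and y: "y \<in> T" for x y
  proof -
    have xy: "x + y \<in> T" by (rule cs.subspace_add[OF T x y])
    have "coset x <+>\<^bsub>M\<^esub> coset y = {\<mu> (k + x) \<oplus>\<^bsub>M\<^esub> \<mu> (l + y) |k l. k \<in> K \<and> l \<in> K}"
      unfolding coset[OF x] coset[OF y] by (auto simp: set_add_def set_mult_def)
    also have "\<dots> = {\<mu> ((k + l) + (x + y)) |k l. k \<in> K \<and> l \<in> K}"
    proof -
      have "\<mu> (k + x) \<oplus>\<^bsub>M\<^esub> \<mu> (l + y) = \<mu> ((k + l) + (x + y))" if "k \<in> K" "l \<in> K" for k l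
      proof -
        have "k + x \<in> T" "l + y \<in> T" using that K(3) x y cs.subspace_add[OF T] by blast+
        then have "\<mu> ((k + x) + (l + y)) = \<mu> (k + x) \<oplus>\<^bsub>M\<^esub> \<mu> (l + y)" by (rule presentationD(6)[OF p])
        then show ?thesis by (simp add: algebra_simps)
      qed
      then show ?thesis by (auto; metis)
    qed
    also have "\<dots> = coset (x + y)"
    proof -
      have "\<exists>k' l'. \<mu> (k + (x + y)) = \<mu> ((k' + l') + (x + y)) \<and> k' \<in> K \<and> l' \<in> K" if "k \<in> K" for k
        using that cs.subspace_0[OF K(1)] by (intro exI[of _ k] exI[of _ 0]) simp
      then show ?thesis unfolding coset[OF xy] using cs.subspace_add[OF K(1)] by blast
    qed
    finally show ?thesis .
  qed
  have smult: "(\<Union>z\<in>coset x. \<mu> ` K +>\<^bsub>M\<^esub> (c \<odot>\<^bsub>M\<^esub> z)) = coset (scl c x)" if x: "x \<in> T" for c x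
  proof -
    have "\<mu> ` K +>\<^bsub>M\<^esub> (c \<odot>\<^bsub>M\<^esub> \<mu> (k + x)) = coset (scl c x)" if k: "k \<in> K" for k
    proof -
      have kx: "k + x \<in> T" using k K(3) x cs.subspace_add[OF T] by blast
      have "\<mu> ` K +>\<^bsub>M\<^esub> (c \<odot>\<^bsub>M\<^esub> \<mu> (k + x)) = coset (scl c (k + x))"
        unfolding coset_def by (simp add: presentationD(7)[OF p kx])
      also have "\<dots> = coset (scl c x)"
        using cs.subspace_scale[OF K(1) k, of c] cs.subspace_scale[OF T kx, of c] cs.subspace_scale[OF T x, of c]
        by (subst coset_eq) (simp_all add: cs.scale_right_distrib)
      finally show ?thesis .
    qed
    moreover have "\<exists>k. k \<in> K" using cs.subspace_0[OF K(1)] by blast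
    ultimately show ?thesis unfolding coset[OF x] by blast
  qed
  have "presentation (quotient_space M (\<mu> ` K)) coset T K"
    unfolding presentation_def
  proof (intro conjI ballI allI)
    show "cs.subspace T" "cs.subspace K" "K \<subseteq> T" by (fact T K)+
    show "carrier (quotient_space M (\<mu> ` K)) = coset ` T"
      unfolding quotient_space_def A_RCOSETS_def'[of M] by (auto simp: presentationD(4)[OF p] coset_def)
    show "\<zero>\<^bsub>quotient_space M (\<mu> ` K)\<^esub> = coset 0"
      unfolding coset[OF cs.subspace_0[OF T]] by (auto simp: quotient_space_def)
    show "coset (x + y) = coset x \<oplus>\<^bsub>quotient_space M (\<mu> ` K)\<^esub> coset y" if "x \<in> T" "y \<in> T" for x y
      using add[OF that] by (simp add: quotient_space_def)
    show "coset (scl c x) = c \<odot>\<^bsub>quotient_space M (\<mu> ` K)\<^esub> coset x" if "x \<in> T" for c x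
      using smult[OF that] by (simp add: quotient_space_def)
    show "(coset x = coset y) = (x - y \<in> K)" if "x \<in> T" "y \<in> T" for x y
      by (rule coset_eq[OF that])
  qed
  then show ?thesis by (simp add: coset_def[abs_def])
qed

lemma presentation_direct_sum:
  assumes p: "\<And>i. i < n \<Longrightarrow> presentation (M i) (\<mu> i) (T i) (N i)"
  shows "presentation (direct_sum_space n M) (\<lambda>f. \<lambda>i\<in>{..<n}. \<mu> i (prj i f))
    {f. \<forall>i<n. prj i f \<in> T i} {f. \<forall>i<n. prj i f \<in> N i}"
  unfolding presentation_def
proof (intro conjI ballI allI)
  let ?\<mu> = "\<lambda>f. \<lambda>i\<in>{..<n}. \<mu> i (prj i f)" and ?T = "{f. \<forall>i<n. prj i f \<in> T i}"
  show "cs.subspace ?T" "cs.subspace {f. \<forall>i<n. prj i f \<in> N i}"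
    using presentationD(1,2)[OF p] unfolding cs.subspace_def by auto
  show "{f. \<forall>i<n. prj i f \<in> N i} \<subseteq> ?T"
    using presentationD(3)[OF p] by blast
  show "carrier (direct_sum_space n M) = ?\<mu> ` ?T"
  proof (intro equalityI subsetI)
    fix x assume "x \<in> carrier (direct_sum_space n M)"
    then have x: "x \<in> (\<Pi>\<^sub>E i\<in>{..<n}. carrier (M i))" by (simp add: direct_sum_space_def)
    have "\<exists>t. t \<in> T i \<and> \<mu> i t = x i" if "i < n" for i
      using PiE_mem[OF x, of i] that presentationD(4)[OF p[OF that]] by force
    then obtain t where t: "\<And>i. i < n \<Longrightarrow> t i \<in> T i \<and> \<mu> i (t i) = x i" by metis
    have "x = ?\<mu> (join t)"
      using x t by (auto simp: fun_eq_iff PiE_def extensional_def)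
    moreover have "join t \<in> ?T" using t by simp
    ultimately show "x \<in> ?\<mu> ` ?T" by blast
  next
    fix x assume "x \<in> ?\<mu> ` ?T"
    then obtain f where "f \<in> ?T" "x = ?\<mu> f" by blast
    then show "x \<in> carrier (direct_sum_space n M)"
      using presentationD(4)[OF p] unfolding direct_sum_space_def by (simp add: restrict_PiE_iff)
  qed
  show "\<zero>\<^bsub>direct_sum_space n M\<^esub> = ?\<mu> 0"
    using presentationD(5)[OF p] by (auto simp: direct_sum_space_def fun_eq_iff)
  show "?\<mu> (x + y) = ?\<mu> x \<oplus>\<^bsub>direct_sum_space n M\<^esub> ?\<mu> y" if "x \<in> ?T" "y \<in> ?T" for x y
    using that presentationD(6)[OF p] by (auto simp: direct_sum_space_def fun_eq_iff)
  show "?\<mu> (scl c x) = c \<odot>\<^bsub>direct_sum_space n M\<^esub> ?\<mu> x" if "x \<in> ?T" for c x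
    using that presentationD(7)[OF p] by (auto simp: direct_sum_space_def fun_eq_iff)
  show "(?\<mu> x = ?\<mu> y) = (x - y \<in> {f. \<forall>i<n. prj i f \<in> N i})" if "x \<in> ?T" "y \<in> ?T" for x y
  proof -
    have "(?\<mu> x = ?\<mu> y) \<longleftrightarrow> (\<forall>i<n. \<mu> i (prj i x) = \<mu> i (prj i y))"
      by (auto simp: fun_eq_iff restrict_def)
    also have "\<dots> \<longleftrightarrow> (\<forall>i<n. prj i x - prj i y \<in> N i)"
      using that presentationD(8)[OF p] by auto
    finally show ?thesis by simp
  qed
qed

text \<open>A presentation with kernel is made injective by passing to the image of a map with that kernel.\<close>

lemma presentation_faithful:
  assumes p: "presentation M \<mu> T N" and q: "lin q" "\<And>x. x \<in> T \<Longrightarrow> q x = 0 \<longleftrightarrow> x \<in> N"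
  obtains \<kappa> where "presentation M \<kappa> (q ` T) {0}" "\<And>x. x \<in> T \<Longrightarrow> \<kappa> (q x) = \<mu> x"
proof -
  note T = presentationD(1)[OF p]
  obtain g where g: "lin g" "\<And>y. g y \<in> T" "\<And>x. x \<in> T \<Longrightarrow> q (g (q x)) = q x"
    using lin_section[OF q(1) T] by blast
  have eq: "\<mu> x = \<mu> y \<longleftrightarrow> q x = q y" if "x \<in> T" "y \<in> T" for x y
    using presentationD(8)[OF p that] q(2)[OF cs.subspace_diff[OF T that]] q(1) by (simp add: lin_simps)
  have \<kappa>: "\<mu> (g (q x)) = \<mu> x" if "x \<in> T" for x
    using eq[OF g(2) that] g(3)[OF that] by simp
  have "presentation M (\<lambda>x. \<mu> (g x)) (q ` T) {0}"
    unfolding presentation_def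
  proof (intro conjI ballI allI)
    show "cs.subspace (q ` T)" by (rule cp.linear_subspace_image[OF q(1) T])
    show "cs.subspace {0}" by simp
    show "{0} \<subseteq> q ` T" using cs.subspace_0[OF cp.linear_subspace_image[OF q(1) T]] by simp
    show "carrier M = (\<lambda>x. \<mu> (g x)) ` q ` T" using presentationD(4)[OF p] \<kappa> by (force simp: image_image)
    show "\<zero>\<^bsub>M\<^esub> = \<mu> (g 0)" using presentationD(5)[OF p] g(1) by (simp add: lin_simps)
    show "\<mu> (g (x + y)) = \<mu> (g x) \<oplus>\<^bsub>M\<^esub> \<mu> (g y)" for x y
      using presentationD(6)[OF p g(2) g(2)] g(1) by (simp add: lin_simps)
    show "\<mu> (g (scl c x)) = c \<odot>\<^bsub>M\<^esub> \<mu> (g x)" for c x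
      using presentationD(7)[OF p g(2)] g(1) by (simp add: lin_simps)
    show "(\<mu> (g x) = \<mu> (g y)) = (x - y \<in> {0})" if "x \<in> q ` T" "y \<in> q ` T" for x y
      using eq[OF g(2) g(2), of x y] that g(3) by auto
  qed
  with \<kappa> that show ?thesis by blast
qed

section \<open>Realizable collections\<close>

text \<open>This property is passed on by isomorphisms and by each operation that generates collections. The
  product lives on the ambient space, not on the record, and so survives every change of type.\<close>

definition realizable :: "'a collection \<Rightarrow> bool" where
  "realizable L \<longleftrightarrow> vectorspace complex_field (fst L) \<and> (\<forall>U\<in>set (snd L). U \<subseteq> carrier (fst L)) \<and>
     (\<exists>\<kappa> S. presentation (fst L) \<kappa> S {0} \<and>
        unitarizable S (length (snd L)) (\<lambda>k. {x \<in> S. \<kappa> x \<in> snd L ! k}))"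

lemma unitarizable_cong:
  assumes "unitarizable S n Vs" "\<And>k. k < n \<Longrightarrow> Vs' k = Vs k"
  shows "unitarizable S n Vs'"
  using assms unfolding unitarizable_def unitary_data_def by simp

lemma realizableI:
  assumes "vectorspace complex_field (fst L)" "\<forall>U\<in>set (snd L). U \<subseteq> carrier (fst L)"
    and "presentation (fst L) \<kappa> S {0}" "unitarizable S n Vs" "length (snd L) = n"
    and "\<And>k. k < n \<Longrightarrow> {x \<in> S. \<kappa> x \<in> snd L ! k} = Vs k"
  shows "realizable L"
proof -
  have "unitarizable S (length (snd L)) (\<lambda>k. {x \<in> S. \<kappa> x \<in> snd L ! k})"
    unfolding assms(5) by (rule unitarizable_cong[OF assms(4,6)])
  then show ?thesis unfolding realizable_def using assms(1-3) by blast
qed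

lemma unitarizable_subspace:
  assumes "unitarizable S n Vs" "k < n"
  shows "cs.subspace (Vs k)" "Vs k \<subseteq> S"
  using assms unfolding unitarizable_def by (auto dest: unitary_data.subspace_Vs unitary_data.Vs_subset)

lemma vectorspace_abelian_group:
  assumes "vectorspace complex_field V"
  shows "abelian_group V"
proof -
  interpret vectorspace complex_field V by (rule assms)
  show ?thesis by unfold_locales
qed

text \<open>The coefficient of the copied subspace is shared equally between the two copies.\<close>

lemma unitarizable_copy:
  assumes "unitarizable S n Vs" and k: "k < n"
  shows "unitarizable S (Suc n) (\<lambda>j. if j = n then Vs k else Vs j)"
proof -
  obtain ip a0 a P where a0: "0 \<le> a0" and ud: "unitary_data S n Vs ip a0 a P"
    using assms(1) unfolding unitarizable_def by blast
  interpret unitary_data S n Vs ip a0 a P by (rule ud)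
  define a' where "a' j = (if j = n \<or> j = k then a k / 2 else a j)" for j
  define P' where "P' j = (if j = n then P k else P j)" for j
  have "unitary_data S (Suc n) (\<lambda>j. if j = n then Vs k else Vs j) ip a0 a' P'"
  proof (rule unitary_data.intro)
    fix v assume v: "v \<in> S"
    have "(\<Sum>j<Suc n. scl (a' j) (P' j v)) =
        (\<Sum>j<n. scl (a j) (P j v) - (if j = k then scl (a k / 2) (P k v) else 0)) + scl (a k / 2) (P k v)"
    proof -
      have "scl (a k / 2) (P k v) = scl (a k) (P k v) - scl (a k / 2) (P k v)"
        by (simp flip: cs.scale_left_diff_distrib)
      then show ?thesis using k by (auto simp: a'_def P'_def intro!: sum.cong)
    qed
    then show "(\<Sum>j<Suc n. scl (a' j) (P' j v)) = scl a0 v"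
      using k sum_P[OF v] by (simp add: sum_subtractf)
  qed (use k subspace_S subspace_Vs Vs_subset sesq pos a_pos lin_P P_in P_orth in
      \<open>auto simp: a'_def P'_def split: if_splits\<close>)
  then show ?thesis by (rule unitarizableI)
qed

lemma realizable_copy:
  assumes "realizable (V, Us)" and k: "k < length Us"
  shows "realizable (V, Us @ [Us ! k])"
proof -
  obtain \<kappa> S where p: "presentation V \<kappa> S {0}"
    and u: "unitarizable S (length Us) (\<lambda>k. {x \<in> S. \<kappa> x \<in> Us ! k})"
    using assms by (auto simp: realizable_def)
  have "unitarizable S (length (Us @ [Us ! k])) (\<lambda>j. {x \<in> S. \<kappa> x \<in> (Us @ [Us ! k]) ! j})"
    unfolding length_append_singleton
    by (rule unitarizable_cong[OF unitarizable_copy[OF u k]]) (auto simp: nth_append)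
  with p assms show ?thesis by (auto simp: realizable_def)
qed

lemma realizable_isomorphic:
  assumes L: "realizable L" and iso: "isomorphic L L'"
  shows "realizable L'"
proof -
  obtain \<kappa> S where p: "presentation (fst L) \<kappa> S {0}"
    and u: "unitarizable S (length (snd L)) (\<lambda>k. {x \<in> S. \<kappa> x \<in> snd L ! k})"
    using L by (auto simp: realizable_def)
  have sub: "\<And>U. U \<in> set (snd L) \<Longrightarrow> U \<subseteq> carrier (fst L)" using L by (auto simp: realizable_def)
  obtain h where h: "linear_map complex_field (fst L) (fst L') h"
    and bij: "bij_betw h (carrier (fst L)) (carrier (fst L'))" and snd: "snd L' = map ((`) h) (snd L)"
    using iso by (auto simp: isomorphic_def)
  interpret linear_map complex_field "fst L" "fst L'" h by (rule h)
  have \<kappa>: "\<kappa> x \<in> carrier (fst L)" if "x \<in> S" for x using presentationD(4)[OF p] that by blast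
  have inj: "h x = h y \<longleftrightarrow> x = y" if "x \<in> carrier (fst L)" "y \<in> carrier (fst L)" for x y
    using bij that by (auto simp: bij_betw_def inj_on_def)
  have "presentation (fst L') (\<lambda>x. h (\<kappa> x)) S {0}"
    unfolding presentation_def
  proof (intro conjI ballI allI)
    show "carrier (fst L') = (\<lambda>x. h (\<kappa> x)) ` S"
      using bij presentationD(4)[OF p] by (auto simp: bij_betw_def image_image)
    show "\<zero>\<^bsub>fst L'\<^esub> = h (\<kappa> 0)" using T0_is_0 presentationD(5)[OF p] by metis
    show "h (\<kappa> (x + y)) = h (\<kappa> x) \<oplus>\<^bsub>fst L'\<^esub> h (\<kappa> y)" if "x \<in> S" "y \<in> S" for x y
      using presentationD(6)[OF p that] T_add \<kappa> that by simp
    show "h (\<kappa> (scl c x)) = c \<odot>\<^bsub>fst L'\<^esub> h (\<kappa> x)" if "x \<in> S" for c x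
      using presentationD(7)[OF p that] T_smult \<kappa> that by simp
    show "(h (\<kappa> x) = h (\<kappa> y)) = (x - y \<in> {0})" if "x \<in> S" "y \<in> S" for x y
      using presentationD(8)[OF p that] inj \<kappa> that by simp
  qed (use presentationD[OF p] in auto)
  moreover have "unitarizable S (length (snd L')) (\<lambda>k. {x \<in> S. h (\<kappa> x) \<in> snd L' ! k})"
    unfolding snd length_map
  proof (rule unitarizable_cong[OF u])
    fix k assume k: "k < length (snd L)"
    have "h (\<kappa> x) \<in> h ` (snd L ! k) \<longleftrightarrow> \<kappa> x \<in> snd L ! k" if "x \<in> S" for x
      using inj \<kappa>[OF that] sub[OF nth_mem[OF k]] by auto
    then show "{x \<in> S. h (\<kappa> x) \<in> map ((`) h) (snd L) ! k} = {x \<in> S. \<kappa> x \<in> snd L ! k}"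
      using k by auto
  qed
  moreover have "vectorspace complex_field (fst L')" ..
  moreover have "\<forall>U\<in>set (snd L'). U \<subseteq> carrier (fst L')" using sub snd by auto
  ultimately show ?thesis by (auto simp: realizable_def)
qed

lemma realizable_Phi_plus:
  assumes L: "realizable (V, Us)" and vs: "vectorspace complex_field (Phi_plus_space (V, Us))"
  shows "realizable (Phi_plus (V, Us))"
proof -
  define n where "n = length Us"
  obtain \<kappa> S where p: "presentation V \<kappa> S {0}"
    and u: "unitarizable S n (\<lambda>k. {x \<in> S. \<kappa> x \<in> Us ! k})"
    using L by (auto simp: realizable_def n_def)
  have V: "abelian_monoid V"
    using L vectorspace_abelian_group by (auto simp: realizable_def abelian_group_def)
  define Vs where "Vs k = {x \<in> S. \<kappa> x \<in> Us ! k}" for k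
  have sub: "cs.subspace (Vs k)" "Vs k \<subseteq> S" if "k < n" for k
    using unitarizable_subspace[OF u that] by (auto simp: Vs_def)
  have U: "Us ! k = \<kappa> ` Vs k" if "k < n" for k
    using L presentationD(4)[OF p] nth_mem[of k Us] that by (force simp: Vs_def realizable_def n_def)
  define D where "D = direct_sum_space n (\<lambda>i. V\<lparr>carrier := Us ! i\<rparr>)"
  define \<mu> where "\<mu> f = (\<lambda>i\<in>{..<n}. \<kappa> (prj i f))" for f
  define T where "T = {f. \<forall>i<n. prj i f \<in> Vs i}"
  define N where "N = {f. \<forall>i<n. prj i f \<in> {0}}"
  define T' where "T' = {f \<in> T. (\<Sum>i<n. prj i f) = 0}"
  have "presentation (V\<lparr>carrier := Us ! i\<rparr>) \<kappa> (Vs i) {0}" if "i < n" for i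
    unfolding U[OF that] by (rule presentation_restrict[OF p sub(1)[OF that] _ sub(2)[OF that]])
      (use cs.subspace_0[OF sub(1)[OF that]] in auto)
  then have pD: "presentation D \<mu> T N"
    unfolding D_def \<mu>_def T_def N_def by (rule presentation_direct_sum)
  have T': "cs.subspace T'"
    using presentationD(1)[OF pD] unfolding T'_def cs.subspace_def
    by (auto simp: sum.distrib cs.scale_sum_right[symmetric])
  have space: "Phi_plus_space (V, Us) = D\<lparr>carrier := \<mu> ` T'\<rparr>"
  proof -
    have "(\<Oplus>\<^bsub>V\<^esub>i\<in>{..<n}. \<mu> f i) = \<zero>\<^bsub>V\<^esub> \<longleftrightarrow> (\<Sum>i<n. prj i f) = 0" if f: "f \<in> T" for f
    proof -
      have in_S: "prj i f \<in> S" if "i < n" for i using f sub(2)[OF that] that by (auto simp: T_def)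
      have "(\<Oplus>\<^bsub>V\<^esub>i\<in>{..<n}. \<mu> f i) = (\<Oplus>\<^bsub>V\<^esub>i\<in>{..<n}. \<kappa> (prj i f))"
        using in_S presentationD(4)[OF p]
        by (intro abelian_monoid.finsum_cong'[OF V]) (auto simp: \<mu>_def)
      also have "\<dots> = \<kappa> (\<Sum>i<n. prj i f)"
        by (rule presentation_finsum[OF p V]) (auto intro: in_S)
      finally have "(\<Oplus>\<^bsub>V\<^esub>i\<in>{..<n}. \<mu> f i) = \<kappa> (\<Sum>i<n. prj i f)" .
      moreover have "(\<Sum>i<n. prj i f) \<in> S"
        by (rule cs.subspace_sum[OF presentationD(1)[OF p]]) (auto intro: in_S)
      ultimately show ?thesis
        using presentation_zero_iff[OF p] by auto
    qed
    then have "{\<xi> \<in> carrier D. (\<Oplus>\<^bsub>V\<^esub>i\<in>{..<n}. \<xi> i) = \<zero>\<^bsub>V\<^esub>} = \<mu> ` T'"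
      unfolding presentationD(4)[OF pD] T'_def by auto
    then show ?thesis by (simp add: Let_def D_def n_def)
  qed
  have pT': "presentation (Phi_plus_space (V, Us)) \<mu> T' N"
    unfolding space
  proof (rule presentation_restrict[OF pD T'])
    show "N \<subseteq> T'" using presentationD(3)[OF pD] by (auto simp: T'_def N_def)
    show "T' \<subseteq> T" by (auto simp: T'_def)
  qed
  define q where "q f = join (\<lambda>k. if k < n then prj k f else 0)" for f
  have q: "lin q" unfolding q_def by (intro lin_intros)
  have prj_q: "prj k (q f) = (if k < n then prj k f else 0)" for k f by (simp add: q_def)
  have q0: "q x = 0 \<longleftrightarrow> x \<in> N" for x
  proof
    assume q0: "q x = 0"
    have "prj k x = 0" if "k < n" for k using prj_q[of k x] that by (simp add: q0)
    then show "x \<in> N" by (simp add: N_def)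
  next
    assume x: "x \<in> N"
    show "q x = 0" by (rule prj_eqI) (use x in \<open>auto simp: prj_q N_def\<close>)
  qed
  obtain \<kappa>' where \<kappa>': "presentation (Phi_plus_space (V, Us)) \<kappa>' (q ` T') {0}"
    "\<And>x. x \<in> T' \<Longrightarrow> \<kappa>' (q x) = \<mu> x"
    using presentation_faithful[OF pT' q q0] by blast
  have un: "unitarizable (q ` T') n (\<lambda>k. {w \<in> q ` T'. prj k w = 0})"
  proof (rule unitarizable_kernel[OF u[folded Vs_def]])
    show "cs.subspace (q ` T')" by (rule presentationD(1)[OF \<kappa>'(1)])
    show "lin (prj k)" for k by (rule lin_prj)
    show "prj k w \<in> Vs k" if "k < n" "w \<in> q ` T'" for k w
      using that by (auto simp: prj_q T'_def T_def)
    show "(\<Sum>k<n. prj k w) = 0" if "w \<in> q ` T'" for w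
      using that by (auto simp: prj_q T'_def)
    show "\<exists>w\<in>q ` T'. \<forall>k<n. prj k w = v k"
      if "\<And>k. k < n \<Longrightarrow> v k \<in> Vs k" "(\<Sum>k<n. v k) = 0" for v
      using that by (intro bexI[of _ "q (join v)"] imageI) (auto simp: prj_q T'_def T_def)
    show "w = 0" if "w \<in> q ` T'" "\<And>k. k < n \<Longrightarrow> prj k w = 0" for w
    proof (rule prj_eqI)
      show "prj k w = prj k 0" for k using that by (cases "k < n") (auto simp: prj_q)
    qed
  qed
  have nth: "{x \<in> q ` T'. \<kappa>' x \<in> snd (Phi_plus (V, Us)) ! k} = {w \<in> q ` T'. prj k w = 0}"
    if k: "k < n" for k
  proof -
    have "\<mu> f k = \<zero>\<^bsub>V\<^esub> \<longleftrightarrow> prj k f = 0" if f: "f \<in> T'" for f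
      using presentation_zero_iff[OF p, of "prj k f"] f k sub(2)[OF k] by (auto simp: \<mu>_def T'_def T_def)
    moreover have "\<mu> f \<in> carrier (Phi_plus_space (V, Us))" if "f \<in> T'" for f
      using that presentationD(4)[OF pT'] by blast
    ultimately have "\<kappa>' (q f) \<in> {\<xi> \<in> carrier (Phi_plus_space (V, Us)). \<xi> k = \<zero>\<^bsub>V\<^esub>} \<longleftrightarrow> prj k (q f) = 0"
      if "f \<in> T'" for f
      using that k by (simp add: \<kappa>'(2) prj_q del: Phi_plus_space.simps)
    moreover have "snd (Phi_plus (V, Us)) ! k = {\<xi> \<in> carrier (Phi_plus_space (V, Us)). \<xi> k = \<zero>\<^bsub>V\<^esub>}"
      using k by (simp add: n_def del: Phi_plus_space.simps)
    ultimately show ?thesis by (simp only:) blast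
  qed
  have len: "length (snd (Phi_plus (V, Us))) = n" and fst: "fst (Phi_plus (V, Us)) = Phi_plus_space (V, Us)"
    by (simp_all add: n_def del: Phi_plus_space.simps)
  have subs: "\<forall>U\<in>set (snd (Phi_plus (V, Us))). U \<subseteq> carrier (Phi_plus_space (V, Us))"
    by (auto simp del: Phi_plus_space.simps)
  show ?thesis
    by (rule realizableI[OF _ _ _ un len nth], unfold fst) (fact vs subs \<kappa>'(1))+
qed

text \<open>These are the families whose class in the direct sum of the quotients \<open>S / Vs i\<close> comes from the
  diagonal; dividing by them gives the space of \<open>\<Phi>\<^sup>-\<close>.\<close>

lemma subspace_diagonal:
  assumes S: "cs.subspace S" and sub: "\<And>k. k < n \<Longrightarrow> cs.subspace (Vs k)"
  shows "cs.subspace {f. (\<forall>i<n. prj i f \<in> S) \<and> (\<exists>v\<in>S. \<forall>i<n. prj i f - v \<in> Vs i)}"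
  unfolding cs.subspace_def
proof (intro conjI ballI allI; (elim CollectE conjE bexE)?)
  show "0 \<in> {f. (\<forall>i<n. prj i f \<in> S) \<and> (\<exists>v\<in>S. \<forall>i<n. prj i f - v \<in> Vs i)}"
    using cs.subspace_0[OF S] cs.subspace_0[OF sub] by (auto intro!: bexI[of _ 0])
next
  fix x y v w assume x: "\<forall>i<n. prj i x \<in> S" "v \<in> S" "\<forall>i<n. prj i x - v \<in> Vs i"
    and y: "\<forall>i<n. prj i y \<in> S" "w \<in> S" "\<forall>i<n. prj i y - w \<in> Vs i"
  have "prj i (x + y) - (v + w) \<in> Vs i" if i: "i < n" for i
  proof -
    have "(prj i x - v) + (prj i y - w) \<in> Vs i" using cs.subspace_add[OF sub[OF i]] x(3) y(3) i by blast
    then show ?thesis by (simp add: algebra_simps)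
  qed
  then show "x + y \<in> {f. (\<forall>i<n. prj i f \<in> S) \<and> (\<exists>v\<in>S. \<forall>i<n. prj i f - v \<in> Vs i)}"
    using cs.subspace_add[OF S] x y by (auto intro!: bexI[of _ "v + w"])
next
  fix c x v assume x: "\<forall>i<n. prj i x \<in> S" "v \<in> S" "\<forall>i<n. prj i x - v \<in> Vs i"
  have "prj i (scl c x) - scl c v \<in> Vs i" if i: "i < n" for i
  proof -
    have "scl c (prj i x - v) \<in> Vs i" using cs.subspace_scale[OF sub[OF i]] x(3) i by blast
    then show ?thesis by (simp add: cs.scale_right_diff_distrib)
  qed
  then show "scl c x \<in> {f. (\<forall>i<n. prj i f \<in> S) \<and> (\<exists>v\<in>S. \<forall>i<n. prj i f - v \<in> Vs i)}"
    using cs.subspace_scale[OF S] x by (auto intro!: bexI[of _ "scl c v"])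
qed

lemma realizable_Phi_minus:
  assumes L: "realizable (V, Us)" and vs: "vectorspace complex_field (fst (Phi_minus (V, Us)))"
  shows "realizable (Phi_minus (V, Us))"
proof -
  define n where "n = length Us"
  obtain \<kappa> S where p: "presentation V \<kappa> S {0}"
    and u: "unitarizable S n (\<lambda>k. {x \<in> S. \<kappa> x \<in> Us ! k})"
    using L by (auto simp: realizable_def n_def)
  note S = presentationD(1)[OF p]
  define Vs where "Vs k = {x \<in> S. \<kappa> x \<in> Us ! k}" for k
  have sub: "cs.subspace (Vs k)" "Vs k \<subseteq> S" if "k < n" for k
    using unitarizable_subspace[OF u that] by (auto simp: Vs_def)
  have U: "Us ! k = \<kappa> ` Vs k" if "k < n" for k
    using L presentationD(4)[OF p] nth_mem[of k Us] that by (force simp: Vs_def realizable_def n_def)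
  define E where "E = direct_sum_space n (\<lambda>i. quotient_space V (Us ! i))"
  define D where "D = (\<lambda>v. \<lambda>i\<in>{..<n}. Us ! i +>\<^bsub>V\<^esub> v) ` carrier V"
  define \<mu> where "\<mu> f = (\<lambda>i\<in>{..<n}. Us ! i +>\<^bsub>V\<^esub> \<kappa> (prj i f))" for f
  define T where "T = {f. \<forall>i<n. prj i f \<in> S}"
  define N where "N = {f. \<forall>i<n. prj i f \<in> Vs i}"
  define K where "K = {f \<in> T. \<exists>v\<in>S. \<forall>i<n. prj i f - v \<in> Vs i}"
  have "presentation (quotient_space V (Us ! i)) (\<lambda>x. Us ! i +>\<^bsub>V\<^esub> \<kappa> x) S (Vs i)" if "i < n" for i
    unfolding U[OF that] by (rule presentation_quotient[OF p sub(1)[OF that] _ sub(2)[OF that]])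
      (use cs.subspace_0[OF sub(1)[OF that]] in auto)
  then have pE: "presentation E \<mu> T N"
    unfolding E_def \<mu>_def T_def N_def by (rule presentation_direct_sum)
  note T = presentationD(1)[OF pE]
  have K: "cs.subspace K"
    unfolding K_def T_def mem_Collect_eq by (rule subspace_diagonal[OF S sub(1)])
  have NK: "N \<subseteq> K"
    using presentationD(3)[OF pE] cs.subspace_0[OF S] by (auto simp: K_def N_def intro!: bexI[of _ 0])
  have KT: "K \<subseteq> T" by (auto simp: K_def)
  have D: "D = \<mu> ` K"
  proof (intro equalityI subsetI)
    fix x assume "x \<in> D"
    then obtain v where v: "v \<in> S" "x = (\<lambda>i\<in>{..<n}. Us ! i +>\<^bsub>V\<^esub> \<kappa> v)"
      unfolding D_def presentationD(4)[OF p] by auto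
    then have "x = \<mu> (join (\<lambda>_. v))" by (simp add: \<mu>_def)
    moreover have "join (\<lambda>_. v) \<in> K"
      using v cs.subspace_0[OF sub(1)] by (auto simp: K_def T_def intro!: bexI[of _ v])
    ultimately show "x \<in> \<mu> ` K" by blast
  next
    fix x assume "x \<in> \<mu> ` K"
    then obtain f v where f: "f \<in> T" "x = \<mu> f" and v: "v \<in> S" "\<And>i. i < n \<Longrightarrow> prj i f - v \<in> Vs i"
      by (auto simp: K_def)
    have "join (\<lambda>_. v) \<in> T" using v by (simp add: T_def)
    then have "\<mu> f = \<mu> (join (\<lambda>_. v))"
      using presentationD(8)[OF pE f(1)] v by (simp add: N_def)
    then have "x = (\<lambda>i\<in>{..<n}. Us ! i +>\<^bsub>V\<^esub> \<kappa> v)" using f by (simp add: \<mu>_def)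
    then show "x \<in> D" unfolding D_def presentationD(4)[OF p] using v(1) by blast
  qed
  define coset where "coset f = \<mu> ` K +>\<^bsub>E\<^esub> \<mu> f" for f
  have pQ: "presentation (quotient_space E D) coset T K"
    unfolding D coset_def by (rule presentation_quotient[OF pE K NK KT])
  obtain q where q: "lin q" and q0: "\<And>x. q x = 0 \<longleftrightarrow> x \<in> K"
    using lin_with_kernel[OF K] by blast
  obtain \<kappa>' where \<kappa>': "presentation (quotient_space E D) \<kappa>' (q ` T) {0}"
    "\<And>x. x \<in> T \<Longrightarrow> \<kappa>' (q x) = coset x"
    using presentation_faithful[OF pQ q q0] by blast
  have \<iota>T: "single k v \<in> T" if "v \<in> S" for k v
    using that cs.subspace_0[OF S] by (simp add: T_def)
  have q_eq: "q f = q f'" if "f \<in> T" "f' \<in> T" "f - f' \<in> K" for f f'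
    using q0[of "f - f'"] that q by (simp add: lin_simps)
  have un: "unitarizable (q ` T) n (\<lambda>k. (\<lambda>v. q (single k v)) ` S)"
  proof (rule unitarizable_cokernel[OF u[folded Vs_def]])
    show "cs.subspace (q ` T)" by (rule cp.linear_subspace_image[OF q T])
    show "lin (\<lambda>v. q (single k v))" for k by (rule lin_comp[OF q lin_single])
    show "q (single k v) \<in> q ` T" if "v \<in> S" for k v using \<iota>T[OF that] by blast
    show "\<exists>w. (\<forall>k<n. w k \<in> S) \<and> x = (\<Sum>k<n. q (single k (w k)))" if x: "x \<in> q ` T" for x
    proof -
      obtain f where f: "f \<in> T" "x = q f" using x by blast
      have "f - (\<Sum>k<n. single k (prj k f)) \<in> N"
        using cs.subspace_0[OF sub(1)] by (auto simp: N_def prj_sum_single)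
      moreover have "(\<Sum>k<n. single k (prj k f)) \<in> T"
        using f(1) by (auto simp: T_def prj_sum_single)
      ultimately have "x = q (\<Sum>k<n. single k (prj k f))"
        using f NK by (auto intro!: q_eq)
      then show ?thesis using f by (intro exI[of _ "\<lambda>k. prj k f"]) (auto simp: T_def cp.linear_sum[OF q])
    qed
    show "(\<Sum>k<n. q (single k (w k))) = 0 \<longleftrightarrow> (\<exists>u\<in>S. \<forall>k<n. w k - u \<in> Vs k)"
      if w: "\<And>k. k < n \<Longrightarrow> w k \<in> S" for w
    proof -
      have "(\<Sum>k<n. q (single k (w k))) = 0 \<longleftrightarrow> (\<Sum>k<n. single k (w k)) \<in> K"
        unfolding q0[symmetric] by (simp add: cp.linear_sum[OF q])
      also have "\<dots> \<longleftrightarrow> (\<exists>u\<in>S. \<forall>k<n. w k - u \<in> Vs k)"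
        using w by (simp add: K_def T_def prj_sum_single)
      finally show ?thesis .
    qed
  qed
  have pre: "{x \<in> q ` T. \<kappa>' x \<in> snd (Phi_minus (V, Us)) ! k} = (\<lambda>v. q (single k v)) ` S"
    if k: "k < n" for k
  proof -
    have zero: "\<mu> f j = \<zero>\<^bsub>quotient_space V (Us ! j)\<^esub> \<longleftrightarrow> prj j f \<in> Vs j" if "f \<in> T" "j < n" for f j
    proof -
      have pj: "presentation (quotient_space V (Us ! j)) (\<lambda>x. Us ! j +>\<^bsub>V\<^esub> \<kappa> x) S (Vs j)"
        unfolding U[OF that(2)] by (rule presentation_quotient[OF p sub(1)[OF that(2)] _ sub(2)[OF that(2)]])
          (use cs.subspace_0[OF sub(1)[OF that(2)]] in auto)
      show ?thesis using presentation_zero_iff[OF pj, of "prj j f"] that by (simp add: \<mu>_def T_def)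
    qed
    have nth: "snd (Phi_minus (V, Us)) ! k = coset ` {f \<in> T. \<forall>j<n. j \<noteq> k \<longrightarrow> prj j f \<in> Vs j}"
    proof -
      have "snd (Phi_minus (V, Us)) ! k = (\<lambda>\<xi>. D +>\<^bsub>E\<^esub> \<xi>) `
          {\<xi> \<in> carrier E. \<forall>j<n. j \<noteq> k \<longrightarrow> \<xi> j = \<zero>\<^bsub>quotient_space V (Us ! j)\<^esub>}"
        using k by (simp add: Let_def n_def D_def E_def)
      also have "{\<xi> \<in> carrier E. \<forall>j<n. j \<noteq> k \<longrightarrow> \<xi> j = \<zero>\<^bsub>quotient_space V (Us ! j)\<^esub>} =
          \<mu> ` {f \<in> T. \<forall>j<n. j \<noteq> k \<longrightarrow> prj j f \<in> Vs j}"
        unfolding presentationD(4)[OF pE] using zero by blast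
      finally show ?thesis by (simp add: image_image coset_def D)
    qed
    have q_coset: "coset f = coset f' \<longleftrightarrow> q f = q f'" if "f \<in> T" "f' \<in> T" for f f'
      using presentationD(8)[OF pQ that] q0[of "f - f'"] q by (simp add: lin_simps)
    show ?thesis
    proof (intro equalityI subsetI)
      fix x assume "x \<in> {x \<in> q ` T. \<kappa>' x \<in> snd (Phi_minus (V, Us)) ! k}"
      then obtain f f' where f: "f \<in> T" "x = q f" and f': "f' \<in> T" "coset f = coset f'"
        "\<And>j. j < n \<Longrightarrow> j \<noteq> k \<Longrightarrow> prj j f' \<in> Vs j"
        unfolding nth using \<kappa>'(2) by auto
      have kS: "prj k f' \<in> S" using f' k by (simp add: T_def)
      have "f' - single k (prj k f') \<in> N"
        using f'(3) cs.subspace_0[OF sub(1)] by (auto simp: N_def)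
      then have "q f' = q (single k (prj k f'))" using NK f'(1) \<iota>T[OF kS] by (intro q_eq) auto
      then have "x = q (single k (prj k f'))" using f f' q_coset by simp
      then show "x \<in> (\<lambda>v. q (single k v)) ` S" using kS by blast
    next
      fix x assume "x \<in> (\<lambda>v. q (single k v)) ` S"
      then obtain v where v: "v \<in> S" "x = q (single k v)" by blast
      have "single k v \<in> {f \<in> T. \<forall>j<n. j \<noteq> k \<longrightarrow> prj j f \<in> Vs j}"
        using \<iota>T[OF v(1)] cs.subspace_0[OF sub(1)] by auto
      then show "x \<in> {x \<in> q ` T. \<kappa>' x \<in> snd (Phi_minus (V, Us)) ! k}"
        unfolding nth using v \<kappa>'(2)[OF \<iota>T[OF v(1)]] \<iota>T[OF v(1)] by auto
    qed
  qed
  have fst: "fst (Phi_minus (V, Us)) = quotient_space E D"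
    by (simp add: Let_def n_def D_def E_def)
  have len: "length (snd (Phi_minus (V, Us))) = n"
    by (simp add: Let_def n_def)
  have subs: "\<forall>U\<in>set (snd (Phi_minus (V, Us))). U \<subseteq> carrier (quotient_space E D)"
  proof
    fix U assume "U \<in> set (snd (Phi_minus (V, Us)))"
    then obtain k where "U = (\<lambda>\<xi>. D +>\<^bsub>E\<^esub> \<xi>) `
          {\<xi> \<in> carrier E. \<forall>j<n. j \<noteq> k \<longrightarrow> \<xi> j = \<zero>\<^bsub>quotient_space V (Us ! j)\<^esub>}"
      by (auto simp: Let_def n_def D_def E_def)
    then show "U \<subseteq> carrier (quotient_space E D)"
      by (auto simp: quotient_space_def A_RCOSETS_def'[of E])
  qed
  show ?thesis
    by (rule realizableI[OF _ _ _ un len pre], unfold fst) (fact vs[unfolded fst] subs \<kappa>'(1))+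
qed

text \<open>By positivity the vector \<open>P k x\<close> is the only one with the defining property of the orthogonal
  projection, so the description operator returns it.\<close>

lemma realizable_imp_unitarized:
  assumes "realizable (V, Us)"
  shows "\<exists>\<chi>. unitarized_with (V, Us) \<chi>"
proof -
  define n where "n = length Us"
  obtain \<kappa> S where p: "presentation V \<kappa> S {0}"
    and u: "unitarizable S n (\<lambda>k. {x \<in> S. \<kappa> x \<in> Us ! k})"
    using assms by (auto simp: realizable_def n_def)
  have grp: "abelian_group V"
    using assms vectorspace_abelian_group by (auto simp: realizable_def)
  interpret V: abelian_group V by (rule grp)
  define Vs where "Vs k = {x \<in> S. \<kappa> x \<in> Us ! k}" for k
  obtain ip a0 a P where a0: "0 \<le> a0" and ud: "unitary_data S n Vs ip a0 a P"
    using u unfolding unitarizable_def Vs_def by blast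
  interpret unitary_data S n Vs ip a0 a P by (rule ud)
  have carr: "carrier V = \<kappa> ` S" by (rule presentationD(4)[OF p])
  have \<kappa>_in: "\<kappa> x \<in> carrier V" if "x \<in> S" for x using that carr by blast
  have U: "Us ! k = \<kappa> ` Vs k" if "k < n" for k
    using assms carr nth_mem[of k Us] that by (force simp: Vs_def realizable_def n_def)
  define h where "h = inv_into S \<kappa>"
  have inj: "inj_on \<kappa> S" using presentationD(8)[OF p] by (auto simp: inj_on_def)
  have h: "h (\<kappa> x) = x" if "x \<in> S" for x unfolding h_def using inj that by simp
  have minus: "\<kappa> x \<ominus>\<^bsub>V\<^esub> \<kappa> y = \<kappa> (x - y)" if x: "x \<in> S" and y: "y \<in> S" for x y
  proof -
    have d: "x - y \<in> S" by (rule cs.subspace_diff[OF subspace_S x y])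
    have "\<kappa> x = \<kappa> (x - y) \<oplus>\<^bsub>V\<^esub> \<kappa> y" using presentationD(6)[OF p d y] by simp
    then show ?thesis
      using \<kappa>_in[OF d] \<kappa>_in[OF y] by (simp add: V.minus_eq V.a_assoc V.r_neg)
  qed
  define ip' where "ip' u v = ip (h u) (h v)" for u v
  have ip': "ip' (\<kappa> x) (\<kappa> y) = ip x y" if "x \<in> S" "y \<in> S" for x y
    using that by (simp add: ip'_def h)
  have herm: "hermitian_product V ip'"
    unfolding hermitian_product_def carr
  proof (intro conjI ballI allI impI; (elim imageE)?)
    fix u v w x y z assume "u = \<kappa> x" "v = \<kappa> y" "w = \<kappa> z" and S: "x \<in> S" "y \<in> S" "z \<in> S"
    moreover have "x + y \<in> S" using S cs.subspace_add[OF subspace_S] by blast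
    ultimately show "ip' (u \<oplus>\<^bsub>V\<^esub> v) w = ip' u w + ip' v w"
      by (simp add: presentationD(6)[OF p, symmetric] ip' ipl)
  next
    fix c u w x z assume "u = \<kappa> x" "w = \<kappa> z" and S: "x \<in> S" "z \<in> S"
    moreover have "scl c x \<in> S" using S cs.subspace_scale[OF subspace_S] by blast
    ultimately show "ip' (c \<odot>\<^bsub>V\<^esub> u) w = c * ip' u w"
      by (simp add: presentationD(7)[OF p, symmetric] ip' ipl)
  next
    fix u w x z assume "u = \<kappa> x" "w = \<kappa> z" "x \<in> S" "z \<in> S"
    then show "ip' w u = cnj (ip' u w)" using ip_cnj[OF sesq, of z x] by (simp add: ip')
  next
    fix v x assume "v \<noteq> \<zero>\<^bsub>V\<^esub>" "v = \<kappa> x" "x \<in> S"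
    then show "0 < Re (ip' v v)" using pos presentationD(5)[OF p] by (auto simp: ip')
  qed
  have proj: "orthogonal_projection V ip' (Us ! k) (\<kappa> x) = \<kappa> (P k x)" if k: "k < n" and x: "x \<in> S" for k x
    unfolding orthogonal_projection_def
  proof (rule the_equality)
    have Pin: "P k x \<in> Vs k" "P k x \<in> S" using P_in[OF k x] P_in_S[OF k x] by auto
    have d: "x - P k x \<in> S" by (rule cs.subspace_diff[OF subspace_S x Pin(2)])
    have "ip' (\<kappa> x \<ominus>\<^bsub>V\<^esub> \<kappa> (P k x)) (\<kappa> w) = 0" if "w \<in> Vs k" for w
      using that P_orth[OF k x that] Vs_subset[OF k] by (subst minus[OF x Pin(2)]) (auto simp: ip' d)
    then show "\<kappa> (P k x) \<in> Us ! k \<and> (\<forall>w\<in>Us ! k. ip' (\<kappa> x \<ominus>\<^bsub>V\<^esub> \<kappa> (P k x)) w = 0)"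
      unfolding U[OF k] using Pin by blast
    fix v assume v: "v \<in> Us ! k \<and> (\<forall>w\<in>Us ! k. ip' (\<kappa> x \<ominus>\<^bsub>V\<^esub> v) w = 0)"
    then obtain z where z: "z \<in> Vs k" "v = \<kappa> z" unfolding U[OF k] by blast
    have zS: "z \<in> S" using z(1) Vs_subset[OF k] by blast
    have xz: "x - z \<in> S" by (rule cs.subspace_diff[OF subspace_S x zS])
    have orth: "ip (x - z) w = 0" if w: "w \<in> Vs k" for w
    proof -
      have "ip' (\<kappa> x \<ominus>\<^bsub>V\<^esub> \<kappa> z) (\<kappa> w) = 0" using v w unfolding U[OF k] z(2) by blast
      then show ?thesis using minus[OF x zS] ip'[OF xz] w Vs_subset[OF k] by auto
    qed
    define e where "e = P k x - z"
    have e: "e \<in> Vs k" unfolding e_def by (rule cs.subspace_diff[OF subspace_Vs[OF k] Pin(1) z(1)])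
    have "ip e e = ip (x - z) e - ip (x - P k x) e" by (simp add: e_def ipl)
    also have "\<dots> = 0" using orth[OF e] P_orth[OF k x e] by simp
    finally have "e = 0" using ip_eq_0D e Vs_subset[OF k] by blast
    then show "v = \<kappa> (P k x)" using z(2) by (simp add: e_def)
  qed
  have "(\<Oplus>\<^bsub>V\<^esub>k\<in>{..<n}. complex_of_real (map a [0..<n] ! k) \<odot>\<^bsub>V\<^esub> orthogonal_projection V ip' (Us ! k) v)
      = complex_of_real a0 \<odot>\<^bsub>V\<^esub> v" if v: "v \<in> carrier V" for v
  proof -
    obtain x where x: "x \<in> S" "v = \<kappa> x" using v carr by blast
    have in_S: "scl (a k) (P k x) \<in> S" if "k < n" for k
      by (rule cs.subspace_scale[OF subspace_S P_in_S[OF that x(1)]])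
    have "(\<Oplus>\<^bsub>V\<^esub>k\<in>{..<n}. complex_of_real (map a [0..<n] ! k) \<odot>\<^bsub>V\<^esub> orthogonal_projection V ip' (Us ! k) v)
        = (\<Oplus>\<^bsub>V\<^esub>k\<in>{..<n}. \<kappa> (scl (a k) (P k x)))"
      using in_S \<kappa>_in
      by (intro V.finsum_cong') (auto simp: x(2) proj[OF _ x(1)] presentationD(7)[OF p P_in_S[OF _ x(1)]])
    also have "\<dots> = \<kappa> (\<Sum>k<n. scl (a k) (P k x))"
      by (rule presentation_finsum[OF p V.abelian_monoid_axioms]) (auto intro: in_S)
    also have "\<dots> = complex_of_real a0 \<odot>\<^bsub>V\<^esub> v"
      by (simp add: sum_P[OF x(1)] presentationD(7)[OF p x(1)] x(2))
    finally show ?thesis .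
  qed
  then have "unitarized_with (V, Us) (a0, map a [0..<n])"
    using a0 a_pos herm by (auto simp: n_def)
  then show ?thesis by blast
qed

section \<open>Dimensions of subspaces\<close>

definition fin_dim :: "cseq set \<Rightarrow> bool" where
  "fin_dim S \<longleftrightarrow> cs.subspace S \<and> (\<exists>B. finite B \<and> S \<subseteq> cs.span B)"

lemma fin_dim_subspace: "fin_dim S \<Longrightarrow> cs.subspace S"
  by (simp add: fin_dim_def)

lemma fin_dim_mono: "fin_dim S \<Longrightarrow> cs.subspace T \<Longrightarrow> T \<subseteq> S \<Longrightarrow> fin_dim T"
  unfolding fin_dim_def by blast

lemma fin_dim_image: "fin_dim S \<Longrightarrow> lin f \<Longrightarrow> fin_dim (f ` S)"
  unfolding fin_dim_def
  by (metis cp.linear_span_image cp.linear_subspace_image finite_imageI image_mono)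

lemma fin_dim_zero: "fin_dim {0}"
  unfolding fin_dim_def by (auto intro: exI[of _ "{}"])

lemma fin_dim_independent:
  assumes "fin_dim S" "B \<subseteq> S" "cs.independent B"
  shows "finite B"
proof -
  obtain C where "finite C" "S \<subseteq> cs.span C" using assms(1) by (auto simp: fin_dim_def)
  then show ?thesis using cs.independent_span_bound[of C B] assms by blast
qed

lemma fin_dim_basis:
  assumes "fin_dim S"
  obtains B where "finite B" "cs.independent B" "B \<subseteq> S" "cs.span B = S" "card B = cs.dim S"
proof -
  obtain B where B: "B \<subseteq> S" "cs.independent B" "S \<subseteq> cs.span B"
    using cs.maximal_independent_subset[of S] by blast
  have "cs.span B = S" using B assms cs.span_minimal[OF B(1)] by (auto simp: fin_dim_def)
  then show ?thesis
    using that B fin_dim_independent[OF assms B(1,2)] cs.dim_span_eq_card_independent[OF B(2)] by metis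
qed

lemma dim_mono:
  assumes S: "fin_dim S" and T: "cs.subspace T" "T \<subseteq> S"
  shows "cs.dim T \<le> cs.dim S"
proof -
  obtain B where B: "finite B" "cs.span B = S" "card B = cs.dim S" using fin_dim_basis[OF S] by metis
  then show ?thesis using cs.dim_le_card[of T B] T by simp
qed

lemma dim_eq_imp_eq:
  assumes S: "fin_dim S" and T: "cs.subspace T" "T \<subseteq> S" and dim: "cs.dim S \<le> cs.dim T"
  shows "T = S"
proof (rule ccontr)
  assume "T \<noteq> S"
  then obtain x where x: "x \<in> S" "x \<notin> T" using T by blast
  obtain B where B: "finite B" "cs.independent B" "B \<subseteq> T" "cs.span B = T" "card B = cs.dim T"
    using fin_dim_basis[OF fin_dim_mono[OF S T]] by metis
  obtain C where C: "finite C" "cs.span C = S" "card C = cs.dim S" using fin_dim_basis[OF S] by metis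
  have "cs.independent (insert x B)" using x B cs.independent_insertI by blast
  then have "card (insert x B) \<le> card C"
    using cs.independent_span_bound[OF C(1), of "insert x B"] x B T C by blast
  moreover have "x \<notin> B" using x B by blast
  ultimately show False using B(1,5) C dim by simp
qed

text \<open>The coordinates of \<open>x\<close> in the independent set \<open>E\<close> are supported both in \<open>B\<close> and in \<open>C\<close>.\<close>

lemma independent_span_disjoint:
  assumes ind: "cs.independent E" and sub: "B \<subseteq> E" "C \<subseteq> E" "B \<inter> C = {}"
    and x: "x \<in> cs.span B" "x \<in> cs.span C"
  shows "x = 0"
proof -
  have "cs.representation E x = cs.representation B x" "cs.representation E x = cs.representation C x"
    using cs.representation_extend[OF ind x(1) sub(1)] cs.representation_extend[OF ind x(2) sub(2)] by auto
  then have "cs.representation B x b = 0" for b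
    using cs.representation_ne_zero[of B x b] cs.representation_ne_zero[of C x b] sub(3) by force
  then have "(\<Sum>b | cs.representation B x b \<noteq> 0. scl (cs.representation B x b) b) = 0" by simp
  then show ?thesis
    using cs.sum_nonzero_representation_eq[OF cs.independent_mono[OF ind sub(1)] x(1)] by simp
qed

theorem rank_nullity:
  assumes S: "fin_dim S" and f: "lin f"
  shows "cs.dim S = cs.dim (f ` S) + cs.dim {x \<in> S. f x = 0}"
proof -
  define K where "K = {x \<in> S. f x = 0}"
  have subS: "cs.subspace S" using S by (rule fin_dim_subspace)
  have K: "cs.subspace K" unfolding K_def using subS f by (auto simp: cs.subspace_def lin_simps)
  obtain B where B: "finite B" "cs.independent B" "B \<subseteq> K" "cs.span B = K" "card B = cs.dim K"
    using fin_dim_basis[OF fin_dim_mono[OF S K]] unfolding K_def by blast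
  obtain E where E: "B \<subseteq> E" "E \<subseteq> S" "cs.independent E" "S \<subseteq> cs.span E"
    using cs.maximal_independent_subset_extend[of B S] B unfolding K_def by blast
  define C where "C = E - B"
  have spanE: "cs.span E = S" using E cs.span_minimal[OF E(2) subS] by blast
  have finE: "finite E" by (rule fin_dim_independent[OF S E(2,3)])
  have indC: "cs.independent C" unfolding C_def by (rule cs.independent_mono[OF E(3)]) blast
  have spanC: "cs.span C \<subseteq> S" unfolding spanE[symmetric] C_def by (rule cs.span_mono) blast
  have inj: "inj_on f (cs.span C)"
  proof (subst cp.linear_inj_on_iff_eq_0[OF f cs.subspace_span], intro ballI impI)
    fix x assume x: "x \<in> cs.span C" "f x = 0"
    then have "x \<in> cs.span B" using spanC B(4) by (auto simp: K_def)
    then show "x = 0" using independent_span_disjoint[OF E(3,1), of C x] x by (auto simp: C_def)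
  qed
  have ind: "cs.independent (f ` C)"
    by (rule cp.linear_independent_injective_image[OF f indC inj])
  have "f ` S = cs.span (f ` E)"
    using cp.linear_span_image[OF f, of E] spanE by simp
  also have "\<dots> = cs.span (f ` C)"
  proof (rule antisym)
    have "f b \<in> cs.span (f ` C)" if "b \<in> E" for b
    proof (cases "b \<in> B")
      case True
      then have "f b = 0" using B(3) by (auto simp: K_def)
      then show ?thesis by (simp add: cs.span_zero)
    next
      case False
      then show ?thesis using that by (intro cs.span_base) (auto simp: C_def)
    qed
    then show "cs.span (f ` E) \<subseteq> cs.span (f ` C)" by (intro cs.span_minimal) auto
    show "cs.span (f ` C) \<subseteq> cs.span (f ` E)" by (rule cs.span_mono) (auto simp: C_def)
  qed
  finally have "cs.dim (f ` S) = card (f ` C)"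
    using cs.dim_span_eq_card_independent[OF ind] by simp
  also have "\<dots> = card C"
    by (rule card_image) (use inj cs.span_superset in \<open>blast intro: inj_on_subset\<close>)
  finally have "cs.dim (f ` S) = card C" .
  moreover have "cs.dim S = card E" using cs.dim_span_eq_card_independent[OF E(3)] spanE by simp
  moreover have "card E = card C + card B"
    using card_Diff_subset[OF B(1) E(1)] card_mono[OF finE E(1)] by (simp add: C_def)
  ultimately show ?thesis using B(5) by (simp add: K_def)
qed

lemma dim_zero [simp]: "cs.dim {0} = 0"
  using cs.dim_span_eq_card_independent[OF cs.independent_empty] by simp

lemma dim_zero_iff:
  assumes "fin_dim S" shows "cs.dim S = 0 \<longleftrightarrow> S = {0}"
proof
  assume "cs.dim S = 0"
  then show "S = {0}"
    using dim_eq_imp_eq[OF assms, of "{0}"] cs.subspace_0[OF fin_dim_subspace[OF assms]] by simp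
qed simp

lemma dim_image_inj:
  assumes S: "fin_dim S" and f: "lin f" and inj: "\<And>x. x \<in> S \<Longrightarrow> f x = 0 \<Longrightarrow> x = 0"
  shows "cs.dim (f ` S) = cs.dim S"
proof -
  have "{x \<in> S. f x = 0} = {0}"
    using inj cs.subspace_0[OF fin_dim_subspace[OF S]] f by (auto simp: lin_simps)
  then show ?thesis using rank_nullity[OF S f] by simp
qed

lemma fin_dim_extension:
  assumes T: "cs.subspace T" and f: "lin f" and im: "fin_dim (f ` T)" and ker: "fin_dim {x \<in> T. f x = 0}"
  shows "fin_dim T"
proof -
  obtain g where g: "lin g" "\<And>y. g y \<in> T" "\<And>x. x \<in> T \<Longrightarrow> f (g (f x)) = f x"
    using lin_section[OF f T] by blast
  obtain B C where B: "finite B" "f ` T \<subseteq> cs.span B" and C: "finite C" "{x \<in> T. f x = 0} \<subseteq> cs.span C"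
    using im ker unfolding fin_dim_def by blast
  have "x \<in> cs.span (g ` B \<union> C)" if x: "x \<in> T" for x
  proof -
    have "x - g (f x) \<in> {x \<in> T. f x = 0}"
      using x g f T by (auto simp: lin_simps cs.subspace_diff)
    then have "x - g (f x) \<in> cs.span (g ` B \<union> C)"
      using C(2) cs.span_mono[of C "g ` B \<union> C"] by blast
    moreover have "g (f x) \<in> cs.span (g ` B \<union> C)"
      using B(2) x cp.linear_span_image[OF g(1), of B] cs.span_mono[of "g ` B" "g ` B \<union> C"] by blast
    ultimately show ?thesis using cs.span_add by fastforce
  qed
  then show ?thesis using T B C by (auto simp: fin_dim_def intro!: exI[of _ "g ` B \<union> C"])
qed

text \<open>The outer direct sum of \<open>n\<close> subspaces; the entries from \<open>n\<close> on vanish, so that the dimension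
  is the sum of the dimensions.\<close>

definition dsum :: "nat \<Rightarrow> (nat \<Rightarrow> cseq set) \<Rightarrow> cseq set" where
  "dsum n Vs = {f. (\<forall>k<n. prj k f \<in> Vs k) \<and> (\<forall>k\<ge>n. prj k f = 0)}"

lemma subspace_dsum: "(\<And>k. k < n \<Longrightarrow> cs.subspace (Vs k)) \<Longrightarrow> cs.subspace (dsum n Vs)"
  unfolding dsum_def cs.subspace_def by auto

lemma dim_dsum:
  assumes "\<And>k. k < n \<Longrightarrow> fin_dim (Vs k)"
  shows "fin_dim (dsum n Vs) \<and> cs.dim (dsum n Vs) = (\<Sum>k<n. cs.dim (Vs k))"
  using assms
proof (induction n)
  case 0
  have "x = 0" if "x \<in> dsum 0 Vs" for x by (rule prj_eqI) (use that in \<open>simp add: dsum_def\<close>)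
  then have "dsum 0 Vs = {0}" using cs.subspace_0[OF subspace_dsum[of 0 Vs]] by blast
  then show ?case by (simp add: fin_dim_zero)
next
  case (Suc n)
  let ?f = "\<lambda>f. join (\<lambda>k. if k < n then prj k f else 0)" and ?T = "dsum (Suc n) Vs"
  have sub: "cs.subspace (Vs k)" if "k < Suc n" for k using Suc.prems[OF that] fin_dim_subspace by blast
  have T: "cs.subspace ?T" by (rule subspace_dsum[OF sub])
  have f: "lin ?f" by (intro lin_intros)
  have IH: "fin_dim (dsum n Vs)" "cs.dim (dsum n Vs) = (\<Sum>k<n. cs.dim (Vs k))"
    using Suc.IH Suc.prems by auto
  have im: "?f ` ?T = dsum n Vs"
  proof (intro equalityI subsetI)
    fix x assume x: "x \<in> dsum n Vs"
    show "x \<in> ?f ` ?T"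
    proof (rule image_eqI)
      show "x = ?f x" by (rule prj_eqI) (use x in \<open>auto simp: dsum_def\<close>)
      show "x \<in> ?T" using x cs.subspace_0[OF sub[of n]] by (auto simp: dsum_def less_Suc_eq)
    qed
  qed (auto simp: dsum_def)
  let ?K = "{x \<in> ?T. ?f x = 0}"
  have K: "?K = single n ` Vs n"
  proof (intro equalityI subsetI)
    fix x assume x: "x \<in> ?K"
    then have f0: "?f x = 0" by blast
    have "prj k x = 0" if "k < n" for k
      using arg_cong[OF f0, of "prj k"] that by simp
    moreover have "prj k x = 0" if "n < k" for k using x that by (simp add: dsum_def)
    ultimately have "prj k x = 0" if "k \<noteq> n" for k using that by (meson linorder_neqE_nat)
    note off = this
    show "x \<in> single n ` Vs n"
    proof (rule image_eqI)
      show "x = single n (prj n x)" by (rule prj_eqI) (simp add: off)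
      show "prj n x \<in> Vs n" using x by (auto simp: dsum_def)
    qed
  next
    fix x assume "x \<in> single n ` Vs n"
    then obtain v where v: "v \<in> Vs n" "x = single n v" by blast
    have "?f x = 0" by (rule prj_eqI) (simp add: v)
    then show "x \<in> ?K" using v cs.subspace_0[OF sub] by (auto simp: dsum_def)
  qed
  have inj: "v = 0" if "single n v = 0" for v using arg_cong[OF that, of "prj n"] by simp
  have "fin_dim ?K" unfolding K by (rule fin_dim_image[OF _ lin_single]) (use Suc.prems in auto)
  then have fd: "fin_dim ?T"
    by (intro fin_dim_extension[OF T f]) (use im IH in auto)
  have "cs.dim ?K = cs.dim (Vs n)"
    unfolding K by (rule dim_image_inj[OF _ lin_single inj]) (use Suc.prems in auto)
  then show ?case using rank_nullity[OF fd f] fd im IH by simp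
qed

lemma dim_sum_Int:
  assumes A: "fin_dim A" and B: "fin_dim B"
  shows "cs.dim {x + y |x y. x \<in> A \<and> y \<in> B} + cs.dim (A \<inter> B) = cs.dim A + cs.dim B"
proof -
  define Vs where "Vs k = (if k = 0 then A else B)" for k :: nat
  let ?f = "\<lambda>f. prj 0 f + prj 1 f" and ?T = "dsum 2 Vs"
  have f: "lin ?f" by (intro lin_intros)
  have T: "fin_dim ?T" "cs.dim ?T = cs.dim A + cs.dim B"
    using dim_dsum[of 2 Vs] A B by (auto simp: Vs_def numeral_2_eq_2)
  have mem: "x \<in> ?T \<longleftrightarrow> prj 0 x \<in> A \<and> prj 1 x \<in> B \<and> (\<forall>k\<ge>2. prj k x = 0)" for x
    by (auto simp: dsum_def Vs_def numeral_2_eq_2 less_Suc_eq)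
  have im: "?f ` ?T = {x + y |x y. x \<in> A \<and> y \<in> B}"
  proof (intro equalityI subsetI)
    fix z assume "z \<in> {x + y |x y. x \<in> A \<and> y \<in> B}"
    then obtain x y where z: "z = x + y" "x \<in> A" "y \<in> B" by blast
    have "z = ?f (join (\<lambda>k. if k = 0 then x else if k = 1 then y else 0))" using z by simp
    moreover have "join (\<lambda>k. if k = 0 then x else if k = 1 then y else 0) \<in> ?T" using z by (simp add: mem)
    ultimately show "z \<in> ?f ` ?T" by blast
  next
    fix z assume "z \<in> ?f ` ?T"
    then obtain x where "x \<in> ?T" "z = prj 0 x + prj 1 x" by blast
    then show "z \<in> {x + y |x y. x \<in> A \<and> y \<in> B}" unfolding mem by blast
  qed
  let ?\<iota> = "\<lambda>v. join (\<lambda>k. if k = 0 then v else if k = 1 then - v else 0)"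
  have \<iota>: "lin ?\<iota>"
  proof (rule linI; rule prj_eqI)
  qed (auto simp: cs.scale_minus_right)
  have "{x \<in> ?T. ?f x = 0} = ?\<iota> ` (A \<inter> B)"
  proof (intro equalityI subsetI)
    fix x assume x: "x \<in> {x \<in> ?T. ?f x = 0}"
    then have eq: "prj 1 x = - prj 0 x" by (simp add: add.commute eq_neg_iff_add_eq_0)
    then have "prj 0 x = - prj 1 x" by simp
    then have "prj 0 x \<in> B" using x cs.subspace_neg[OF fin_dim_subspace[OF B], of "prj 1 x"] by (simp add: mem)
    moreover have "x = ?\<iota> (prj 0 x)"
    proof (rule prj_eqI)
      fix k :: nat
      consider "k = 0" | "k = 1" | "k \<ge> 2" by linarith
      then show "prj k x = prj k (?\<iota> (prj 0 x))" using x eq by cases (auto simp: mem)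
    qed
    ultimately show "x \<in> ?\<iota> ` (A \<inter> B)" using x by (auto simp: mem)
  next
    fix x assume "x \<in> ?\<iota> ` (A \<inter> B)"
    then show "x \<in> {x \<in> ?T. ?f x = 0}"
      using cs.subspace_neg[OF fin_dim_subspace[OF B]] by (auto simp: mem)
  qed
  moreover have inj: "v = 0" if "?\<iota> v = 0" for v using arg_cong[OF that, of "prj 0"] by simp
  have "cs.dim (?\<iota> ` (A \<inter> B)) = cs.dim (A \<inter> B)"
    by (rule dim_image_inj[OF _ \<iota> inj])
      (rule fin_dim_mono[OF A cs.subspace_inter[OF fin_dim_subspace[OF A] fin_dim_subspace[OF B]] Int_lower1])
  ultimately show ?thesis using rank_nullity[OF T(1) f] T(2) unfolding im by simp
qed

lemma Re_mult_cnj: "Re (z * cnj z) = (cmod z)\<^sup>2"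
  by (simp add: complex_mult_cnj cmod_power2)

lemma fin_dim_ip:
  assumes "fin_dim S"
  obtains ip where "sesquilinear ip" "\<And>x. x \<in> S \<Longrightarrow> x \<noteq> 0 \<Longrightarrow> 0 < Re (ip x x)"
proof -
  obtain B where B: "finite B" "cs.independent B" "cs.span B = S" using fin_dim_basis[OF assms] by metis
  have "\<forall>b. \<exists>r. functional r \<and> (\<forall>x\<in>B. r x = (if x = b then 1 else 0))"
    by (intro allI cf.linear_independent_extend[OF B(2)])
  from choice[OF this] obtain r where
    r: "\<And>b. functional (r b)" "\<And>b x. x \<in> B \<Longrightarrow> r b x = (if x = b then 1 else 0)"
    by blast
  define ip where "ip x y = (\<Sum>b\<in>B. r b x * cnj (r b y))" for x y
  have coords: "(\<Sum>b\<in>B. scl (r b x) b) = x" if "x \<in> S" for x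
  proof -
    have lin: "lin (\<lambda>x. \<Sum>b\<in>B. scl (r b x) b)" by (intro lin_intros r)
    have "(\<Sum>b\<in>B. scl (r b x) b) = x" if "x \<in> B" for x
    proof -
      have "(\<Sum>b\<in>B. scl (r b x) b) = (\<Sum>b\<in>B. if x = b then x else 0)"
        using that by (intro sum.cong) (auto simp: r(2))
      then show ?thesis using that B(1) by simp
    qed
    then show ?thesis using cp.linear_eq_on_span[OF lin lin_id] that B(3) by blast
  qed
  have "sesquilinear ip"
    unfolding sesquilinear_def
  proof (intro conjI allI)
    show "ip (x + y) z = ip x z + ip y z" for x y z
      unfolding ip_def sum.distrib[symmetric]
      by (intro sum.cong refl) (simp only: functional_simps(1)[OF r(1)] distrib_right)
    show "ip (scl c x) z = c * ip x z" for c x z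
      unfolding ip_def sum_distrib_left
      by (intro sum.cong refl) (simp only: functional_simps(3)[OF r(1)] mult.assoc)
    show "ip y x = cnj (ip x y)" for x y
      unfolding ip_def cnj_sum by (intro sum.cong refl) (simp add: mult.commute)
  qed
  moreover have "0 < Re (ip x x)" if "x \<in> S" "x \<noteq> 0" for x
  proof -
    have "\<exists>b\<in>B. r b x \<noteq> 0"
    proof (rule ccontr)
      assume "\<not> ?thesis"
      then have "(\<Sum>b\<in>B. scl (r b x) b) = 0" by (intro sum.neutral) simp
      with coords[OF that(1)] that(2) show False by simp
    qed
    then obtain b where b: "b \<in> B" "r b x \<noteq> 0" by blast
    have "Re (ip x x) = (\<Sum>b\<in>B. (cmod (r b x))\<^sup>2)"
      unfolding ip_def Re_sum Re_mult_cnj ..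
    also have "0 < \<dots>" by (rule sum_pos2[OF B(1) b(1)]) (use b in auto)
    finally show ?thesis .
  qed
  ultimately show ?thesis using that by blast
qed

section \<open>Collections of lines\<close>

text \<open>With an auxiliary product \<open>ip\<close>, the
  operator \<open>A v = \<Sum> ip v (x k) x k\<close> is positive definite because the \<open>x k\<close> span, and the new product
  \<open>ip (A\<^sup>-\<^sup>1 v) w\<close> turns \<open>v = A (A\<^sup>-\<^sup>1 v)\<close> into \<open>v = \<Sum> ip' v (x k) x k\<close>. The \<open>k\<close>-th term is the projection onto
  the \<open>k\<close>-th line times the squared length of \<open>x k\<close>.\<close>

theorem unitarizable_lines:
  assumes S: "fin_dim S" and x: "\<And>k. k < n \<Longrightarrow> x k \<noteq> 0"
    and span: "cs.span (x ` {..<n}) = S"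
  shows "unitarizable S n (\<lambda>k. cs.span {x k})"
proof -
  have subS: "cs.subspace S" by (rule fin_dim_subspace[OF S])
  have x_in: "x k \<in> S" if "k < n" for k using that span cs.span_base[of "x k" "x ` {..<n}"] by auto
  obtain ip where ip: "sesquilinear ip" and pos: "\<And>v. v \<in> S \<Longrightarrow> v \<noteq> 0 \<Longrightarrow> 0 < Re (ip v v)"
    using fin_dim_ip[OF S] by blast
  define A where "A v = (\<Sum>k<n. scl (ip v (x k)) (x k))" for v
  have A: "lin A" unfolding A_def by (intro lin_intros functional_ip ip)
  have A_in: "A v \<in> S" for v
    unfolding A_def using x_in by (intro cs.subspace_sum[OF subS] cs.subspace_scale[OF subS]) auto
  have ip_A: "ip (A v) w = (\<Sum>k<n. ip v (x k) * cnj (ip w (x k)))" for v w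
    unfolding A_def ip_left[OF ip] by (simp add: ip_cnj[OF ip, of "x _" w])
  have Re_A: "Re (ip (A v) v) = (\<Sum>k<n. (cmod (ip v (x k)))\<^sup>2)" for v
    unfolding ip_A Re_sum Re_mult_cnj ..
  have posA: "0 < Re (ip (A v) v)" if v: "v \<in> S" "v \<noteq> 0" for v
  proof -
    have "\<exists>k<n. ip v (x k) \<noteq> 0"
    proof (rule ccontr)
      assume no: "\<not> ?thesis"
      have "ip w v = 0" if "w \<in> cs.span (x ` {..<n})" for w
        by (rule cf.linear_eq_0_on_span[OF functional_ip[OF ip] _ that])
          (use no ip_cnj[OF ip, of _ v] in auto)
      then show False using pos[OF v] v(1) span by force
    qed
    then obtain k where k: "k < n" "ip v (x k) \<noteq> 0" by blast
    show ?thesis unfolding Re_A by (rule sum_pos2[of _ k]) (use k in auto)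
  qed
  have inj: "v = 0" if "v \<in> S" "A v = 0" for v
    using posA[OF that(1)] that(2) by (auto simp: ip_left[OF ip])
  have "A ` S = S"
    by (rule dim_eq_imp_eq[OF S cp.linear_subspace_image[OF A subS]])
      (use A_in dim_image_inj[OF S A inj] in auto)
  obtain g where g: "lin g" "\<And>y. g y \<in> S" "\<And>v. v \<in> S \<Longrightarrow> g (A v) = v"
    using lin_left_inverse[OF A subS inj] by blast
  have Ag: "A (g v) = v" if "v \<in> S" for v
    using that \<open>A ` S = S\<close> g(3) by (metis imageE)
  define ip' where "ip' v w = ip (A (g v)) (g w)" for v w
  have sesq': "sesquilinear ip'"
    unfolding sesquilinear_def
  proof (intro conjI allI)
    show "ip' (u + v) w = ip' u w + ip' v w" for u v w
      unfolding ip'_def by (simp add: lin_simps A g(1) ip_left[OF ip])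
    show "ip' (scl c u) w = c * ip' u w" for c u w
      unfolding ip'_def by (simp add: lin_simps A g(1) ip_left[OF ip])
    show "ip' w v = cnj (ip' v w)" for v w
      unfolding ip'_def ip_A by (simp add: mult.commute)
  qed
  have pos': "0 < Re (ip' v v)" if v: "v \<in> S" "v \<noteq> 0" for v
  proof -
    have "g v \<noteq> 0" using Ag[OF v(1)] v(2) A by (auto simp: lin_simps)
    then show ?thesis unfolding ip'_def by (rule posA[OF g(2)])
  qed
  have ip'_x: "ip' v (x k) = ip (g v) (x k)" if "v \<in> S" "k < n" for v k
  proof -
    have "ip' v (x k) = (\<Sum>j<n. ip (g v) (x j) * cnj (ip (g (x k)) (x j)))"
      by (simp add: ip'_def ip_A)
    also have "\<dots> = cnj (ip (A (g (x k))) (g v))" unfolding ip_A by (simp add: mult.commute)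
    also have "\<dots> = cnj (ip (x k) (g v))" using Ag[OF x_in[OF that(2)]] by simp
    finally show ?thesis using ip_cnj[OF ip, of "x k" "g v"] by simp
  qed
  define a where "a k = Re (ip' (x k) (x k))" for k
  have a: "0 < a k" "ip' (x k) (x k) = a k" if "k < n" for k
  proof -
    show "0 < a k" unfolding a_def by (rule pos'[OF x_in[OF that] x[OF that]])
    have "cnj (ip' (x k) (x k)) = ip' (x k) (x k)" using ip_cnj[OF sesq', of "x k" "x k"] by simp
    then show "ip' (x k) (x k) = a k" by (simp add: a_def complex_eq_iff)
  qed
  define P where "P k v = scl (ip' v (x k) / a k) (x k)" for k v
  have "unitary_data S n (\<lambda>k. cs.span {x k}) ip' 1 a P"
  proof (rule unitary_data.intro)
    show "cs.span {x k} \<subseteq> S" if "k < n" for k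
      using x_in[OF that] by (intro cs.span_minimal[OF _ subS]) auto
    show "lin (P k)" for k
      unfolding P_def
      by (rule lin_functional, rule functionalI)
        (simp_all add: ip_left[OF sesq'] add_divide_distrib)
    show "P k v \<in> cs.span {x k}" for k v
      unfolding P_def by (intro cs.span_scale cs.span_base) simp
    show "ip' (v - P k v) w = 0" if k: "k < n" and v: "v \<in> S" and w: "w \<in> cs.span {x k}" for k v w
    proof -
      obtain c where "w = scl c (x k)" using w by (auto simp: cs.span_singleton)
      then show ?thesis using a[OF k] by (simp add: P_def ip_left[OF sesq'] ip_right[OF sesq'])
    qed
    show "(\<Sum>k<n. scl (a k) (P k v)) = scl (complex_of_real 1) v" if v: "v \<in> S" for v
    proof -
      have "scl (a k) (P k v) = scl (ip (g v) (x k)) (x k)" if "k < n" for k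
        using a(1)[OF that] ip'_x[OF v that] by (simp add: P_def)
      then have "(\<Sum>k<n. scl (a k) (P k v)) = A (g v)" by (simp add: A_def)
      then show ?thesis using Ag[OF v] by simp
    qed
  qed (use subS sesq' pos' a in auto)
  then show ?thesis by (rule unitarizableI)
qed

definition truncated :: "nat \<Rightarrow> cseq set" where
  "truncated n = {x. \<forall>i\<ge>n. coord x i = 0}"

lemma fin_dim_truncated: "fin_dim (truncated n)"
proof -
  define e where "e i = Cseq (\<lambda>j. if j = i then 1 else 0)" for i :: nat
  have sub: "cs.subspace (truncated n)" by (auto simp: truncated_def cs.subspace_def)
  have "x \<in> cs.span (e ` {..<n})" if x: "x \<in> truncated n" for x
  proof -
    have sum: "coord (\<Sum>k\<in>K. scl (coord x k) (e k)) j = (if j \<in> K then coord x j else 0)"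
      if "finite K" for K j
      using that by (induction K rule: finite_induct) (auto simp: e_def)
    have "x = (\<Sum>k<n. scl (coord x k) (e k))"
      by (rule cseq_eqI) (use x in \<open>auto simp: sum truncated_def\<close>)
    also have "\<dots> \<in> cs.span (e ` {..<n})"
      by (intro cs.span_sum cs.span_scale cs.span_base) auto
    finally show ?thesis .
  qed
  then show ?thesis using sub by (auto simp: fin_dim_def intro!: exI[of _ "e ` {..<n}"])
qed

text \<open>Coordinates with respect to a finite basis.\<close>

lemma presentation_exists:
  assumes "vectorspace complex_field V" "vectorspace.fin_dim complex_field V"
  obtains \<kappa> S where "presentation V \<kappa> S {0}" "fin_dim S"
proof -
  interpret V: vectorspace complex_field V by (rule assms(1))
  obtain \<beta> where \<beta>: "finite \<beta>" "V.basis \<beta>"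
    using V.finite_basis_exists[OF assms(2)] by blast
  then have indpt: "V.lin_indpt \<beta>" and gen: "V.span \<beta> = carrier V" and sub: "\<beta> \<subseteq> carrier V"
    by (auto simp: V.basis_def)
  obtain b where b: "bij_betw b {..<card \<beta>} \<beta>"
    using ex_bij_betw_nat_finite[OF \<beta>(1)] by (auto simp: atLeast0LessThan)
  define n where "n = card \<beta>"
  have b_in: "b i \<in> carrier V" if "i < n" for i
    using b that sub by (auto simp: bij_betw_def n_def)
  define \<kappa> where "\<kappa> x = (\<Oplus>\<^bsub>V\<^esub>i\<in>{..<n}. coord x i \<odot>\<^bsub>V\<^esub> b i)" for x
  have term_in: "c \<odot>\<^bsub>V\<^esub> b i \<in> carrier V" if "i < n" for c i
    using b_in[OF that] by simp
  have \<kappa>_in: "\<kappa> x \<in> carrier V" for x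
    unfolding \<kappa>_def by (rule V.finsum_closed) (auto intro: term_in)
  have add: "\<kappa> (x + y) = \<kappa> x \<oplus>\<^bsub>V\<^esub> \<kappa> y" for x y
  proof -
    have "\<kappa> (x + y) = (\<Oplus>\<^bsub>V\<^esub>i\<in>{..<n}. coord x i \<odot>\<^bsub>V\<^esub> b i \<oplus>\<^bsub>V\<^esub> coord y i \<odot>\<^bsub>V\<^esub> b i)"
      unfolding \<kappa>_def using b_in term_in V.smult_l_distr
      by (intro V.finsum_cong') auto
    also have "\<dots> = \<kappa> x \<oplus>\<^bsub>V\<^esub> \<kappa> y"
      unfolding \<kappa>_def by (rule V.finsum_addf) (auto intro: term_in)
    finally show ?thesis .
  qed
  have smult: "\<kappa> (scl c x) = c \<odot>\<^bsub>V\<^esub> \<kappa> x" for c x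
  proof -
    have "c \<odot>\<^bsub>V\<^esub> \<kappa> x = (\<Oplus>\<^bsub>V\<^esub>i\<in>{..<n}. c \<odot>\<^bsub>V\<^esub> (coord x i \<odot>\<^bsub>V\<^esub> b i))"
      unfolding \<kappa>_def by (rule V.finsum_smult) (auto intro: term_in)
    also have "\<dots> = \<kappa> (scl c x)"
      unfolding \<kappa>_def using b_in term_in V.smult_assoc1
      by (intro V.finsum_cong') auto
    finally show ?thesis by simp
  qed
  have lincomb: "\<kappa> x = V.lincomb (\<lambda>v. coord x (inv_into {..<n} b v)) \<beta>" for x
  proof -
    have inj: "inj_on b {..<n}" and im: "\<beta> = b ` {..<n}" using b by (auto simp: bij_betw_def n_def)
    have "V.lincomb (\<lambda>v. coord x (inv_into {..<n} b v)) \<beta> =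
        (\<Oplus>\<^bsub>V\<^esub>i\<in>{..<n}. coord x (inv_into {..<n} b (b i)) \<odot>\<^bsub>V\<^esub> b i)"
      unfolding V.lincomb_def im using b_in inj by (intro V.finsum_reindex) auto
    also have "\<dots> = \<kappa> x"
      unfolding \<kappa>_def using inj term_in by (intro V.finsum_cong') (auto simp: inv_into_f_f)
    finally show ?thesis by simp
  qed
  have zero: "x = 0" if x: "x \<in> truncated n" "\<kappa> x = \<zero>\<^bsub>V\<^esub>" for x
  proof (rule cseq_eqI)
    fix i
    show "coord x i = coord 0 i"
    proof (cases "i < n")
      case True
      have bi: "b i \<in> \<beta>" "inv_into {..<n} b (b i) = i"
        using b True by (auto simp: bij_betw_def n_def inv_into_f_f)
      have "coord x (inv_into {..<n} b (b i)) = 0"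
      proof (rule ccontr)
        assume "coord x (inv_into {..<n} b (b i)) \<noteq> 0"
        then have "V.lin_dep \<beta>"
          using V.lin_dep_crit[OF \<beta>(1) subset_refl _ bi(1)] x(2) lincomb[of x] by simp
        then show False using indpt by blast
      qed
      then show ?thesis using bi by simp
    next
      case False
      then show ?thesis using x(1) by (simp add: truncated_def)
    qed
  qed
  have zero': "\<kappa> 0 = \<zero>\<^bsub>V\<^esub>"
    using add[of 0 0] \<kappa>_in[of 0] by (simp add: V.add.l_cancel_one')
  have T: "cs.subspace (truncated n)" using fin_dim_truncated fin_dim_subspace by blast
  have "presentation V \<kappa> (truncated n) {0}"
    unfolding presentation_def
  proof (intro conjI ballI allI)
    show "carrier V = \<kappa> ` truncated n"
    proof (intro equalityI subsetI)
      fix v assume "v \<in> carrier V"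
      then obtain a where a: "V.lincomb a \<beta> = v" using V.finite_in_span[OF \<beta>(1) sub, of v] gen by blast
      define x where "x = Cseq (\<lambda>i. if i < n then a (b i) else 0)"
      have "coord x (inv_into {..<n} b u) = a u" if u: "u \<in> \<beta>" for u
        using b u f_inv_into_f[of u b "{..<n}"] inv_into_into[of u b "{..<n}"]
        by (auto simp: x_def bij_betw_def n_def)
      then have "\<kappa> x = v"
        unfolding lincomb a[symmetric] V.lincomb_def using sub
        by (intro V.finsum_cong') auto
      moreover have "x \<in> truncated n" by (simp add: x_def truncated_def)
      ultimately show "v \<in> \<kappa> ` truncated n" by blast
    qed (use \<kappa>_in in auto)
    show "(\<kappa> x = \<kappa> y) = (x - y \<in> {0})" if xy: "x \<in> truncated n" "y \<in> truncated n" for x y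
    proof
      assume eq: "\<kappa> x = \<kappa> y"
      have "\<kappa> (x - y) \<oplus>\<^bsub>V\<^esub> \<kappa> y = \<kappa> y" using add[of "x - y" y] eq by simp
      then have "\<kappa> (x - y) = \<zero>\<^bsub>V\<^esub>" using \<kappa>_in by (simp add: V.add.r_cancel_one)
      then show "x - y \<in> {0}" using zero[OF cs.subspace_diff[OF T xy]] by simp
    qed simp
    show "{0} \<subseteq> truncated n" using cs.subspace_0[OF T] by simp
  qed (use T zero' add smult in auto)
  then show ?thesis using that fin_dim_truncated by blast
qed

lemma presentation_subspace:
  assumes p: "presentation V \<kappa> S {0}" and U: "VectorSpace.subspace complex_field U V"
  shows "cs.subspace {x \<in> S. \<kappa> x \<in> U}"
proof -
  interpret submodule complex_field U V using U by (simp add: VectorSpace.subspace_def)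
  note S = presentationD(1)[OF p]
  show ?thesis
    unfolding cs.subspace_def
  proof (intro conjI ballI allI)
    show "0 \<in> {x \<in> S. \<kappa> x \<in> U}"
      using zero_closed presentationD(5)[OF p] cs.subspace_0[OF S] by simp
    show "x + y \<in> {x \<in> S. \<kappa> x \<in> U}" if "x \<in> {x \<in> S. \<kappa> x \<in> U}" "y \<in> {x \<in> S. \<kappa> x \<in> U}" for x y
      using that m_closed cs.subspace_add[OF S] presentationD(6)[OF p] by simp
    show "scl c x \<in> {x \<in> S. \<kappa> x \<in> U}" if "x \<in> {x \<in> S. \<kappa> x \<in> U}" for c x
      using that smult_closed[of c] cs.subspace_scale[OF S] presentationD(7)[OF p] by simp
  qed
qed

text \<open>Since every linear map on \<open>S\<close> extends to the ambient space, it is enough to test the maps that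
  are linear everywhere.\<close>

definition brick_on :: "cseq set \<Rightarrow> nat \<Rightarrow> (nat \<Rightarrow> cseq set) \<Rightarrow> bool" where
  "brick_on S n Vs \<longleftrightarrow> (\<forall>X. lin X \<and> X ` S \<subseteq> S \<and> (\<forall>k<n. X ` Vs k \<subseteq> Vs k) \<longrightarrow>
     (\<exists>c. \<forall>v\<in>S. X v = scl c v))"

lemma brick_onD:
  assumes "brick_on S n Vs" "lin X" "\<And>x. x \<in> S \<Longrightarrow> X x \<in> S" "\<And>k x. k < n \<Longrightarrow> x \<in> Vs k \<Longrightarrow> X x \<in> Vs k"
  shows "\<exists>c. \<forall>v\<in>S. X v = scl c v"
  using assms unfolding brick_on_def by blast

lemma presentation_brick:
  assumes p: "presentation V \<kappa> S {0}" and brick: "brick (V, Us)"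
  shows "brick_on S (length Us) (\<lambda>k. {x \<in> S. \<kappa> x \<in> Us ! k})"
  unfolding brick_on_def
proof (intro allI impI; elim conjE)
  fix X assume X: "lin X" "X ` S \<subseteq> S"
    "\<forall>k<length Us. X ` {x \<in> S. \<kappa> x \<in> Us ! k} \<subseteq> {x \<in> S. \<kappa> x \<in> Us ! k}"
  have vs: "vectorspace complex_field V"
    and sub: "\<And>U. U \<in> set Us \<Longrightarrow> VectorSpace.subspace complex_field U V"
    using brick by auto
  interpret V: vectorspace complex_field V by (rule vs)
  have carr: "carrier V = \<kappa> ` S" by (rule presentationD(4)[OF p])
  define h where "h = inv_into S \<kappa>"
  have inj: "inj_on \<kappa> S" using presentationD(8)[OF p] by (auto simp: inj_on_def)
  have h: "h (\<kappa> x) = x" if "x \<in> S" for x unfolding h_def using inj that by simp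
  have XS: "X x \<in> S" if "x \<in> S" for x using X(2) that by blast
  define Y where "Y v = \<kappa> (X (h v))" for v
  have Y: "Y (\<kappa> x) = \<kappa> (X x)" if "x \<in> S" for x using that by (simp add: Y_def h)
  have "Y \<in> LinearCombinations.module_hom complex_field V V"
    unfolding LinearCombinations.module_hom_def carr
  proof (intro CollectI conjI allI impI Pi_I; (elim conjE)?; (elim imageE)?)
    fix v x assume "v = \<kappa> x" "x \<in> S"
    then show "Y v \<in> \<kappa> ` S" using Y XS by auto
  next
    fix v w x y assume "v = \<kappa> x" "w = \<kappa> y" and S: "x \<in> S" "y \<in> S"
    moreover have "x + y \<in> S" using S cs.subspace_add[OF presentationD(1)[OF p]] by blast
    ultimately show "Y (v \<oplus>\<^bsub>V\<^esub> w) = Y v \<oplus>\<^bsub>V\<^esub> Y w"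
      by (simp add: presentationD(6)[OF p, symmetric] Y XS cp.linear_add[OF X(1)])
  next
    fix c v x assume "v = \<kappa> x" and S: "x \<in> S"
    moreover have "scl c x \<in> S" using S cs.subspace_scale[OF presentationD(1)[OF p]] by blast
    ultimately show "Y (c \<odot>\<^bsub>V\<^esub> v) = c \<odot>\<^bsub>V\<^esub> Y v"
      by (simp add: presentationD(7)[OF p, symmetric] Y XS cp.linear_scale[OF X(1)])
  qed
  then have lm: "linear_map complex_field V V Y"
    by (intro linear_map.intro mod_hom.intro mod_hom_axioms.intro vs V.module_axioms)
  have "Y ` U \<subseteq> U" if U: "U \<in> set Us" for U
  proof
    fix v assume "v \<in> Y ` U"
    then obtain u where u: "u \<in> U" "v = Y u" by blast
    have "U \<subseteq> carrier V" using sub[OF U] by (auto simp: VectorSpace.subspace_def submodule_def)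
    then obtain x where x: "x \<in> S" "u = \<kappa> x" using u(1) carr by blast
    obtain k where k: "k < length Us" "U = Us ! k" using U by (auto simp: in_set_conv_nth)
    have "X x \<in> {x \<in> S. \<kappa> x \<in> Us ! k}"
      using X(3) k(1) u(1) x unfolding k(2) by blast
    then show "v \<in> U" using u(2) Y[OF x(1)] by (simp add: x(2) k(2))
  qed
  with lm have "\<exists>c. \<forall>v\<in>carrier V. Y v = c \<odot>\<^bsub>V\<^esub> v"
    using brick unfolding brick.simps by blast
  then obtain c where c: "\<And>v. v \<in> carrier V \<Longrightarrow> Y v = c \<odot>\<^bsub>V\<^esub> v" by blast
  have "X x = scl c x" if x: "x \<in> S" for x
  proof -
    have "\<kappa> (X x) = \<kappa> (scl c x)"
      using c[of "\<kappa> x"] x unfolding carr Y[OF x] presentationD(7)[OF p x] by simp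
    then show ?thesis
      using presentationD(8)[OF p XS[OF x] cs.subspace_scale[OF presentationD(1)[OF p] x]] by simp
  qed
  then show "\<exists>c. \<forall>v\<in>S. X v = scl c v" by blast
qed

lemma presentation_line:
  assumes p: "presentation M \<kappa> T {0}" and M: "vectorspace complex_field M"
    and T: "fin_dim T" and dim: "vectorspace.dim complex_field M = 1"
  obtains x where "x \<noteq> 0" "T = cs.span {x}"
proof -
  interpret M: vectorspace complex_field M by (rule M)
  obtain B where B: "finite B" "B \<subseteq> T" "cs.span B = T" using fin_dim_basis[OF T] by metis
  have carr: "carrier M = \<kappa> ` T" by (rule presentationD(4)[OF p])
  have AM: "\<kappa> ` B \<subseteq> carrier M" using B carr by blast
  interpret A: submodule complex_field "M.span (\<kappa> ` B)" M by (rule M.span_is_submodule[OF AM])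
  have "\<kappa> x \<in> M.span (\<kappa> ` B)" if "x \<in> T" for x
  proof -
    have "cs.subspace {x \<in> T. \<kappa> x \<in> M.span (\<kappa> ` B)}"
    proof (rule presentation_subspace[OF p])
      show "VectorSpace.subspace complex_field (M.span (\<kappa> ` B)) M"
        using M A.submodule_axioms by (simp add: VectorSpace.subspace_def)
    qed
    moreover have "B \<subseteq> {x \<in> T. \<kappa> x \<in> M.span (\<kappa> ` B)}"
      using B M.in_own_span[OF AM] by auto
    ultimately have "cs.span B \<subseteq> {x \<in> T. \<kappa> x \<in> M.span (\<kappa> ` B)}" by (intro cs.span_minimal)
    then show ?thesis using that B by blast
  qed
  then have "M.gen_set (\<kappa> ` B)" using A.subset carr by auto
  then have fd: "M.fin_dim" unfolding M.fin_dim_def using B AM by blast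
  obtain \<beta> where \<beta>: "finite \<beta>" "M.basis \<beta>" using M.finite_basis_exists[OF fd] by blast
  have "card \<beta> = 1" using M.dim_basis[OF \<beta>] dim by simp
  then obtain u where u: "\<beta> = {u}" by (auto simp: card_1_singleton_iff)
  have uM: "u \<in> carrier M" and gen: "M.span {u} = carrier M" and ind: "M.lin_indpt {u}"
    using \<beta>(2) by (auto simp: M.basis_def u)
  obtain x where x: "x \<in> T" "u = \<kappa> x" using uM carr by blast
  show ?thesis
  proof
    show "x \<noteq> 0"
    proof
      assume "x = 0"
      then have "u = \<zero>\<^bsub>M\<^esub>" using x presentationD(5)[OF p] by simp
      moreover have "(UNIV :: complex set) \<noteq> {0}" by (metis UNIV_I singletonD zero_neq_one)
      ultimately have "M.lin_dep {u}" by (intro M.zero_lin_dep) auto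
      then show False using ind by blast
    qed
    show "T = cs.span {x}"
    proof
      show "cs.span {x} \<subseteq> T" using x(1) by (intro cs.span_minimal presentationD(1)[OF p]) auto
      show "T \<subseteq> cs.span {x}"
      proof
        fix y assume y: "y \<in> T"
        then have "\<kappa> y \<in> M.span {u}" using gen carr by blast
        then obtain a where a: "M.lincomb a {u} = \<kappa> y" using M.finite_in_span[of "{u}" "\<kappa> y"] uM by auto
        have "M.lincomb a {u} = a u \<odot>\<^bsub>M\<^esub> u"
          unfolding M.lincomb_def using M.finsum_insert[of "{}" u "\<lambda>v. a v \<odot>\<^bsub>M\<^esub> v"] uM by simp
        then have "\<kappa> y = \<kappa> (scl (a u) x)" using a x presentationD(7)[OF p x(1)] by simp
        then have "y = scl (a u) x"
          using presentationD(8)[OF p y cs.subspace_scale[OF presentationD(1)[OF p] x(1)]] by simp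
        then show "y \<in> cs.span {x}" by (auto simp: cs.span_singleton)
      qed
    qed
  qed
qed

text \<open>If the lines do not span \<open>S\<close>, a projection onto their span preserves them all; being scalar, it
  vanishes, and there are no lines at all.\<close>

lemma brick_on_lines_unitarizable:
  assumes S: "fin_dim S" and brick: "brick_on S n (\<lambda>k. cs.span {x k})"
    and x: "\<And>k. k < n \<Longrightarrow> x k \<noteq> 0" "\<And>k. k < n \<Longrightarrow> x k \<in> S"
  shows "unitarizable S n (\<lambda>k. cs.span {x k})"
proof (cases "cs.span (x ` {..<n}) = S")
  case True
  show ?thesis by (rule unitarizable_lines[OF S x(1) True])
next
  case False
  define W where "W = cs.span (x ` {..<n})"
  have WS: "W \<subseteq> S" unfolding W_def using x by (intro cs.span_minimal fin_dim_subspace[OF S]) auto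
  then obtain y where y: "y \<in> S" "y \<notin> W" using False by (auto simp: W_def)
  have W: "cs.subspace W" by (simp add: W_def)
  obtain \<pi> where \<pi>: "lin \<pi>" "\<And>v. \<pi> v \<in> W" "\<And>v. v \<in> W \<Longrightarrow> \<pi> v = v" using lin_projection[OF W] by blast
  have lineW: "cs.span {x k} \<subseteq> W" if "k < n" for k unfolding W_def by (rule cs.span_mono) (use that in auto)
  have "\<exists>c. \<forall>v\<in>S. \<pi> v = scl c v"
  proof (rule brick_onD[OF brick \<pi>(1)])
    show "\<pi> v \<in> S" for v using \<pi>(2) WS by blast
    show "\<pi> v \<in> cs.span {x k}" if "k < n" "v \<in> cs.span {x k}" for k v
      using \<pi>(3)[of v] lineW[OF that(1)] that(2) by auto
  qed
  then obtain c where c: "\<And>v. v \<in> S \<Longrightarrow> \<pi> v = scl c v" by blast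
  have "c = 0"
  proof (rule ccontr)
    assume "c \<noteq> 0"
    then have "y = scl (1 / c) (\<pi> y)" using c[OF y(1)] by simp
    then show False using y(2) cs.subspace_scale[OF W \<pi>(2)[of y], of "1 / c"] by simp
  qed
  then have "w = 0" if "w \<in> W" for w using \<pi>(3)[OF that] c[of w] that WS by auto
  moreover have "x k \<in> W" if "k < n" for k unfolding W_def using that by (intro cs.span_base) auto
  ultimately have n: "n = 0" using x(1) by blast
  obtain ip where ip: "sesquilinear ip" "\<And>v. v \<in> S \<Longrightarrow> v \<noteq> 0 \<Longrightarrow> 0 < Re (ip v v)"
    using fin_dim_ip[OF S] by blast
  have "unitary_data S n (\<lambda>k. cs.span {x k}) ip 0 (\<lambda>k. 1) (\<lambda>k v. 0)"
    by (rule unitary_data.intro) (use n ip fin_dim_subspace[OF S] in auto)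
  then show ?thesis by (rule unitarizableI)
qed

lemma realizable_lines:
  assumes "brick L" "one_dimensional L"
  shows "realizable L"
proof -
  obtain V Us where L: "L = (V, Us)" by (cases L)
  have vs: "vectorspace complex_field V" and fd: "vectorspace.fin_dim complex_field V"
    and sub: "\<And>U. U \<in> set Us \<Longrightarrow> VectorSpace.subspace complex_field U V"
    using assms(1) L by auto
  obtain \<kappa> S where p: "presentation V \<kappa> S {0}" and S: "fin_dim S"
    using presentation_exists[OF vs fd] by blast
  define Vs where "Vs k = {x \<in> S. \<kappa> x \<in> Us ! k}" for k
  define n where "n = length Us"
  have subU: "Us ! k \<subseteq> carrier V" if "k < n" for k
    using sub[OF nth_mem] that by (auto simp: VectorSpace.subspace_def submodule_def n_def)
  have "\<exists>x. x \<noteq> 0 \<and> Vs k = cs.span {x}" if k: "k < n" for k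
  proof -
    have U: "VectorSpace.subspace complex_field (Us ! k) V" using sub k by (simp add: n_def)
    have sV: "cs.subspace (Vs k)" unfolding Vs_def by (rule presentation_subspace[OF p U])
    have "Us ! k = \<kappa> ` Vs k" using subU[OF k] presentationD(4)[OF p] by (force simp: Vs_def)
    then have "presentation (V\<lparr>carrier := Us ! k\<rparr>) \<kappa> (Vs k) {0}"
      using presentation_restrict[OF p sV] cs.subspace_0[OF sV] by (auto simp: Vs_def)
    moreover have "vectorspace complex_field (V\<lparr>carrier := Us ! k\<rparr>)"
      by (rule vectorspace.subspace_is_vs[OF vs U])
    moreover have "fin_dim (Vs k)" by (rule fin_dim_mono[OF S sV]) (auto simp: Vs_def)
    moreover have "vectorspace.dim complex_field (V\<lparr>carrier := Us ! k\<rparr>) = 1"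
      using assms(2) L k by (simp add: n_def)
    ultimately show ?thesis using presentation_line by metis
  qed
  then obtain x where x: "\<And>k. k < n \<Longrightarrow> x k \<noteq> 0" "\<And>k. k < n \<Longrightarrow> Vs k = cs.span {x k}" by metis
  have "brick_on S n Vs" using presentation_brick[OF p] assms(1) unfolding L Vs_def n_def by blast
  then have "brick_on S n (\<lambda>k. cs.span {x k})" using x(2) by (simp add: brick_on_def)
  moreover have "x k \<in> S" if "k < n" for k
    using x(2)[OF that] cs.span_base[of "x k" "{x k}"] by (auto simp: Vs_def)
  ultimately have "unitarizable S n (\<lambda>k. cs.span {x k})"
    using brick_on_lines_unitarizable[OF S] x(1) by blast
  then show ?thesis
  proof (rule realizableI[OF _ _ _ , rotated 3])
    show "length (snd L) = n" by (simp add: L n_def)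
    show "{y \<in> S. \<kappa> y \<in> snd L ! k} = cs.span {x k}" if "k < n" for k
      using x(2)[OF that] by (simp add: L Vs_def)
    show "\<forall>U\<in>set (snd L). U \<subseteq> carrier (fst L)"
      using subU unfolding L n_def by (metis fst_conv snd_conv in_set_conv_nth)
  qed (use vs p L in auto)
qed

lemma generated_realizable: "generated L \<Longrightarrow> realizable L"
proof (induction rule: generated.induct)
  case (lines L)
  then show ?case by (rule realizable_lines)
next
  case (copy V Us k)
  then show ?case using realizable_copy by blast
next
  case (plus L L')
  obtain V Us where L: "L = (V, Us)" by (cases L)
  have "vectorspace complex_field (Phi_plus_space (V, Us))"
    using plus.hyps(2) unfolding isomorphic_def L linear_map_def by (auto simp del: Phi_plus_space.simps)
  then show ?case using realizable_isomorphic[OF realizable_Phi_plus plus.hyps(2)[unfolded L]] plus.IH L by blast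
next
  case (minus L L')
  obtain V Us where L: "L = (V, Us)" by (cases L)
  have "vectorspace complex_field (fst (Phi_minus (V, Us)))"
    using minus.hyps(2) unfolding isomorphic_def L linear_map_def by blast
  then show ?case using realizable_isomorphic[OF realizable_Phi_minus minus.hyps(2)[unfolded L]] minus.IH L by blast
qed

lemma brick_on_cong: "brick_on S n Vs \<Longrightarrow> (\<And>k. k < n \<Longrightarrow> Vs' k = Vs k) \<Longrightarrow> brick_on S n Vs'"
  by (simp add: brick_on_def)

section \<open>Linked collections\<close>

text \<open>The nondegenerate situation in which the two Coxeter functors are inverse to each other: an exact
  sequence \<open>0 \<rightarrow> W \<rightarrow> \<Oplus> s k ` W \<rightarrow> V \<rightarrow> 0\<close>. The collection on \<open>V\<close> consists of the images of the \<open>s k\<close>, the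
  one on \<open>W\<close> of their kernels; the second is \<open>\<Phi>\<^sup>+\<close> of the first and the first is \<open>\<Phi>\<^sup>-\<close> of the second.\<close>

locale linked =
  fixes n :: nat and W V :: "cseq set" and s :: "nat \<Rightarrow> cseq \<Rightarrow> cseq"
  assumes W: "cs.subspace W" and V: "cs.subspace V"
    and s: "\<And>k. k < n \<Longrightarrow> lin (s k)"
    and s_in: "\<And>k w. k < n \<Longrightarrow> w \<in> W \<Longrightarrow> s k w \<in> V"
    and gen: "\<And>x. x \<in> V \<Longrightarrow> \<exists>w. (\<forall>k<n. w k \<in> W) \<and> x = (\<Sum>k<n. s k (w k))"
    and inj: "\<And>w. w \<in> W \<Longrightarrow> (\<And>k. k < n \<Longrightarrow> s k w = 0) \<Longrightarrow> w = 0"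
    and exact: "\<And>w. (\<And>k. k < n \<Longrightarrow> w k \<in> W) \<Longrightarrow>
      (\<Sum>k<n. s k (w k)) = 0 \<longleftrightarrow> (\<exists>u\<in>W. \<forall>k<n. s k (w k) = s k u)"
begin

lemma exactE:
  assumes "\<And>k. k < n \<Longrightarrow> w k \<in> W" "(\<Sum>k<n. s k (w k)) = 0"
  obtains u where "u \<in> W" "\<And>k. k < n \<Longrightarrow> s k (w k) = s k u"
proof -
  have "\<exists>u\<in>W. \<forall>k<n. s k (w k) = s k u" using exact[of w, OF assms(1)] assms(2) by simp
  then show ?thesis using that by blast
qed

lemma sum_s_zero: assumes "w \<in> W" shows "(\<Sum>k<n. s k w) = 0"
proof -
  have "\<exists>u\<in>W. \<forall>k<n. s k w = s k u" using assms by blast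
  then show ?thesis using exact[of "\<lambda>k. w"] assms by simp
qed

lemma unitarizable_target:
  assumes "unitarizable W n (\<lambda>k. {w \<in> W. s k w = 0})"
  shows "unitarizable V n (\<lambda>k. s k ` W)"
proof (rule unitarizable_cokernel[OF assms V s s_in gen])
  fix w assume w: "\<And>k. k < n \<Longrightarrow> w k \<in> W"
  have "w k - u \<in> {w \<in> W. s k w = 0} \<longleftrightarrow> s k (w k) = s k u" if "k < n" "u \<in> W" for k u
    using cs.subspace_diff[OF W w[OF that(1)] that(2)] cp.linear_diff[OF s[OF that(1)]] by simp
  then have "(\<exists>u\<in>W. \<forall>k<n. w k - u \<in> {w \<in> W. s k w = 0}) \<longleftrightarrow> (\<exists>u\<in>W. \<forall>k<n. s k (w k) = s k u)"
    by (intro bex_cong refl all_cong)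
  then show "(\<Sum>k<n. s k (w k)) = 0 \<longleftrightarrow> (\<exists>u\<in>W. \<forall>k<n. w k - u \<in> {w \<in> W. s k w = 0})"
    using exact[of w, OF w] by simp
qed

lemma unitarizable_source:
  assumes "unitarizable V n (\<lambda>k. s k ` W)"
  shows "unitarizable W n (\<lambda>k. {w \<in> W. s k w = 0})"
proof (rule unitarizable_kernel[OF assms W s _ sum_s_zero _ inj])
  fix v assume v: "\<And>k. k < n \<Longrightarrow> v k \<in> s k ` W" "(\<Sum>k<n. v k) = 0"
  have "\<forall>k. \<exists>w. k < n \<longrightarrow> w \<in> W \<and> v k = s k w" using v(1) by blast
  then obtain w where w: "\<And>k. k < n \<Longrightarrow> w k \<in> W" "\<And>k. k < n \<Longrightarrow> v k = s k (w k)" by metis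
  have "(\<Sum>k<n. s k (w k)) = 0" using v(2) w(2) by simp
  from exactE[OF w(1) this] obtain u where
    u: "u \<in> W" "\<And>k. k < n \<Longrightarrow> s k (w k) = s k u" by blast
  then show "\<exists>u\<in>W. \<forall>k<n. s k u = v k" using w(2) by metis
qed auto

text \<open>An endomorphism of the collection on \<open>W\<close> acts on the images \<open>s k ` W\<close>, hence on their direct sum
  compatibly with the subspace \<open>W\<close>, hence on the quotient \<open>V\<close>.\<close>

lemma brick_on_source:
  assumes "brick_on V n (\<lambda>k. s k ` W)"
  shows "brick_on W n (\<lambda>k. {w \<in> W. s k w = 0})"
  unfolding brick_on_def
proof (intro allI impI; elim conjE)
  fix Z assume Z: "lin Z" "Z ` W \<subseteq> W" "\<forall>k<n. Z ` {w \<in> W. s k w = 0} \<subseteq> {w \<in> W. s k w = 0}"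
  have ZW: "Z w \<in> W" if "w \<in> W" for w using Z(2) that by blast
  have Z0: "s k (Z w) = 0" if "k < n" "w \<in> W" "s k w = 0" for k w using Z(3) that by blast
  define T where "T = {f. \<forall>k<n. prj k f \<in> W}"
  have T: "cs.subspace T" using W by (auto simp: T_def cs.subspace_def)
  define A where "A f = (\<Sum>k<n. s k (prj k f))" for f
  have A: "lin A" unfolding A_def by (intro lin_sum lin_comp[OF s lin_prj]) auto
  obtain g where g: "lin g" "\<And>y. g y \<in> T" "\<And>x. x \<in> T \<Longrightarrow> A (g (A x)) = A x"
    using lin_section[OF A T] by blast
  have Ag: "A (g x) = x" if x: "x \<in> V" for x
  proof -
    obtain w where w: "\<And>k. k < n \<Longrightarrow> w k \<in> W" "x = (\<Sum>k<n. s k (w k))" using gen[OF x] by blast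
    then have "x = A (join w)" "join w \<in> T" by (auto simp: A_def T_def)
    then show ?thesis using g(3) by metis
  qed
  define y where "y k x = prj k (g x)" for k x
  have y: "y k x \<in> W" if "k < n" for k x using g(2)[of x] that by (simp add: y_def T_def)
  have lin_y: "lin (y k)" for k unfolding y_def by (rule lin_comp[OF lin_prj g(1)])
  define X where "X x = (\<Sum>k<n. s k (Z (y k x)))" for x
  have X: "lin X" unfolding X_def
    by (intro lin_sum lin_comp[OF s lin_comp[OF Z(1) lin_y]]) auto
  have Xs: "X (s i w) = s i (Z w)" if i: "i < n" and w: "w \<in> W" for i w
  proof -
    define m where "m k = y k (s i w) - (if k = i then w else 0)" for k
    have m: "m k \<in> W" if "k < n" for k
      unfolding m_def using y[OF that] w cs.subspace_0[OF W] by (intro cs.subspace_diff[OF W]) auto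
    have "(\<Sum>k<n. s k (m k)) = (\<Sum>k<n. s k (y k (s i w)) - (if k = i then s i w else 0))"
      unfolding m_def by (intro sum.cong) (auto simp: cp.linear_diff[OF s] cp.linear_0[OF s])
    also have "\<dots> = 0" using Ag[OF s_in[OF i w]] i by (simp add: sum_subtractf A_def y_def)
    finally have "(\<Sum>k<n. s k (m k)) = 0" .
    from exactE[OF m this] obtain u where
      u: "u \<in> W" "\<And>k. k < n \<Longrightarrow> s k (m k) = s k u" by blast
    have "s k (Z (y k (s i w))) = (if k = i then s i (Z w) else 0) + s k (Z u)" if k: "k < n" for k
    proof -
      have "s k (m k - u) = 0" using u(2)[OF k] by (simp add: cp.linear_diff[OF s[OF k]])
      then have "s k (Z (m k - u)) = 0"
        using Z0[OF k cs.subspace_diff[OF W m[OF k] u(1)]] by blast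
      moreover have "Z (y k (s i w)) = Z (m k - u) + (if k = i then Z w else 0) + Z u"
        by (simp add: m_def cp.linear_diff[OF Z(1)] cp.linear_0[OF Z(1)])
      ultimately show ?thesis
        by (cases "k = i") (simp_all add: cp.linear_add[OF s[OF k]] cp.linear_add[OF s[OF i]])
    qed
    then have "X (s i w) = s i (Z w) + (\<Sum>k<n. s k (Z u))"
      unfolding X_def using i by (simp add: sum.distrib)
    then show ?thesis using sum_s_zero[OF ZW[OF u(1)]] by simp
  qed
  have "\<exists>c. \<forall>x\<in>V. X x = scl c x"
  proof (rule brick_onD[OF assms X])
    show "X x \<in> V" if "x \<in> V" for x
      unfolding X_def by (intro cs.subspace_sum[OF V] s_in ZW y) auto
    show "X x \<in> s k ` W" if "k < n" "x \<in> s k ` W" for k x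
      using that Xs ZW by auto
  qed
  then obtain c where c: "\<And>x. x \<in> V \<Longrightarrow> X x = scl c x" by blast
  have "Z w = scl c w" if w: "w \<in> W" for w
  proof -
    have "Z w - scl c w = 0"
    proof (rule inj)
      show "Z w - scl c w \<in> W" using ZW[OF w] w W by (intro cs.subspace_diff cs.subspace_scale)
      show "s k (Z w - scl c w) = 0" if k: "k < n" for k
        using Xs[OF k w] c[OF s_in[OF k w]] by (simp add: cp.linear_diff[OF s[OF k]] cp.linear_scale[OF s[OF k]])
    qed
    then show ?thesis by simp
  qed
  then show "\<exists>c. \<forall>v\<in>W. Z v = scl c v" by blast
qed

definition \<tau> :: "cseq \<Rightarrow> cseq" where
  "\<tau> w = join (\<lambda>k. if k < n then s k w else 0)"

lemma prj_\<tau>: "prj k (\<tau> w) = (if k < n then s k w else 0)"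
  by (simp add: \<tau>_def)

lemma lin_\<tau>: "lin \<tau>"
  unfolding \<tau>_def
proof (rule lin_join)
  show "lin (\<lambda>x. if k < n then s k x else 0)" for k
    by (cases "k < n") (simp_all add: s lin_zero)
qed

lemma \<tau>_inj: assumes "w \<in> W" "\<tau> w = 0" shows "w = 0"
proof (rule inj[OF assms(1)])
  fix k assume "k < n"
  then show "s k w = 0" using prj_\<tau>[of k w] by (simp add: assms(2))
qed

text \<open>An endomorphism of the collection on \<open>V\<close> acts on the direct sum of its subspaces and preserves the
  kernel \<open>W\<close> of the summation map.\<close>

lemma brick_on_target:
  assumes "brick_on W n (\<lambda>k. {w \<in> W. s k w = 0})"
  shows "brick_on V n (\<lambda>k. s k ` W)"
  unfolding brick_on_def
proof (intro allI impI; elim conjE)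
  fix Z assume Z: "lin Z" "Z ` V \<subseteq> V" "\<forall>k<n. Z ` s k ` W \<subseteq> s k ` W"
  obtain g where g: "lin g" "\<And>y. g y \<in> W" "\<And>w. w \<in> W \<Longrightarrow> g (\<tau> w) = w"
    using lin_left_inverse[OF lin_\<tau> W \<tau>_inj] by blast
  define X where "X w = g (join (\<lambda>k. if k < n then Z (s k w) else 0))" for w
  have X: "lin X"
    unfolding X_def
  proof (intro lin_comp[OF g(1)] lin_join)
    show "lin (\<lambda>x. if k < n then Z (s k x) else 0)" for k
      by (cases "k < n") (simp_all add: lin_comp[OF Z(1) s] lin_zero)
  qed
  have sX: "s k (X w) = Z (s k w)" if w: "w \<in> W" and k: "k < n" for k w
  proof -
    have "\<forall>k. \<exists>v. k < n \<longrightarrow> v \<in> W \<and> Z (s k w) = s k v" using Z(3) w by blast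
    then obtain v where v: "\<And>k. k < n \<Longrightarrow> v k \<in> W" "\<And>k. k < n \<Longrightarrow> Z (s k w) = s k (v k)" by metis
    have "(\<Sum>k<n. s k (v k)) = Z (\<Sum>k<n. s k w)" using v(2) by (simp add: cp.linear_sum[OF Z(1)])
    then have "(\<Sum>k<n. s k (v k)) = 0" by (simp add: sum_s_zero[OF w] cp.linear_0[OF Z(1)])
    from exactE[OF v(1) this] obtain u where
      u: "u \<in> W" "\<And>k. k < n \<Longrightarrow> s k (v k) = s k u" by blast
    have "join (\<lambda>k. if k < n then Z (s k w) else 0) = \<tau> u"
      by (rule prj_eqI) (simp add: prj_\<tau> v(2) u(2))
    then have "X w = u" using g(3)[OF u(1)] by (simp add: X_def)
    then show ?thesis using u(2)[OF k] v(2)[OF k] by simp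
  qed
  have "\<exists>c. \<forall>w\<in>W. X w = scl c w"
  proof (rule brick_onD[OF assms X])
    show "X w \<in> W" for w unfolding X_def by (rule g(2))
    show "X w \<in> {w \<in> W. s k w = 0}" if "k < n" "w \<in> {w \<in> W. s k w = 0}" for k w
      using that sX[of w k] g(2) cp.linear_0[OF Z(1)] by (simp add: X_def)
  qed
  then obtain c where c: "\<And>w. w \<in> W \<Longrightarrow> X w = scl c w" by blast
  have Zs: "Z (s k w) = scl c (s k w)" if "k < n" "w \<in> W" for k w
    using sX[OF that(2,1)] c[OF that(2)] by (simp add: cp.linear_scale[OF s[OF that(1)]])
  have "Z x = scl c x" if x: "x \<in> V" for x
  proof -
    obtain w where w: "\<And>k. k < n \<Longrightarrow> w k \<in> W" "x = (\<Sum>k<n. s k (w k))" using gen[OF x] by blast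
    then show ?thesis by (simp add: cp.linear_sum[OF Z(1)] Zs cs.scale_sum_right)
  qed
  then show "\<exists>c. \<forall>v\<in>V. Z v = scl c v" by blast
qed

lemma dim_linked:
  assumes fd: "fin_dim W"
  shows "fin_dim V" "cs.dim V + cs.dim W = (\<Sum>k<n. cs.dim (s k ` W))"
proof -
  let ?H = "dsum n (\<lambda>k. s k ` W)" and ?A = "\<lambda>f. \<Sum>k<n. prj k f"
  have H: "fin_dim ?H" "cs.dim ?H = (\<Sum>k<n. cs.dim (s k ` W))"
    using dim_dsum[of n "\<lambda>k. s k ` W"] fin_dim_image[OF fd s] by auto
  have A: "lin ?A" by (intro lin_intros)
  have sub0: "0 \<in> s k ` W" if "k < n" for k
    using cs.subspace_0[OF cp.linear_subspace_image[OF s[OF that] W]] .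
  have im: "?A ` ?H = V"
  proof (intro equalityI subsetI)
    fix x assume "x \<in> V"
    then obtain w where w: "\<And>k. k < n \<Longrightarrow> w k \<in> W" "x = (\<Sum>k<n. s k (w k))" using gen by blast
    define f where "f = join (\<lambda>k. if k < n then s k (w k) else 0)"
    have "f \<in> ?H" "x = ?A f" using w by (auto simp: dsum_def f_def)
    then show "x \<in> ?A ` ?H" by blast
  next
    fix x assume "x \<in> ?A ` ?H"
    then obtain f where f: "f \<in> ?H" "x = ?A f" by blast
    have "prj k f \<in> V" if "k < n" for k
      using f(1) that s_in[OF that] by (auto simp: dsum_def)
    then show "x \<in> V" unfolding f(2) by (intro cs.subspace_sum[OF V]) auto
  qed
  have ker: "{f \<in> ?H. ?A f = 0} = \<tau> ` W"
  proof (intro equalityI subsetI)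
    fix f assume f: "f \<in> {f \<in> ?H. ?A f = 0}"
    have "\<forall>k. \<exists>v. k < n \<longrightarrow> v \<in> W \<and> prj k f = s k v" using f by (auto simp: dsum_def)
    then obtain v where v: "\<And>k. k < n \<Longrightarrow> v k \<in> W" "\<And>k. k < n \<Longrightarrow> prj k f = s k (v k)" by metis
    have "(\<Sum>k<n. s k (v k)) = 0" using f v(2) by simp
    from exactE[OF v(1) this] obtain u where
      u: "u \<in> W" "\<And>k. k < n \<Longrightarrow> s k (v k) = s k u" by blast
    have "f = \<tau> u"
      by (rule prj_eqI) (use f in \<open>auto simp: prj_\<tau> v(2) u(2) dsum_def\<close>)
    then show "f \<in> \<tau> ` W" using u(1) by blast
  next
    fix f assume "f \<in> \<tau> ` W"
    then obtain w where w: "w \<in> W" "f = \<tau> w" by blast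
    have "?A f = 0" using sum_s_zero[OF w(1)] by (simp add: w(2) prj_\<tau>)
    then show "f \<in> {f \<in> ?H. ?A f = 0}" using w by (simp add: dsum_def prj_\<tau>)
  qed
  show "fin_dim V" using fin_dim_image[OF H(1) A] im by simp
  have "cs.dim (\<tau> ` W) = cs.dim W" by (rule dim_image_inj[OF fd lin_\<tau> \<tau>_inj])
  then show "cs.dim V + cs.dim W = (\<Sum>k<n. cs.dim (s k ` W))"
    using rank_nullity[OF H(1) A] H(2) unfolding im ker by simp
qed

end

lemma span_UN:
  assumes "finite J" "\<And>j. j \<in> J \<Longrightarrow> cs.subspace (Vs j)" "x \<in> cs.span (\<Union>j\<in>J. Vs j)"
  shows "\<exists>v. (\<forall>j\<in>J. v j \<in> Vs j) \<and> x = (\<Sum>j\<in>J. v j)"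
proof -
  let ?R = "{x. \<exists>v. (\<forall>j\<in>J. v j \<in> Vs j) \<and> x = (\<Sum>j\<in>J. v j)}"
  have "cs.subspace ?R"
    unfolding cs.subspace_def
  proof (intro conjI ballI allI)
    show "0 \<in> ?R" using cs.subspace_0[OF assms(2)] by (intro CollectI exI[of _ "\<lambda>_. 0"]) auto
    show "x + y \<in> ?R" if xy: "x \<in> ?R" "y \<in> ?R" for x y
    proof -
      obtain v w where "\<forall>j\<in>J. v j \<in> Vs j" "x = (\<Sum>j\<in>J. v j)" "\<forall>j\<in>J. w j \<in> Vs j" "y = (\<Sum>j\<in>J. w j)"
        using xy by blast
      then show ?thesis using cs.subspace_add[OF assms(2)]
        by (intro CollectI exI[of _ "\<lambda>j. v j + w j"]) (auto simp: sum.distrib)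
    qed
    show "scl c x \<in> ?R" if x: "x \<in> ?R" for c x
    proof -
      obtain v where "\<forall>j\<in>J. v j \<in> Vs j" "x = (\<Sum>j\<in>J. v j)" using x by blast
      then show ?thesis using cs.subspace_scale[OF assms(2)]
        by (intro CollectI exI[of _ "\<lambda>j. scl c (v j)"]) (auto simp: cs.scale_sum_right)
    qed
  qed
  moreover have "(\<Union>j\<in>J. Vs j) \<subseteq> ?R"
  proof
    fix x assume "x \<in> (\<Union>j\<in>J. Vs j)"
    then obtain i where i: "i \<in> J" "x \<in> Vs i" by blast
    then show "x \<in> ?R" using cs.subspace_0[OF assms(2)] assms(1)
      by (intro CollectI exI[of _ "\<lambda>j. if j = i then x else 0"]) auto
  qed
  ultimately have "cs.span (\<Union>j\<in>J. Vs j) \<subseteq> ?R" by (intro cs.span_minimal)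
  then show ?thesis using assms(3) by blast
qed


section \<open>Bricks of dimension at least two\<close>

lemma brick_on_dim_le:
  assumes brick: "brick_on S n Vs" and S: "fin_dim S" and X: "lin X"
    and XS: "\<And>x. x \<in> S \<Longrightarrow> X x \<in> S" and XV: "\<And>k x. k < n \<Longrightarrow> x \<in> Vs k \<Longrightarrow> X x \<in> Vs k"
    and im: "finite B" "\<And>x. x \<in> S \<Longrightarrow> X x \<in> cs.span B" and v: "v \<in> S" "X v \<noteq> 0"
  shows "cs.dim S \<le> card B"
proof -
  have "\<exists>c. \<forall>v\<in>S. X v = scl c v" by (rule brick_onD[OF brick X XS XV])
  then obtain c where c: "\<And>v. v \<in> S \<Longrightarrow> X v = scl c v" by blast
  have "c \<noteq> 0" using c[OF v(1)] v(2) by auto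
  have "x \<in> cs.span B" if "x \<in> S" for x
  proof -
    have "x = scl (1 / c) (X x)" using c[OF that] \<open>c \<noteq> 0\<close> by simp
    then show ?thesis using cs.span_scale[OF im(2)[OF that], of "1 / c"] by simp
  qed
  then show ?thesis using cs.dim_le_card[of S B] im(1) by blast
qed

text \<open>The operator \<open>y \<mapsto> f y x\<close> is an endomorphism of the collection and is not scalar in dimension
  at least two.\<close>

lemma brick_on_no_rank_one:
  assumes brick: "brick_on S n Vs" and S: "fin_dim S" "2 \<le> cs.dim S"
    and sub: "\<And>k. k < n \<Longrightarrow> cs.subspace (Vs k)"
    and x: "x \<in> S" "x \<noteq> 0" and f: "functional f" and v: "v \<in> S" "f v \<noteq> 0"
    and pres: "\<And>k y. k < n \<Longrightarrow> y \<in> Vs k \<Longrightarrow> x \<in> Vs k \<or> f y = 0"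
  shows False
proof -
  have "cs.dim S \<le> card {x}"
  proof (rule brick_on_dim_le[OF brick S(1) lin_functional[OF f, of x]])
    show "scl (f y) x \<in> S" for y by (rule cs.subspace_scale[OF fin_dim_subspace[OF S(1)] x(1)])
    show "scl (f y) x \<in> Vs k" if "k < n" "y \<in> Vs k" for k y
      using pres[OF that] cs.subspace_scale[OF sub[OF that(1)], of x] cs.subspace_0[OF sub[OF that(1)]] by auto
    show "scl (f y) x \<in> cs.span {x}" for y by (intro cs.span_scale cs.span_base) simp
  qed (use v x in auto)
  then show False using S(2) by simp
qed

locale large_brick =
  fixes S :: "cseq set" and n :: nat and Vs :: "nat \<Rightarrow> cseq set"
  assumes brick: "brick_on S n Vs" and fd: "fin_dim S" and dim2: "2 \<le> cs.dim S"
    and sub: "\<And>k. k < n \<Longrightarrow> cs.subspace (Vs k)" and sub_S: "\<And>k. k < n \<Longrightarrow> Vs k \<subseteq> S"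
begin

lemma subS: "cs.subspace S"
  by (rule fin_dim_subspace[OF fd])

lemma fd_Vs: "k < n \<Longrightarrow> fin_dim (Vs k)"
  by (rule fin_dim_mono[OF fd sub sub_S])

lemma no_rank_one:
  assumes "x \<in> S" "x \<noteq> 0" "functional f" "v \<in> S" "f v \<noteq> 0"
    and "\<And>k y. k < n \<Longrightarrow> y \<in> Vs k \<Longrightarrow> x \<in> Vs k \<or> f y = 0"
  shows False
  by (rule brick_on_no_rank_one[OF brick fd dim2 sub assms])

lemma Inter_zero:
  assumes x: "x \<in> S" "\<And>k. k < n \<Longrightarrow> x \<in> Vs k"
  shows "x = 0"
proof (rule ccontr)
  assume "x \<noteq> 0"
  then obtain f where f: "functional f" "f x = 1"
    using functional_separating[of "{0}" x] by auto
  show False by (rule no_rank_one[OF x(1) \<open>x \<noteq> 0\<close> f(1) x(1)]) (use f x in auto)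
qed

lemma Inter_others:
  assumes i: "i < n" and x: "x \<in> S" "\<And>k. k < n \<Longrightarrow> k \<noteq> i \<Longrightarrow> x \<in> Vs k"
  shows "x \<in> Vs i"
proof (rule ccontr)
  assume nx: "x \<notin> Vs i"
  obtain f where f: "functional f" "f x = 1" "\<And>y. y \<in> Vs i \<Longrightarrow> f y = 0"
    using functional_separating[OF sub[OF i] nx] by blast
  have "x \<noteq> 0" using nx cs.subspace_0[OF sub[OF i]] by auto
  show False by (rule no_rank_one[OF x(1) \<open>x \<noteq> 0\<close> f(1) x(1)]) (use f x in auto)
qed

lemma span_all: "cs.span (\<Union>k<n. Vs k) = S"
proof (rule ccontr)
  let ?T = "cs.span (\<Union>k<n. Vs k)"
  assume ne: "?T \<noteq> S"
  have "?T \<subseteq> S" using sub_S by (intro cs.span_minimal subS) auto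
  then obtain x where x: "x \<in> S" "x \<notin> ?T" using ne by blast
  obtain f where f: "functional f" "f x = 1" "\<And>y. y \<in> ?T \<Longrightarrow> f y = 0"
    using functional_separating[OF cs.subspace_span x(2)] by blast
  have "x \<noteq> 0" using x cs.span_zero by auto
  moreover have "f y = 0" if "k < n" "y \<in> Vs k" for k y
    by (rule f(3), rule cs.span_base) (use that in auto)
  ultimately show False using no_rank_one[OF x(1) _ f(1) x(1)] f(2) by auto
qed

lemma span_others:
  assumes i: "i < n" and x: "x \<in> Vs i"
  shows "x \<in> cs.span (\<Union>k\<in>{..<n} - {i}. Vs k)"
proof (rule ccontr)
  let ?T = "cs.span (\<Union>k\<in>{..<n} - {i}. Vs k)"
  assume nx: "x \<notin> ?T"
  obtain f where f: "functional f" "f x = 1" "\<And>y. y \<in> ?T \<Longrightarrow> f y = 0"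
    using functional_separating[OF cs.subspace_span nx] by blast
  have "x \<noteq> 0" using nx cs.span_zero by auto
  moreover have "x \<in> S" using x sub_S[OF i] by blast
  moreover have "x \<in> Vs k \<or> f y = 0" if "k < n" "y \<in> Vs k" for k y
  proof (cases "k = i")
    case False
    have "f y = 0" by (rule f(3), rule cs.span_base) (use that False in auto)
    then show ?thesis ..
  qed (use x in simp)
  ultimately show False using no_rank_one[OF _ _ f(1)] f(2) by fastforce
qed

text \<open>The image of \<open>W = \<Phi>\<^sup>+\<close> in the \<open>k\<close>-th summand is all of \<open>Vs k\<close> because \<open>Vs k\<close> lies in the sum of
  the other subspaces.\<close>

lemma kernel_linked:
  obtains W where "fin_dim W" "linked n W S prj"
    "\<And>k. k < n \<Longrightarrow> prj k ` W = Vs k" 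
proof -
  define W where "W = {f \<in> dsum n Vs. (\<Sum>k<n. prj k f) = 0}"
  have H: "fin_dim (dsum n Vs)" using dim_dsum[of n Vs] fd_Vs by blast
  have W: "cs.subspace W"
    using fin_dim_subspace[OF H] unfolding W_def cs.subspace_def
    by (auto simp: sum.distrib cs.scale_sum_right[symmetric])
  have prj_W: "prj k w \<in> Vs k" if "k < n" "w \<in> W" for k w using that by (simp add: W_def dsum_def)
  have onto: "prj k ` W = Vs k" if k: "k < n" for k
  proof (intro equalityI subsetI)
    fix x assume x: "x \<in> Vs k"
    have fin: "finite ({..<n} - {k})" by simp
    have subk: "cs.subspace (Vs j)" if "j \<in> {..<n} - {k}" for j using that sub by simp
    from span_UN[OF fin subk span_others[OF k cs.subspace_neg[OF sub[OF k] x]]]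
    obtain v where v: "\<forall>j\<in>{..<n} - {k}. v j \<in> Vs j" "- x = (\<Sum>j\<in>{..<n} - {k}. v j)" by blast
    define f where "f = join (\<lambda>j. if j = k then x else if j < n then v j else 0)"
    have prj_f: "prj j f = (if j = k then x else if j < n then v j else 0)" for j by (simp add: f_def)
    have "(\<Sum>j<n. prj j f) = prj k f + (\<Sum>j\<in>{..<n} - {k}. prj j f)"
      using k by (intro sum.remove) auto
    also have "(\<Sum>j\<in>{..<n} - {k}. prj j f) = (\<Sum>j\<in>{..<n} - {k}. v j)"
      by (intro sum.cong) (auto simp: prj_f)
    finally have "(\<Sum>j<n. prj j f) = 0" by (simp add: prj_f v(2)[symmetric])
    then have "f \<in> W" using v(1) x k by (simp add: W_def dsum_def prj_f)
    moreover have "x = prj k f" by (simp add: prj_f)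
    ultimately show "x \<in> prj k ` W" by blast
  qed (use prj_W[OF k] in auto)
  have "linked n W S prj"
  proof (rule linked.intro)
    show "prj k w \<in> S" if "k < n" "w \<in> W" for k w using prj_W[OF that] sub_S[OF that(1)] by blast
    show "\<exists>w. (\<forall>k<n. w k \<in> W) \<and> x = (\<Sum>k<n. prj k (w k))" if "x \<in> S" for x
    proof -
      have mem: "x \<in> cs.span (\<Union>k<n. Vs k)" unfolding span_all by (rule that)
      have subk: "cs.subspace (Vs j)" if "j \<in> {..<n}" for j by (rule sub) (use that in simp)
      from span_UN[OF finite_lessThan subk mem]
      obtain v where v: "\<forall>k\<in>{..<n}. v k \<in> Vs k" "x = (\<Sum>k<n. v k)" by blast
      have "\<forall>k. \<exists>w. k < n \<longrightarrow> w \<in> W \<and> prj k w = v k"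
      proof
        fix k
        show "\<exists>w. k < n \<longrightarrow> w \<in> W \<and> prj k w = v k"
        proof (cases "k < n")
          case True
          then have "v k \<in> prj k ` W" using v(1) unfolding onto[OF True] by simp
          then obtain w where "w \<in> W" "v k = prj k w" by (rule imageE)
          then show ?thesis by auto
        qed simp
      qed
      from choice[OF this] obtain w where w: "\<forall>k. k < n \<longrightarrow> w k \<in> W \<and> prj k (w k) = v k" ..
      have "x = (\<Sum>k<n. prj k (w k))" unfolding v(2) using w by (intro sum.cong) auto
      then show ?thesis using w by blast
    qed
    show "w = 0" if w: "w \<in> W" "\<And>k. k < n \<Longrightarrow> prj k w = 0" for w
    proof (rule prj_eqI)
      have "\<forall>k\<ge>n. prj k w = 0" using w(1) by (simp add: W_def dsum_def)
      then have "prj k w = 0" for k using w(2)[of k] by (meson not_le)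
      then show "prj k w = prj k 0" for k by (simp only: prj_simps)
    qed
    show "(\<Sum>k<n. prj k (w k)) = 0 \<longleftrightarrow> (\<exists>u\<in>W. \<forall>k<n. prj k (w k) = prj k u)"
      if w: "\<And>k. k < n \<Longrightarrow> w k \<in> W" for w
    proof
      assume sum: "(\<Sum>k<n. prj k (w k)) = 0"
      define u where "u = join (\<lambda>k. if k < n then prj k (w k) else 0)"
      have "u \<in> W" using sum prj_W w by (simp add: u_def W_def dsum_def)
      moreover have "\<forall>k<n. prj k (w k) = prj k u" by (simp add: u_def)
      ultimately show "\<exists>u\<in>W. \<forall>k<n. prj k (w k) = prj k u" by blast
    next
      assume "\<exists>u\<in>W. \<forall>k<n. prj k (w k) = prj k u"
      then obtain u where u: "u \<in> W" "\<And>k. k < n \<Longrightarrow> prj k (w k) = prj k u" by blast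
      then show "(\<Sum>k<n. prj k (w k)) = 0" by (simp add: W_def)
    qed
  qed (use W subS lin_prj in auto)
  moreover have "fin_dim W" by (rule fin_dim_mono[OF H W]) (auto simp: W_def)
  ultimately show ?thesis using that onto by blast
qed

text \<open>The kernel of \<open>S \<rightarrow> S / Vs k \<rightarrow> \<Phi>\<^sup>-\<close> is only \<open>Vs k\<close> because \<open>Vs k\<close> contains the intersection of the
  other subspaces.\<close>

lemma cokernel_linked:
  obtains V s where "linked n S V s" "\<And>k. k < n \<Longrightarrow> {w \<in> S. s k w = 0} = Vs k"
proof -
  define K where "K = {f. (\<forall>i<n. prj i f \<in> S) \<and> (\<exists>v\<in>S. \<forall>i<n. prj i f - v \<in> Vs i)}"
  have K: "cs.subspace K" unfolding K_def by (rule subspace_diagonal[OF subS sub])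
  obtain q where q: "lin q" and q0: "\<And>x. q x = 0 \<longleftrightarrow> x \<in> K"
    using lin_with_kernel[OF K] by blast
  define s where "s k v = q (single k v)" for k v
  have lin_s: "lin (s k)" for k unfolding s_def by (rule lin_comp[OF q lin_single])
  define V where "V = {\<Sum>k<n. s k (w k) |w. \<forall>k<n. w k \<in> S}"
  have ker: "s k w = 0 \<longleftrightarrow> w \<in> Vs k" if k: "k < n" and w: "w \<in> S" for k w
  proof
    assume "s k w = 0"
    then obtain v where v: "v \<in> S" "\<And>i. i < n \<Longrightarrow> (if i = k then w else 0) - v \<in> Vs i"
      unfolding s_def q0 K_def prj_single mem_Collect_eq by blast
    have "v \<in> Vs i" if "i < n" "i \<noteq> k" for i
      using v(2)[OF that(1)] that(2) cs.subspace_neg[OF sub[OF that(1)], of "- v"] by simp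
    then have "v \<in> Vs k" using Inter_others[OF k v(1)] by blast
    then show "w \<in> Vs k" using v(2)[OF k] cs.subspace_add[OF sub[OF k], of "w - v" v] by simp
  next
    assume "w \<in> Vs k"
    then show "s k w = 0"
      unfolding s_def q0 K_def prj_single mem_Collect_eq
      using w cs.subspace_0[OF subS] cs.subspace_0[OF sub] by (intro conjI bexI[of _ 0]) auto
  qed
  have sum_s: "(\<Sum>k<n. s k (w k)) = 0 \<longleftrightarrow> (\<exists>u\<in>S. \<forall>k<n. w k - u \<in> Vs k)"
    if w: "\<And>k. k < n \<Longrightarrow> w k \<in> S" for w
  proof -
    have "(\<Sum>k<n. s k (w k)) = q (\<Sum>k<n. single k (w k))" by (simp add: s_def cp.linear_sum[OF q])
    then show ?thesis using w by (simp add: q0 K_def prj_sum_single)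
  qed
  have "linked n S V s"
  proof (rule linked.intro)
    show "cs.subspace V"
      unfolding cs.subspace_def
    proof (intro conjI ballI allI)
      show "0 \<in> V" unfolding V_def using cs.subspace_0[OF subS] cp.linear_0[OF lin_s]
        by (intro CollectI exI[of _ "\<lambda>_. 0"]) simp
      show "x + y \<in> V" if xy: "x \<in> V" "y \<in> V" for x y
      proof -
        obtain w w' where "x = (\<Sum>k<n. s k (w k))" "\<forall>k<n. w k \<in> S" "y = (\<Sum>k<n. s k (w' k))" "\<forall>k<n. w' k \<in> S"
          using xy unfolding V_def by blast
        then show ?thesis unfolding V_def using cs.subspace_add[OF subS]
          by (intro CollectI exI[of _ "\<lambda>k. w k + w' k"]) (simp add: sum.distrib cp.linear_add[OF lin_s])
      qed
      show "scl c x \<in> V" if x: "x \<in> V" for c x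
      proof -
        obtain w where "x = (\<Sum>k<n. s k (w k))" "\<forall>k<n. w k \<in> S" using x unfolding V_def by blast
        then show ?thesis unfolding V_def using cs.subspace_scale[OF subS]
          by (intro CollectI exI[of _ "\<lambda>k. scl c (w k)"]) (simp add: cs.scale_sum_right cp.linear_scale[OF lin_s])
      qed
    qed
    show "s k w \<in> V" if "k < n" "w \<in> S" for k w
    proof -
      have "(\<Sum>j<n. s j (if j = k then w else 0)) = (\<Sum>j<n. if j = k then s k w else 0)"
        by (intro sum.cong) (auto simp: cp.linear_0[OF lin_s])
      then have "s k w = (\<Sum>j<n. s j (if j = k then w else 0))" using that(1) by simp
      then show ?thesis unfolding V_def using that(2) cs.subspace_0[OF subS]
        by (intro CollectI exI[of _ "\<lambda>j. if j = k then w else 0"]) auto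
    qed
    show "\<exists>w. (\<forall>k<n. w k \<in> S) \<and> x = (\<Sum>k<n. s k (w k))" if "x \<in> V" for x
      using that unfolding V_def by blast
    show "w = 0" if "w \<in> S" "\<And>k. k < n \<Longrightarrow> s k w = 0" for w
    proof (rule Inter_zero[OF that(1)])
      show "w \<in> Vs k" if k: "k < n" for k using ker[OF k \<open>w \<in> S\<close>] \<open>\<And>k. k < n \<Longrightarrow> s k w = 0\<close>[OF k] by simp
    qed
    show "(\<Sum>k<n. s k (w k)) = 0 \<longleftrightarrow> (\<exists>u\<in>S. \<forall>k<n. s k (w k) = s k u)"
      if w: "\<And>k. k < n \<Longrightarrow> w k \<in> S" for w
    proof -
      have "s k (w k) = s k u \<longleftrightarrow> w k - u \<in> Vs k" if "k < n" "u \<in> S" for k u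
        using ker[OF that(1) cs.subspace_diff[OF subS w[OF that(1)] that(2)]]
        by (simp add: cp.linear_diff[OF lin_s])
      then have "(\<exists>u\<in>S. \<forall>k<n. s k (w k) = s k u) \<longleftrightarrow> (\<exists>u\<in>S. \<forall>k<n. w k - u \<in> Vs k)"
        by (intro bex_cong refl all_cong)
      then show ?thesis using sum_s[OF w] by simp
    qed
  qed (use subS lin_s in auto)
  moreover have "{w \<in> S. s k w = 0} = Vs k" if "k < n" for k using ker[OF that] sub_S[OF that] by blast
  ultimately show ?thesis using that by blast
qed

end

section \<open>Brick quadruples\<close>

text \<open>Covers the dimensions zero and one, where every subspace is trivial.\<close>

lemma unitarizable_extreme:
  assumes S: "fin_dim S" and Vs: "\<And>k. k < n \<Longrightarrow> Vs k = {0} \<or> Vs k = S"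
  shows "unitarizable S n Vs"
proof -
  obtain ip where ip: "sesquilinear ip" "\<And>x. x \<in> S \<Longrightarrow> x \<noteq> 0 \<Longrightarrow> 0 < Re (ip x x)"
    using fin_dim_ip[OF S] by blast
  have sub: "cs.subspace S" by (rule fin_dim_subspace[OF S])
  define m where "m = card {k. k < n \<and> Vs k = S}"
  define P where "P k v = (if Vs k = S then v else 0)" for k and v :: cseq
  have "unitary_data S n Vs ip m (\<lambda>k. 1) P"
  proof (rule unitary_data.intro)
    show "cs.subspace (Vs k)" "Vs k \<subseteq> S" if "k < n" for k
      using Vs[OF that] sub cs.subspace_0[OF sub] by (elim disjE; simp)+
    show "lin (P k)" for k
      unfolding P_def by (cases "Vs k = S") (simp_all add: lin_id lin_zero)
    show "P k v \<in> Vs k" if "k < n" "v \<in> S" for k v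
      using Vs[OF that(1)] that(2) unfolding P_def by (cases "Vs k = S") simp_all
    show "ip (v - P k v) w = 0" if "k < n" "w \<in> Vs k" for k v w
    proof (cases "Vs k = S")
      case True
      then show ?thesis by (simp add: P_def ip_left[OF ip(1)])
    next
      case False
      then have "w = 0" using Vs[OF that(1)] that(2) by simp
      then show ?thesis by (simp add: ip_right[OF ip(1)])
    qed
    show "(\<Sum>k<n. scl (complex_of_real 1) (P k v)) = scl (complex_of_real (real m)) v" for v
    proof -
      have "(\<Sum>k<n. scl (complex_of_real 1) (P k v)) = (\<Sum>k | k < n \<and> Vs k = S. v)"
        unfolding P_def by (simp add: sum.If_cases Int_def)
      also have "\<dots> = (\<Sum>k | k < n \<and> Vs k = S. scl 1 v)" by simp
      also have "\<dots> = scl (\<Sum>k | k < n \<and> Vs k = S. 1) v" by (simp only: cs.scale_sum_left)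
      finally show ?thesis by (simp add: m_def)
    qed
  qed (use ip sub in auto)
  then show ?thesis by (rule unitarizableI)
qed

lemma dim_one_line:
  assumes "fin_dim T" "cs.dim T = 1"
  obtains x where "x \<noteq> 0" "T = cs.span {x}"
proof -
  obtain B where B: "cs.independent B" "cs.span B = T" "card B = 1"
    using fin_dim_basis[OF assms(1)] assms(2) by metis
  then obtain x where "B = {x}" by (auto simp: card_1_singleton_iff)
  with B that show ?thesis by auto
qed

abbreviation complementary :: "cseq set \<Rightarrow> cseq set \<Rightarrow> cseq set \<Rightarrow> bool" where
  "complementary S A B \<equiv> A \<inter> B = {0} \<and> (\<forall>x\<in>S. \<exists>a\<in>A. \<exists>b\<in>B. x = a + b)"

lemma complementary_projection:
  assumes "cs.subspace A" "cs.subspace B" "complementary S A B" "cs.subspace S" "A \<subseteq> S" "B \<subseteq> S"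
  obtains p where "lin p" "\<And>x. x \<in> A \<Longrightarrow> p x = x" "\<And>x. x \<in> B \<Longrightarrow> p x = 0"
    "\<And>x. x \<in> S \<Longrightarrow> p x \<in> A" "\<And>x. x \<in> S \<Longrightarrow> p x = 0 \<Longrightarrow> x \<in> B"
proof -
  obtain p where p: "lin p" "\<And>x. x \<in> A \<Longrightarrow> p x = x" "\<And>x. x \<in> B \<Longrightarrow> p x = 0"
    using lin_extension_on_sum[OF assms(1,2)] assms(3) by blast
  have split: "\<exists>a b. a \<in> A \<and> b \<in> B \<and> x = a + b \<and> p x = a" if "x \<in> S" for x
  proof -
    obtain a b where ab: "a \<in> A" "b \<in> B" "x = a + b" using assms(3) \<open>x \<in> S\<close> by blast
    then have "p x = a" using p by (simp add: cp.linear_add[OF p(1)])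
    then show ?thesis using ab by blast
  qed
  show ?thesis
  proof (rule that[OF p])
    show "p x \<in> A" if "x \<in> S" for x using split[OF that] by auto
    show "x \<in> B" if "x \<in> S" "p x = 0" for x using split[OF that(1)] that(2) by auto
  qed
qed

lemma mem_sum_left: "cs.subspace B \<Longrightarrow> z \<in> A \<Longrightarrow> z \<in> {a + b |a b. a \<in> A \<and> b \<in> B}"
  using cs.subspace_0[of B] by (intro CollectI exI[of _ z] exI[of _ 0]) simp

lemma mem_sum_right: "cs.subspace A \<Longrightarrow> z \<in> B \<Longrightarrow> z \<in> {a + b |a b. a \<in> A \<and> b \<in> B}"
  using cs.subspace_0[of A] by (intro CollectI exI[of _ 0] exI[of _ z]) simp

text \<open>The quadruples of defect zero, on which the Coxeter functors do not change the dimension.\<close>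

locale balanced_quadruple = large_brick S 4 Vs for S Vs +
  assumes balanced: "(\<Sum>k<4. cs.dim (Vs k)) = 2 * cs.dim S"
begin

text \<open>Otherwise a functional vanishing on \<open>Vs k + Vs l\<close>, multiplied by a vector of \<open>Vs i \<inter> Vs j\<close>, is an
  endomorphism of rank one.\<close>

lemma Int_or_sum:
  assumes ij: "i < 4" "j < 4" and x: "x \<noteq> 0" "x \<in> Vs i" "x \<in> Vs j"
    and kl: "k < 4" "l < 4" "{i, j, k, l} = {..<4}"
  shows "\<forall>y\<in>S. \<exists>a\<in>Vs k. \<exists>b\<in>Vs l. y = a + b"
proof (rule ccontr)
  let ?T = "{a + b |a b. a \<in> Vs k \<and> b \<in> Vs l}"
  assume "\<not> ?thesis"
  then obtain y where y: "y \<in> S" "y \<notin> ?T" by blast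
  obtain f where f: "functional f" "f y = 1" "\<And>z. z \<in> ?T \<Longrightarrow> f z = 0"
    using functional_separating[OF cs.subspace_sums[OF sub[OF kl(1)] sub[OF kl(2)]] y(2)] by blast
  have xS: "x \<in> S" using x(2) sub_S[OF ij(1)] by blast
  have "x \<in> Vs m \<or> f z = 0" if m: "m < 4" "z \<in> Vs m" for m z
  proof -
    have "m \<in> {i, j, k, l}" using m(1) kl(3) by simp
    moreover have "f z = 0" if "m = k"
      using mem_sum_left[OF sub[OF kl(2)]] f(3) m(2) that by blast
    moreover have "f z = 0" if "m = l"
      using mem_sum_right[OF sub[OF kl(1)]] f(3) m(2) that by blast
    ultimately show ?thesis using x by auto
  qed
  then show False using no_rank_one[OF xS x(1) f(1) y(1)] f(2) by simp
qed

lemma dim_sum_eq: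
  assumes "i < 4" "j < 4"
  shows "cs.dim {a + b |a b. a \<in> Vs i \<and> b \<in> Vs j} + cs.dim (Vs i \<inter> Vs j) = cs.dim (Vs i) + cs.dim (Vs j)"
  by (rule dim_sum_Int[OF fd_Vs[OF assms(1)] fd_Vs[OF assms(2)]])

lemma sum_in_S: "i < 4 \<Longrightarrow> j < 4 \<Longrightarrow> {a + b |a b. a \<in> Vs i \<and> b \<in> Vs j} \<subseteq> S"
  using sub_S cs.subspace_add[OF subS] by blast

lemma sum_dims:
  assumes "distinct [i, j, k, l]" "{i, j, k, l} = {..<4}"
  shows "cs.dim (Vs i) + cs.dim (Vs j) + cs.dim (Vs k) + cs.dim (Vs l) = 2 * cs.dim S"
  using balanced assms(1) unfolding assms(2)[symmetric] by simp

text \<open>If the dimensions of one pair were too large, the pair would meet; then the other pair would span,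
  and all four dimensions together would exceed twice the dimension of the space.\<close>

lemma pair_le:
  assumes ij: "i < 4" "j < 4" and kl: "k < 4" "l < 4" "{i, j, k, l} = {..<4}" "distinct [i, j, k, l]"
  shows "cs.dim (Vs i) + cs.dim (Vs j) \<le> cs.dim S"
proof (rule ccontr)
  assume gt: "\<not> ?thesis"
  let ?T = "\<lambda>i j. {a + b |a b. a \<in> Vs i \<and> b \<in> Vs j}"
  have sT: "cs.subspace (?T i j)" by (rule cs.subspace_sums[OF sub[OF ij(1)] sub[OF ij(2)]])
  have "cs.dim (?T i j) \<le> cs.dim S" by (rule dim_mono[OF fd sT sum_in_S[OF ij]])
  then have "cs.dim (Vs i \<inter> Vs j) \<noteq> 0" using dim_sum_eq[OF ij] gt by linarith
  moreover have "fin_dim (Vs i \<inter> Vs j)"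
    by (rule fin_dim_mono[OF fd_Vs[OF ij(1)] cs.subspace_inter[OF sub[OF ij(1)] sub[OF ij(2)]]]) blast
  ultimately have "Vs i \<inter> Vs j \<noteq> {0}" using dim_zero_iff[of "Vs i \<inter> Vs j"] by simp
  then obtain x where x: "x \<noteq> 0" "x \<in> Vs i" "x \<in> Vs j"
    using cs.subspace_0[OF sub[OF ij(1)]] cs.subspace_0[OF sub[OF ij(2)]] by blast
  have "S \<subseteq> ?T k l" using Int_or_sum[OF ij x kl(1-3)] by blast
  then have "?T k l = S" using sum_in_S[OF kl(1,2)] by blast
  then have "cs.dim S \<le> cs.dim (Vs k) + cs.dim (Vs l)" using dim_sum_eq[OF kl(1,2)] by simp
  moreover have "cs.dim (Vs i) + cs.dim (Vs j) + cs.dim (Vs k) + cs.dim (Vs l) = 2 * cs.dim S"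
    using sum_dims[of i j k l] kl by simp
  ultimately show False using gt by linarith
qed

lemma dim_half: "k < 4 \<Longrightarrow> 2 * cs.dim (Vs k) = cs.dim S"
proof -
  assume k: "k < 4"
  have four: "{..<4} = {0, 1, 2, 3 :: nat}" by auto
  have "cs.dim (Vs 0) + cs.dim (Vs 1) \<le> cs.dim S" by (rule pair_le[of 0 1 2 3]) (auto simp: four)
  moreover have "cs.dim (Vs 0) + cs.dim (Vs 2) \<le> cs.dim S" by (rule pair_le[of 0 2 1 3]) (auto simp: four)
  moreover have "cs.dim (Vs 0) + cs.dim (Vs 3) \<le> cs.dim S" by (rule pair_le[of 0 3 1 2]) (auto simp: four)
  moreover have "cs.dim (Vs 1) + cs.dim (Vs 2) \<le> cs.dim S" by (rule pair_le[of 1 2 0 3]) (auto simp: four)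
  moreover have "cs.dim (Vs 1) + cs.dim (Vs 3) \<le> cs.dim S" by (rule pair_le[of 1 3 0 2]) (auto simp: four)
  moreover have "cs.dim (Vs 2) + cs.dim (Vs 3) \<le> cs.dim S" by (rule pair_le[of 2 3 0 1]) (auto simp: four)
  moreover have "cs.dim (Vs 0) + cs.dim (Vs 1) + cs.dim (Vs 2) + cs.dim (Vs 3) = 2 * cs.dim S"
    by (rule sum_dims) (auto simp: four)
  moreover have "k = 0 \<or> k = 1 \<or> k = 2 \<or> k = 3" using k by linarith
  ultimately show ?thesis by (elim disjE; hypsubst; linarith)
qed

lemma complementary_iff:
  assumes ij: "i < 4" "j < 4"
  shows "Vs i \<inter> Vs j = {0} \<longleftrightarrow> (\<forall>x\<in>S. \<exists>a\<in>Vs i. \<exists>b\<in>Vs j. x = a + b)"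
proof -
  let ?T = "{a + b |a b. a \<in> Vs i \<and> b \<in> Vs j}"
  have sT: "cs.subspace ?T" by (rule cs.subspace_sums[OF sub[OF ij(1)] sub[OF ij(2)]])
  have fI: "fin_dim (Vs i \<inter> Vs j)"
    by (rule fin_dim_mono[OF fd_Vs[OF ij(1)] cs.subspace_inter[OF sub[OF ij(1)] sub[OF ij(2)]]]) blast
  have eq: "cs.dim ?T + cs.dim (Vs i \<inter> Vs j) = cs.dim S"
    using dim_sum_eq[OF ij] dim_half[OF ij(1)] dim_half[OF ij(2)] by linarith
  have "Vs i \<inter> Vs j = {0} \<longleftrightarrow> cs.dim ?T = cs.dim S"
    using dim_zero_iff[OF fI] eq by linarith
  also have "\<dots> \<longleftrightarrow> ?T = S"
  proof
    assume "cs.dim ?T = cs.dim S"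
    then show "?T = S" by (intro dim_eq_imp_eq[OF fd sT sum_in_S[OF ij]]) simp
  next
    assume "?T = S"
    then show "cs.dim ?T = cs.dim S" by (rule arg_cong)
  qed
  also have "\<dots> \<longleftrightarrow> (\<forall>x\<in>S. \<exists>a\<in>Vs i. \<exists>b\<in>Vs j. x = a + b)"
    using sum_in_S[OF ij] by blast
  finally show ?thesis .
qed

text \<open>Suppose \<open>Vs i\<close> and \<open>Vs j\<close> are complementary and the other two are not. Take \<open>w\<close> in both of the
  other two and a functional \<open>f\<close> that kills both. With \<open>u\<close> in \<open>Vs i\<close> such that \<open>u + w\<close> is in \<open>Vs j\<close>,
  and \<open>r\<close> the projection onto \<open>Vs j\<close> along \<open>Vs i\<close>, the operator \<open>x \<mapsto> f x u + f (r x) w\<close> preserves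
  all four subspaces. It is a nonzero scalar of rank at most two.\<close>

lemma mixed_dim:
  assumes idx: "i < 4" "j < 4" "k < 4" "l < 4" "{i, j, k, l} = {..<4}"
    and ij: "Vs i \<inter> Vs j = {0}" and kl: "Vs k \<inter> Vs l \<noteq> {0}"
  shows "cs.dim S \<le> 2"
proof -
  have cij: "complementary S (Vs i) (Vs j)" using ij complementary_iff[OF idx(1,2)] by blast
  have cji: "complementary S (Vs j) (Vs i)"
    using cij by (metis Int_commute add.commute)
  obtain w where w: "w \<noteq> 0" "w \<in> Vs k" "w \<in> Vs l"
    using kl cs.subspace_0[OF sub[OF idx(3)]] cs.subspace_0[OF sub[OF idx(4)]] by blast
  have wS: "w \<in> S" using w(2) sub_S[OF idx(3)] by blast
  let ?T = "{a + b |a b. a \<in> Vs k \<and> b \<in> Vs l}"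
  obtain y where y: "y \<in> S" "y \<notin> ?T" using kl complementary_iff[OF idx(3,4)] by blast
  obtain f where f: "functional f" "f y = 1" "\<And>z. z \<in> ?T \<Longrightarrow> f z = 0"
    using functional_separating[OF cs.subspace_sums[OF sub[OF idx(3)] sub[OF idx(4)]] y(2)] by blast
  have fk: "f z = 0" if "z \<in> Vs k" for z
    by (rule f(3)[OF mem_sum_left[OF sub[OF idx(4)] that]])
  have fl: "f z = 0" if "z \<in> Vs l" for z
    by (rule f(3)[OF mem_sum_right[OF sub[OF idx(3)] that]])
  obtain p where p: "lin p" "\<And>x. x \<in> Vs i \<Longrightarrow> p x = x" "\<And>x. x \<in> Vs j \<Longrightarrow> p x = 0"
    "\<And>x. x \<in> S \<Longrightarrow> p x \<in> Vs i" "\<And>x. x \<in> S \<Longrightarrow> p x = 0 \<Longrightarrow> x \<in> Vs j"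
    using complementary_projection[OF sub[OF idx(1)] sub[OF idx(2)] cij subS sub_S[OF idx(1)] sub_S[OF idx(2)]]
    by blast
  obtain r where r: "lin r" "\<And>x. x \<in> Vs j \<Longrightarrow> r x = x" "\<And>x. x \<in> Vs i \<Longrightarrow> r x = 0"
    "\<And>x. x \<in> S \<Longrightarrow> r x \<in> Vs j" "\<And>x. x \<in> S \<Longrightarrow> r x = 0 \<Longrightarrow> x \<in> Vs i"
    using complementary_projection[OF sub[OF idx(2)] sub[OF idx(1)] cji subS sub_S[OF idx(2)] sub_S[OF idx(1)]]
    by blast
  define u where "u = - p w"
  have u: "u \<in> Vs i" unfolding u_def by (rule cs.subspace_neg[OF sub[OF idx(1)] p(4)[OF wS]])
  have uS: "u \<in> S" using u sub_S[OF idx(1)] by blast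
  have uw: "u + w \<in> Vs j"
  proof (rule p(5))
    show "u + w \<in> S" by (rule cs.subspace_add[OF subS uS wS])
    show "p (u + w) = 0" using p(2)[OF p(4)[OF wS]]
      by (simp add: u_def cp.linear_diff[OF p(1)])
  qed
  define X where "X x = scl (f x) u + scl (f (r x)) w" for x
  have X: "lin X" unfolding X_def
    by (intro lin_add lin_functional f(1) functional_comp[OF f(1) r(1)])
  have f0: "f 0 = 0" by (rule cf.linear_0[OF f(1)])
  have all: "m = i \<or> m = j \<or> m = k \<or> m = l" if "m < 4" for m
  proof -
    have "m \<in> {i, j, k, l}" using that idx(5) by simp
    then show ?thesis by auto
  qed
  have XS: "X x \<in> S" for x
    unfolding X_def by (intro cs.subspace_add[OF subS] cs.subspace_scale[OF subS] uS wS)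
  have XV: "X x \<in> Vs m" if m: "m < 4" "x \<in> Vs m" for m x
    using all[OF m(1)]
  proof (elim disjE)
    assume "m = i"
    then show ?thesis using m r(3) u cs.subspace_scale[OF sub[OF idx(1)]] by (simp add: X_def f0)
  next
    assume "m = j"
    then have "X x = scl (f x) (u + w)" using m r(2) by (simp add: X_def cs.scale_right_distrib)
    then show ?thesis using uw \<open>m = j\<close> cs.subspace_scale[OF sub[OF idx(2)]] by simp
  next
    assume "m = k"
    then show ?thesis using m fk w cs.subspace_scale[OF sub[OF idx(3)]] by (simp add: X_def)
  next
    assume "m = l"
    then show ?thesis using m fl w cs.subspace_scale[OF sub[OF idx(4)]] by (simp add: X_def)
  qed
  have w_not: "w \<notin> Vs i" "w \<notin> Vs j"
  proof -
    have zero: "w = 0" if "\<And>m. m < 4 \<Longrightarrow> w \<in> Vs m" using Inter_zero[OF wS that] .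
    show "w \<notin> Vs i"
    proof
      assume wi: "w \<in> Vs i"
      have "w \<in> Vs j" by (rule Inter_others[OF idx(2) wS]) (use all w wi in metis)
      then show False using zero all w wi by metis
    qed
    show "w \<notin> Vs j"
    proof
      assume wj: "w \<in> Vs j"
      have "w \<in> Vs i" by (rule Inter_others[OF idx(1) wS]) (use all w wj in metis)
      then show False using zero all w wj by metis
    qed
  qed
  obtain a b where ab: "a \<in> Vs i" "b \<in> Vs j" "y = a + b" using cij y(1) by blast
  have "\<exists>v\<in>S. X v \<noteq> 0"
  proof (cases "f a = 0")
    case False
    have "u \<noteq> 0" using uw w_not(2) by auto
    then have "X a \<noteq> 0" using False r(3)[OF ab(1)] by (simp add: X_def f0)
    then show ?thesis using ab(1) sub_S[OF idx(1)] by blast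
  next
    case True
    then have "f b \<noteq> 0" using f(2) ab(3) by (simp add: cf.linear_add[OF f(1)])
    moreover have "u + w \<noteq> 0"
    proof
      assume "u + w = 0"
      then have "w = - u" by (simp add: eq_neg_iff_add_eq_0 add.commute)
      then show False using w_not(1) cs.subspace_neg[OF sub[OF idx(1)] u] by simp
    qed
    moreover have "X b = scl (f b) (u + w)" using r(2)[OF ab(2)] by (simp add: X_def cs.scale_right_distrib)
    ultimately have "X b \<noteq> 0" by simp
    then show ?thesis using ab(2) sub_S[OF idx(2)] by blast
  qed
  then obtain v where v: "v \<in> S" "X v \<noteq> 0" by blast
  have "cs.dim S \<le> card {u, w}"
  proof (rule brick_on_dim_le[OF brick fd X XS XV _ _ v])
    show "X x \<in> cs.span {u, w}" for x
      unfolding X_def by (rule cs.span_add; rule cs.span_scale; rule cs.span_base; simp)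
  qed simp_all
  also have "\<dots> \<le> 2" by (simp add: card_insert_if)
  finally show ?thesis .
qed

text \<open>If all pairs are complementary, then \<open>S = A \<oplus> B\<close>, and \<open>C\<close>, \<open>D\<close> are the graphs of isomorphisms
  \<open>\<phi>\<close>, \<open>\<psi>\<close> from \<open>A\<close> to \<open>B\<close>. The operator that is \<open>\<psi>\<^sup>-\<^sup>1\<phi>\<close> on \<open>A\<close> and \<open>\<phi>\<psi>\<^sup>-\<^sup>1\<close> on \<open>B\<close> is an endomorphism, so
  \<open>\<phi> = c \<psi>\<close> for a scalar \<open>c\<close>. After that every operator on \<open>A\<close> extends to an endomorphism of the
  quadruple, and one of rank one on \<open>A\<close> gives the bound.\<close>

lemma generic_dim:
  assumes all: "\<And>i j. i < 4 \<Longrightarrow> j < 4 \<Longrightarrow> i \<noteq> j \<Longrightarrow> Vs i \<inter> Vs j = {0}"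
  shows "cs.dim S \<le> 2"
proof -
  define A B C D where "A = Vs 0" and "B = Vs 1" and "C = Vs 2" and "D = Vs 3"
  have subs: "cs.subspace A" "cs.subspace B" "cs.subspace C" "cs.subspace D"
    using sub by (auto simp: A_def B_def C_def D_def)
  have inS: "A \<subseteq> S" "B \<subseteq> S" "C \<subseteq> S" "D \<subseteq> S"
    using sub_S by (auto simp: A_def B_def C_def D_def)
  have compl: "complementary S (Vs i) (Vs j)" if "i < 4" "j < 4" "i \<noteq> j" for i j
    using all[OF that] complementary_iff[OF that(1,2)] by blast
  have cAB: "complementary S A B" and cBA: "complementary S B A" and cAD: "complementary S A D"
    and cBC: "complementary S B C" and cCA: "complementary S C A"
    unfolding A_def B_def C_def D_def by (rule compl; simp)+
  obtain pA where pA: "lin pA" "\<And>x. x \<in> A \<Longrightarrow> pA x = x" "\<And>x. x \<in> B \<Longrightarrow> pA x = 0"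
    "\<And>x. x \<in> S \<Longrightarrow> pA x \<in> A" "\<And>x. x \<in> S \<Longrightarrow> pA x = 0 \<Longrightarrow> x \<in> B"
    using complementary_projection[OF subs(1,2) cAB subS inS(1,2)] by blast
  obtain pB where pB: "lin pB" "\<And>x. x \<in> B \<Longrightarrow> pB x = x" "\<And>x. x \<in> A \<Longrightarrow> pB x = 0"
    "\<And>x. x \<in> S \<Longrightarrow> pB x \<in> B" "\<And>x. x \<in> S \<Longrightarrow> pB x = 0 \<Longrightarrow> x \<in> A"
    using complementary_projection[OF subs(2,1) cBA subS inS(2,1)] by blast
  \<comment> \<open>On \<open>A\<close> and \<open>B\<close> the projections \<open>\<beta>\<close> onto \<open>B\<close> along \<open>C\<close> and \<open>\<alpha>\<close> onto \<open>A\<close> along \<open>D\<close> are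
    \<open>-\<phi>\<close> and \<open>-\<psi>\<^sup>-\<^sup>1\<close>.\<close>
  obtain \<alpha> where \<alpha>: "lin \<alpha>" "\<And>x. x \<in> A \<Longrightarrow> \<alpha> x = x" "\<And>x. x \<in> D \<Longrightarrow> \<alpha> x = 0"
    "\<And>x. x \<in> S \<Longrightarrow> \<alpha> x \<in> A" "\<And>x. x \<in> S \<Longrightarrow> \<alpha> x = 0 \<Longrightarrow> x \<in> D"
    using complementary_projection[OF subs(1,4) cAD subS inS(1,4)] by blast
  obtain \<beta> where \<beta>: "lin \<beta>" "\<And>x. x \<in> B \<Longrightarrow> \<beta> x = x" "\<And>x. x \<in> C \<Longrightarrow> \<beta> x = 0"
    "\<And>x. x \<in> S \<Longrightarrow> \<beta> x \<in> B" "\<And>x. x \<in> S \<Longrightarrow> \<beta> x = 0 \<Longrightarrow> x \<in> C"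
    using complementary_projection[OF subs(2,3) cBC subS inS(2,3)] by blast
  obtain r where r: "lin r" "\<And>x. x \<in> C \<Longrightarrow> r x = x" "\<And>x. x \<in> A \<Longrightarrow> r x = 0"
    "\<And>x. x \<in> S \<Longrightarrow> r x \<in> C" "\<And>x. x \<in> S \<Longrightarrow> r x = 0 \<Longrightarrow> x \<in> A"
    using complementary_projection[OF subs(3,1) cCA subS inS(3,1)] by blast
  have \<alpha>S: "\<alpha> x \<in> S" and \<beta>S: "\<beta> x \<in> S" if "x \<in> S" for x using \<alpha>(4) \<beta>(4) inS that by blast+
  have C_split: "\<beta> a = - b" if "a \<in> A" "b \<in> B" "a + b \<in> C" for a b
    using \<beta>(3)[OF that(3)] \<beta>(2)[OF that(2)] by (simp add: cp.linear_add[OF \<beta>(1)] eq_neg_iff_add_eq_0)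
  have D_split: "\<alpha> b = - a" if "a \<in> A" "b \<in> B" "a + b \<in> D" for a b
    using \<alpha>(3)[OF that(3)] \<alpha>(2)[OF that(1)]
    by (simp add: cp.linear_add[OF \<alpha>(1)] eq_neg_iff_add_eq_0 add.commute)
  have inC: "e - \<beta> e \<in> C" if "e \<in> S" for e
    by (rule \<beta>(5)[OF cs.subspace_diff[OF subS that \<beta>S[OF that]]])
      (simp add: cp.linear_diff[OF \<beta>(1)] \<beta>(2)[OF \<beta>(4)[OF that]])
  have inD: "e - \<alpha> e \<in> D" if "e \<in> S" for e
    by (rule \<alpha>(5)[OF cs.subspace_diff[OF subS that \<alpha>S[OF that]]])
      (simp add: cp.linear_diff[OF \<alpha>(1)] \<alpha>(2)[OF \<alpha>(4)[OF that]])
  have split: "\<exists>a\<in>A. \<exists>b\<in>B. z = a + b" if "z \<in> S" for z using cAB that by blast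
  have four: "m = 0 \<or> m = 1 \<or> m = 2 \<or> m = 3" if "m < 4" for m :: nat using that by linarith
  define X where "X x = \<alpha> (\<beta> (pA x)) + \<beta> (\<alpha> (pB x))" for x
  have X: "lin X" unfolding X_def
    by (intro lin_add lin_comp[OF \<alpha>(1)] lin_comp[OF \<beta>(1)] pA(1) pB(1))
  have XA: "X a = \<alpha> (\<beta> a)" if "a \<in> A" for a
    using pA(2)[OF that] pB(3)[OF that] by (simp add: X_def cp.linear_0[OF \<alpha>(1)] cp.linear_0[OF \<beta>(1)])
  have XB: "X b = \<beta> (\<alpha> b)" if "b \<in> B" for b
    using pA(3)[OF that] pB(2)[OF that] by (simp add: X_def cp.linear_0[OF \<alpha>(1)] cp.linear_0[OF \<beta>(1)])
  have XA_in: "X a \<in> A" if "a \<in> A" for a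
    unfolding XA[OF that] by (rule \<alpha>(4)[OF \<beta>S[OF subsetD[OF inS(1) that]]])
  have XB_in: "X b \<in> B" if "b \<in> B" for b
    unfolding XB[OF that] by (rule \<beta>(4)[OF \<alpha>S[OF subsetD[OF inS(2) that]]])
  have XC: "X z \<in> C" if z: "z \<in> C" for z
  proof -
    obtain a b where ab: "a \<in> A" "b \<in> B" "z = a + b" using split z inS(3) by blast
    have "\<beta> a = - b" using C_split ab z by blast
    then have "X z = - (\<alpha> b - \<beta> (\<alpha> b))"
      by (simp add: ab(3) cp.linear_add[OF X] XA[OF ab(1)] XB[OF ab(2)] cp.linear_neg[OF \<alpha>(1)])
    moreover have "\<alpha> b \<in> S" using \<alpha>S ab(2) inS by blast
    ultimately show ?thesis using cs.subspace_neg[OF subs(3) inC] by simp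
  qed
  have XD: "X z \<in> D" if z: "z \<in> D" for z
  proof -
    obtain a b where ab: "a \<in> A" "b \<in> B" "z = a + b" using split z inS(4) by blast
    have "\<alpha> b = - a" using D_split ab z by blast
    then have "X z = - (\<beta> a - \<alpha> (\<beta> a))"
      by (simp add: ab(3) cp.linear_add[OF X] XA[OF ab(1)] XB[OF ab(2)] cp.linear_neg[OF \<beta>(1)])
    moreover have "\<beta> a \<in> S" using \<beta>S ab(1) inS by blast
    ultimately show ?thesis using cs.subspace_neg[OF subs(4) inD] by simp
  qed
  have "\<exists>c. \<forall>x\<in>S. X x = scl c x"
  proof (rule brick_onD[OF brick X])
    show "X x \<in> S" if x: "x \<in> S" for x
    proof -
      obtain a b where ab: "a \<in> A" "b \<in> B" "x = a + b" using split[OF x] by blast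
      have "X a + X b \<in> S"
        using XA_in[OF ab(1)] XB_in[OF ab(2)] inS by (intro cs.subspace_add[OF subS]) auto
      then show ?thesis by (simp add: cp.linear_add[OF X] ab(3))
    qed
    show "X x \<in> Vs m" if m: "m < 4" "x \<in> Vs m" for m x
      using four[OF m(1)] m(2) XA_in XB_in XC XD
      unfolding A_def B_def C_def D_def by (elim disjE) auto
  qed
  then obtain c where c: "\<And>x. x \<in> S \<Longrightarrow> X x = scl c x" by blast
  have "A \<noteq> {0}" using dim_half[of 0] dim2 by (auto simp: A_def)
  then obtain u where u: "u \<in> A" "u \<noteq> 0" using cs.subspace_0[OF subs(1)] by blast
  have uS: "u \<in> S" using u inS by blast
  have uB: "u \<notin> B" using u cAB by blast
  obtain f where f: "functional f" "f u = 1" "\<And>z. z \<in> B \<Longrightarrow> f z = 0"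
    using functional_separating[OF subs(2) uB] by blast
  have f0: "f 0 = 0" by (rule cf.linear_0[OF f(1)])
  define w where "w = - \<beta> u"
  have w: "w \<in> B" unfolding w_def by (rule cs.subspace_neg[OF subs(2) \<beta>(4)[OF uS]])
  have wS: "w \<in> S" using w inS by blast
  have uw: "u + w \<in> C" using inC[OF uS] by (simp add: w_def)
  have \<alpha>w: "\<alpha> w = - scl c u"
    using c[OF uS] XA[OF u(1)] by (simp add: w_def cp.linear_neg[OF \<alpha>(1)])
  define Y where "Y x = scl (f x) u + scl (f (r x)) w" for x
  have Y: "lin Y" unfolding Y_def
    by (intro lin_add lin_functional f(1) functional_comp[OF f(1) r(1)])
  have YS: "Y x \<in> S" for x
    unfolding Y_def by (intro cs.subspace_add[OF subS] cs.subspace_scale[OF subS] uS wS)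
  have YA: "Y x \<in> A" if "x \<in> A" for x
    using that r(3) u cs.subspace_scale[OF subs(1)] by (simp add: Y_def f0)
  have YB: "Y x \<in> B" if "x \<in> B" for x
    using that f(3) w cs.subspace_scale[OF subs(2)] by (simp add: Y_def)
  have YC: "Y x \<in> C" if "x \<in> C" for x
  proof -
    have "Y x = scl (f x) (u + w)" using that r(2) by (simp add: Y_def cs.scale_right_distrib)
    then show ?thesis using uw cs.subspace_scale[OF subs(3)] by simp
  qed
  have YD: "Y z \<in> D" if z: "z \<in> D" for z
  proof -
    have zS: "z \<in> S" using z inS by blast
    obtain a b where ab: "a \<in> A" "b \<in> B" "z = a + b" using split[OF zS] by blast
    have aS: "a \<in> S" "b \<in> S" using ab inS by blast+
    have "\<alpha> b = - a" using D_split ab z by blast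
    then have "- \<beta> a = scl c b"
      using c[OF aS(2)] XB[OF ab(2)] by (simp add: cp.linear_neg[OF \<beta>(1)])
    then have "\<beta> a = - scl c b" by (metis minus_minus)
    then have acb: "a + scl c b \<in> C" using inC[OF aS(1)] by simp
    have "f (r (a + scl c b)) = f (a + scl c b)" using r(2)[OF acb] by simp
    then have "c * f (r b) = f a"
      using r(3)[OF ab(1)] f(3)[OF ab(2)]
      by (simp add: cp.linear_add[OF r(1)] cp.linear_scale[OF r(1)] cf.linear_add[OF f(1)] cf.linear_scale[OF f(1)] f0)
    moreover have "Y z = scl (f a) u + scl (f (r b)) w"
      using r(3)[OF ab(1)] f(3)[OF ab(2)]
      by (simp add: Y_def ab(3) cp.linear_add[OF r(1)] cf.linear_add[OF f(1)] f0)
    ultimately have "\<alpha> (Y z) = 0"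
      using \<alpha>(2)[OF u(1)]
      by (simp add: cp.linear_add[OF \<alpha>(1)] cp.linear_scale[OF \<alpha>(1)] \<alpha>w mult.commute)
    then show ?thesis by (rule \<alpha>(5)[OF YS])
  qed
  have "Y u = u" using f(2) r(3)[OF u(1)] by (simp add: Y_def f0)
  have "cs.dim S \<le> card {u, w}"
  proof (rule brick_on_dim_le[OF brick fd Y YS])
    show "Y x \<in> Vs m" if m: "m < 4" "x \<in> Vs m" for m x
      using four[OF m(1)] m(2) YA YB YC YD unfolding A_def B_def C_def D_def by (elim disjE) auto
    show "Y x \<in> cs.span {u, w}" for x
      unfolding Y_def by (rule cs.span_add; rule cs.span_scale; rule cs.span_base; simp)
    show "u \<in> S" "Y u \<noteq> 0" using uS u(2) \<open>Y u = u\<close> by auto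
  qed simp_all
  also have "\<dots> \<le> 2" by (simp add: card_insert_if)
  finally show ?thesis .
qed

lemma dim_eq_2: "cs.dim S = 2"
proof -
  have "cs.dim S \<le> 2"
  proof (cases "\<forall>i<4. \<forall>j<4. i \<noteq> j \<longrightarrow> Vs i \<inter> Vs j = {0}")
    case True
    then show ?thesis by (intro generic_dim) auto
  next
    case False
    then obtain k l where kl: "k < 4" "l < 4" "k \<noteq> l" "Vs k \<inter> Vs l \<noteq> {0}" by blast
    have "\<exists>i j. i < 4 \<and> j < 4 \<and> {k, l, i, j} = {..<4}"
    proof -
      have four: "{..<4} = {0, 1, 2, 3 :: nat}" by auto
      have "card ({..<4} - {k, l}) = 2" using kl by (subst card_Diff_subset) auto
      then obtain i j where ij: "{..<4} - {k, l} = {i, j}" by (auto simp: card_2_iff)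
      then have "i \<in> {..<4}" "j \<in> {..<4}" by blast+
      moreover have "{k, l, i, j} = {..<4}" using ij kl by blast
      ultimately show ?thesis by auto
    qed
    then obtain i j where ij: "i < 4" "j < 4" "{k, l, i, j} = {..<4}" by blast
    obtain x where x: "x \<noteq> 0" "x \<in> Vs k" "x \<in> Vs l"
      using kl cs.subspace_0[OF sub[OF kl(1)]] cs.subspace_0[OF sub[OF kl(2)]] by blast
    have "Vs i \<inter> Vs j = {0}"
      unfolding complementary_iff[OF ij(1,2)] by (rule Int_or_sum[OF kl(1,2) x ij])
    moreover have "{i, j, k, l} = {..<4}" using ij(3) by blast
    ultimately show ?thesis using mixed_dim[OF ij(1,2) kl(1,2)] kl(4) by blast
  qed
  then show ?thesis using dim2 by simp
qed

lemma balanced_unitarizable: "unitarizable S 4 Vs"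
proof -
  have "\<exists>x. x \<noteq> 0 \<and> Vs k = cs.span {x}" if k: "k < 4" for k
  proof -
    have "cs.dim (Vs k) = 1" using dim_half[OF k] dim_eq_2 by simp
    then show ?thesis using dim_one_line[OF fd_Vs[OF k]] by metis
  qed
  then have "\<forall>k. \<exists>x. k < 4 \<longrightarrow> x \<noteq> 0 \<and> Vs k = cs.span {x}" by blast
  from choice[OF this] obtain x where x: "\<And>k. k < 4 \<Longrightarrow> x k \<noteq> 0" "\<And>k. k < 4 \<Longrightarrow> Vs k = cs.span {x k}" by blast
  have "unitarizable S 4 (\<lambda>k. cs.span {x k})"
  proof (rule brick_on_lines_unitarizable[OF fd _ x(1)])
    show "brick_on S 4 (\<lambda>k. cs.span {x k})" by (rule brick_on_cong[OF brick]) (simp add: x(2))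
    show "x k \<in> S" if "k < 4" for k
      using sub_S[OF that] unfolding x(2)[OF that] using cs.span_base[of "x k" "{x k}"] by blast
  qed
  then show ?thesis by (rule unitarizable_cong) (simp add: x(2))
qed

end

text \<open>The dimension formula of linked collections shows that \<open>\<Phi>\<^sup>+\<close> lowers the dimension when the
  dimensions of the subspaces add up to less than \<open>2 dim S\<close>, and \<open>\<Phi>\<^sup>-\<close> when they add up to more.\<close>

theorem brick_on_quadruple_unitarizable:
  assumes "fin_dim S" "\<And>k. k < 4 \<Longrightarrow> cs.subspace (Vs k)" "\<And>k. k < 4 \<Longrightarrow> Vs k \<subseteq> S" "brick_on S 4 Vs"
  shows "unitarizable S 4 Vs"
  using assms
proof (induction "cs.dim S" arbitrary: S Vs rule: less_induct)
  case less
  note fd = less.prems(1) and sub = less.prems(2) and sub_S = less.prems(3) and brick = less.prems(4)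
  show ?case
  proof (cases "2 \<le> cs.dim S")
    case False
    have "Vs k = {0} \<or> Vs k = S" if k: "k < 4" for k
    proof (cases "cs.dim (Vs k) = 0")
      case True
      then show ?thesis using dim_zero_iff[OF fin_dim_mono[OF fd sub[OF k] sub_S[OF k]]] by simp
    next
      case nz: False
      then show ?thesis using dim_eq_imp_eq[OF fd sub[OF k] sub_S[OF k]] False by linarith
    qed
    then show ?thesis by (rule unitarizable_extreme[OF fd])
  next
    case True
    interpret large_brick S 4 Vs by (rule large_brick.intro[OF brick fd True sub sub_S])
    consider "(\<Sum>k<4. cs.dim (Vs k)) < 2 * cs.dim S" | "(\<Sum>k<4. cs.dim (Vs k)) > 2 * cs.dim S"
      | "(\<Sum>k<4. cs.dim (Vs k)) = 2 * cs.dim S" by linarith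
    then show ?thesis
    proof cases
      case 1
      obtain W where W: "fin_dim W" "linked 4 W S prj" "\<And>k. k < 4 \<Longrightarrow> prj k ` W = Vs k"
        using kernel_linked by blast
      interpret L: linked 4 W S prj by (rule W(2))
      let ?Ws = "\<lambda>k. {w \<in> W. prj k w = 0}"
      have "cs.dim S + cs.dim W = (\<Sum>k<4. cs.dim (Vs k))"
        unfolding L.dim_linked(2)[OF W(1)] by (intro sum.cong) (auto simp: W(3))
      then have "cs.dim W < cs.dim S" using 1 by linarith
      moreover have "cs.subspace (?Ws k)" for k
        using L.W cp.linear_subspace_kernel[OF lin_prj] by (auto simp: cs.subspace_def)
      moreover have "brick_on W 4 ?Ws"
        by (rule L.brick_on_source[OF brick_on_cong[OF brick]]) (simp add: W(3))
      ultimately have "unitarizable W 4 ?Ws" by (intro less.hyps W(1)) auto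
      from L.unitarizable_target[OF this] show ?thesis
        by (rule unitarizable_cong) (simp add: W(3))
    next
      case 2
      obtain V s where L: "linked 4 S V s" and ker: "\<And>k. k < 4 \<Longrightarrow> {w \<in> S. s k w = 0} = Vs k"
        using cokernel_linked by blast
      interpret L: linked 4 S V s by (rule L)
      let ?Us = "\<lambda>k. s k ` S"
      have dim: "cs.dim (?Us k) + cs.dim (Vs k) = cs.dim S" if k: "k < 4" for k
        using rank_nullity[OF fd L.s[OF k]] unfolding ker[OF k] by simp
      have "(\<Sum>k<4. cs.dim (?Us k)) + (\<Sum>k<4. cs.dim (Vs k)) = (\<Sum>k<4::nat. cs.dim S)"
        unfolding sum.distrib[symmetric] by (intro sum.cong refl dim) simp
      then have "cs.dim V < cs.dim S" using L.dim_linked(2)[OF fd] 2 by simp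
      moreover have "fin_dim V" by (rule L.dim_linked(1)[OF fd])
      moreover have "cs.subspace (?Us k)" if "k < 4" for k
        by (rule cp.linear_subspace_image[OF L.s[OF that] subS])
      moreover have "?Us k \<subseteq> V" if "k < 4" for k using L.s_in[OF that] by blast
      moreover have "brick_on V 4 ?Us"
        by (rule L.brick_on_target[OF brick_on_cong[OF brick]]) (simp add: ker)
      ultimately have "unitarizable V 4 ?Us" by (intro less.hyps)
      from L.unitarizable_source[OF this] show ?thesis
        by (rule unitarizable_cong) (simp add: ker)
    next
      case 3
      interpret balanced_quadruple S Vs by unfold_locales (rule 3)
      show ?thesis by (rule balanced_unitarizable)
    qed
  qed
qed

lemma brick_quadruple_realizable:
  assumes brick: "brick (V, Us)" and len: "length Us = 4"
  shows "realizable (V, Us)"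
proof -
  have vs: "vectorspace complex_field V" and fd: "vectorspace.fin_dim complex_field V"
    and sub: "\<And>U. U \<in> set Us \<Longrightarrow> VectorSpace.subspace complex_field U V"
    using brick by auto
  obtain \<kappa> S where p: "presentation V \<kappa> S {0}" and S: "fin_dim S"
    using presentation_exists[OF vs fd] by blast
  let ?Vs = "\<lambda>k. {x \<in> S. \<kappa> x \<in> Us ! k}"
  have "unitarizable S 4 ?Vs"
  proof (rule brick_on_quadruple_unitarizable[OF S])
    show "cs.subspace (?Vs k)" if "k < 4" for k
      using presentation_subspace[OF p sub[OF nth_mem]] that len by simp
    show "brick_on S 4 ?Vs" using presentation_brick[OF p brick] len by simp
  qed auto
  moreover have "\<forall>U\<in>set Us. U \<subseteq> carrier V"
    using sub by (auto simp: VectorSpace.subspace_def submodule_def)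
  ultimately show ?thesis using vs p len by (intro realizableI[where \<kappa> = \<kappa> and S = S]) auto
qed

theorem theorem2:
  shows "(\<forall>L :: 'a collection. generated L \<longrightarrow> (\<exists>\<chi>. unitarized_with L \<chi>)) \<and>
         (\<forall>(V :: (complex, 'b) module) V1 V2 V3 V4.
            brick (V, [V1, V2, V3, V4]) \<longrightarrow>
            (\<exists>\<chi>. unitarized_with (V, [V1, V2, V3, V4]) \<chi>))"
proof (intro conjI allI impI)
  fix L :: "'a collection" assume L: "generated L"
  obtain V Us where "L = (V, Us)" by (cases L)
  with generated_realizable[OF L] show "\<exists>\<chi>. unitarized_with L \<chi>"
    using realizable_imp_unitarized by blast
next
  fix V :: "(complex, 'b) module" and V1 V2 V3 V4
  assume "brick (V, [V1, V2, V3, V4])"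
  then show "\<exists>\<chi>. unitarized_with (V, [V1, V2, V3, V4]) \<chi>"
    by (intro realizable_imp_unitarized brick_quadruple_realizable) auto
qed

end
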